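(* Let $p(\cdot):\mathbb R^n\to(0,\infty)$ satisfy $p(\cdot)\in LH$ and $0<p^-\le p^+<\infty$. Let $\phi,\varphi\in\mathcal S(\mathbb R^n)$ be any two functions each satisfying the admissibility condition (A). Then there is a constant $C\ge 1$ such that for all $f\in\mathcal S'_\infty$, with both quantities understood in $[0,\infty]$, $$C^{-1}\,\mathcal I_\varphi(f)\le \mathcal U_\phi(f)\le C\,\mathcal I_\varphi(f),$$ where $$\mathcal U_\phi(f)=\sup_{P}\left\{\frac{|P|}{\|\chi_P\|^2_{L^{p(\cdot)}}}\sum_{j=-\log_2\ell(P)}^\infty\ \sum_{\substack{Q\subset P\\ \ell(Q)=2^{-j}}}\Big(\sup_{z\in Q}|\tilde\phi_j\ast f(z)|\Big)^2|Q|\right\}^{1/2},$$ $$\mathcal I_\varphi(f)=\sup_{P}\left\{\frac{|P|}{\|\chi_P\|^2_{L^{p(\cdot)}}}\sum_{j=-\log_2\ell(P)}^\infty\ \sum_{\substack{Q\subset P\\ \ell(Q)=2^{-j}}}\Big(\inf_{z\in Q}|\tilde\varphi_j\ast f(z)|\Big)^2|Q|\right\}^{1/2},$$ and $P$, $Q$ run over dyadic cubes.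
   Context: Exponents: for measurable $p(\cdot):\mathbb R^n\to(0,\infty)$, $p^-=\inf p$, $p^+=\sup p$, and $\|f\|_{L^{p(\cdot)}}=\inf\{\lambda>0:\int_{\mathbb R^n}(|f(x)|/\lambda)^{p(x)}dx\le1\}$. $p(\cdot)\in LH$ means there is $C>0$ with $|p(x)-p(y)|\le C/(-\log|x-y|)$ for $0<|x-y|\le1/2$, and $|p(x)-p(y)|\le C/\log(e+|x|)$ for $|y|\ge|x|$. Spaces: $\mathcal S$ is the Schwartz space; $\mathcal S_\infty=\{f\in\mathcal S:\int f(x)x^\alpha dx=0\text{ for all }\alpha\}$; $\mathcal S'_\infty$ is its topological dual. Dyadic cubes: $N$ is a fixed positive integer, sufficiently large depending only on $n$, $p(\cdot)$ and the kernel functions involved. A dyadic cube is $Q=Q_{j\mathbf k}=\prod_{i=1}^n[2^{-j-N}k_i,2^{-j-N}(k_i+1))$, $j\in\mathbb Z$, $\mathbf k\in\mathbb Z^n$; one writes $\ell(Q)=2^{-j}$ (so the Euclidean side length is $2^{-N}\ell(Q)$). Notation: $\psi_j(x)=2^{jn}\psi(2^jx)$, $\tilde\psi(x)=\overline{\psi(-x)}$, $\tilde\psi_j=(\tilde\psi)_j$. Condition (A): two functions $\varphi,\psi\in\mathcal S$ form an admissible pair if $\hat\varphi,\hat\psi$ are supported in $\{1/2\le|\xi|\le2\}$, $|\hat\varphi(\xi)|,|\hat\psi(\xi)|\ge c>0$ for $3/5\le|\xi|\le5/3$, and $\sum_{j\in\mathbb Z}\overline{\hat\varphi(2^j\xi)}\hat\psi(2^j\xi)=1$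 for all $\xi\ne0$. A single function satisfies (A) if it is a member of some admissible pair. *)

theory Defs
  imports "HOL-Analysis.Analysis"
begin

section \<open>Variable exponents\<close>

definition p_minus :: "(real^'n \<Rightarrow> real) \<Rightarrow> ereal" where
  "p_minus p = (INF x. ereal (p x))"

definition p_plus :: "(real^'n \<Rightarrow> real) \<Rightarrow> ereal" where
  "p_plus p = (SUP x. ereal (p x))"

definition log_hoelder :: "(real^'n \<Rightarrow> real) \<Rightarrow> bool" where
  "log_hoelder p \<longleftrightarrow> (\<exists>C>0.
     (\<forall>x y. 0 < norm (x - y) \<and> norm (x - y) \<le> 1/2 \<longrightarrow>
        \<bar>p x - p y\<bar> \<le> C / (- ln (norm (x - y)))) \<and>
     (\<forall>x y. norm y \<ge> norm x \<longrightarrow>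
        \<bar>p x - p y\<bar> \<le> C / ln (exp 1 + norm x)))"

text \<open>The Luxemburg norm with values in the extended half-line: it is infinite
  if no \<open>\<lambda>\<close> qualifies.\<close>

definition Lp_norm :: "(real^'n \<Rightarrow> real) \<Rightarrow> (real^'n \<Rightarrow> 'b::real_normed_vector) \<Rightarrow> ennreal" where
  "Lp_norm p f = Inf {ennreal t |t::real. t > 0 \<and>
     (\<integral>\<^sup>+ x. ennreal ((norm (f x) / t) powr p x) \<partial>lebesgue) \<le> 1}"

section \<open>Schwartz functions\<close>

definition partial :: "'n \<Rightarrow> (real^'n \<Rightarrow> complex) \<Rightarrow> real^'n \<Rightarrow> complex" where
  "partial i f x = frechet_derivative f (at x) (axis i 1)"

text \<open>Instead of multi-indices, derivatives are indexed by the list of the coordinate directions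
  in which one differentiates successively.\<close>

definition partials :: "'n list \<Rightarrow> (real^'n \<Rightarrow> complex) \<Rightarrow> real^'n \<Rightarrow> complex" where
  "partials is f = foldr partial is f"

definition smooth :: "(real^'n \<Rightarrow> complex) \<Rightarrow> bool" where
  "smooth f \<longleftrightarrow> (\<forall>is. partials is f differentiable_on UNIV)"

definition schwartz :: "(real^'n \<Rightarrow> complex) set" where
  "schwartz = {f. smooth f \<and>
     (\<forall>k is. bdd_above (range (\<lambda>x. (1 + norm x) ^ k * norm (partials is f x))))}"

definition schwartz_seminorm :: "nat \<Rightarrow> 'n list \<Rightarrow> (real^'n \<Rightarrow> complex) \<Rightarrow> real" where
  "schwartz_seminorm k is f = (SUP x. (1 + norm x) ^ k * norm (partials is f x))"

definition schwartz_topology :: "(real^'n \<Rightarrow> complex) topology" where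
  "schwartz_topology = topology_generated_by
     {{g \<in> schwartz. schwartz_seminorm k is (\<lambda>x. g x - f x) < \<epsilon>} |k is f \<epsilon>.
        f \<in> schwartz \<and> 0 < \<epsilon>}"

text \<open>\<open>\<S>\<^sub>\<infinity>\<close>: all moments, including the one of order zero, vanish.\<close>

definition schwartz_inf :: "(real^'n \<Rightarrow> complex) set" where
  "schwartz_inf = {f \<in> schwartz. \<forall>\<alpha>::'n \<Rightarrow> nat.
     (LINT x|lborel. f x * of_real (\<Prod>i\<in>UNIV. (x $ i) ^ \<alpha> i)) = 0}"

text \<open>The topological dual of \<open>\<S>\<^sub>\<infinity>\<close>, which carries the subspace topology.  A functional is a
  function on all of \<^typ>\<open>real^'n \<Rightarrow> complex\<close>; its values off \<open>\<S>\<^sub>\<infinity>\<close> are irrelevant.\<close>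

definition schwartz_inf_dual :: "((real^'n \<Rightarrow> complex) \<Rightarrow> complex) set" where
  "schwartz_inf_dual = {u.
     (\<forall>f\<in>schwartz_inf. \<forall>g\<in>schwartz_inf. u (\<lambda>x. f x + g x) = u f + u g) \<and>
     (\<forall>f\<in>schwartz_inf. \<forall>c. u (\<lambda>x. c * f x) = c * u f) \<and>
     continuous_map (subtopology schwartz_topology schwartz_inf) euclidean u}"

section \<open>Dilation, reflection, convolution and Fourier transform\<close>

definition dilate :: "int \<Rightarrow> (real^'n \<Rightarrow> complex) \<Rightarrow> real^'n \<Rightarrow> complex" where
  "dilate j f x = of_real (2 powi (j * int CARD('n))) * f ((2 powi j) *\<^sub>R x)"

definition tilde :: "(real^'n \<Rightarrow> complex) \<Rightarrow> real^'n \<Rightarrow> complex" where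
  "tilde f x = cnj (f (- x))"

text \<open>The pairing of distributions with test functions is bilinear, so the convolution with a
  test function involves no conjugation.\<close>

definition conv_dist ::
    "(real^'n \<Rightarrow> complex) \<Rightarrow> ((real^'n \<Rightarrow> complex) \<Rightarrow> complex) \<Rightarrow> real^'n \<Rightarrow> complex" where
  "conv_dist g u z = u (\<lambda>y. g (z - y))"

text \<open>Normalisation: \<open>\<integral> f(x) e\<^sup>-\<^sup>i\<^sup>x\<^sup>\<cdot>\<^sup>\<xi> dx\<close>, without \<open>2\<pi>\<close> in the exponent.\<close>

definition fourier :: "(real^'n \<Rightarrow> complex) \<Rightarrow> real^'n \<Rightarrow> complex" where
  "fourier f \<xi> = (LINT x|lborel. f x * cis (- (x \<bullet> \<xi>)))"

definition admissible_pair :: "(real^'n \<Rightarrow> complex) \<Rightarrow> (real^'n \<Rightarrow> complex) \<Rightarrow> bool" where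
  "admissible_pair \<phi> \<psi> \<longleftrightarrow>
     \<phi> \<in> schwartz \<and> \<psi> \<in> schwartz \<and>
     closure {\<xi>. fourier \<phi> \<xi> \<noteq> 0} \<subseteq> {\<xi>. 1/2 \<le> norm \<xi> \<and> norm \<xi> \<le> 2} \<and>
     closure {\<xi>. fourier \<psi> \<xi> \<noteq> 0} \<subseteq> {\<xi>. 1/2 \<le> norm \<xi> \<and> norm \<xi> \<le> 2} \<and>
     (\<exists>c>0. \<forall>\<xi>. 3/5 \<le> norm \<xi> \<and> norm \<xi> \<le> 5/3 \<longrightarrow>
        norm (fourier \<phi> \<xi>) \<ge> c \<and> norm (fourier \<psi> \<xi>) \<ge> c) \<and>
     (\<forall>\<xi>. \<xi> \<noteq> 0 \<longrightarrow>
        ((\<lambda>j::int. cnj (fourier \<phi> ((2 powi j) *\<^sub>R \<xi>)) * fourier \<psi> ((2 powi j) *\<^sub>R \<xi>))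
           has_sum 1) UNIV)"

definition admissible :: "(real^'n \<Rightarrow> complex) \<Rightarrow> bool" where
  "admissible \<phi> \<longleftrightarrow> (\<exists>\<psi>. admissible_pair \<phi> \<psi> \<or> admissible_pair \<psi> \<phi>)"

section \<open>Dyadic cubes and the two quantities\<close>

text \<open>\<open>dyadic_cube N j k\<close> is \<open>Q\<^sub>j\<^sub>k\<close>.  Its nominal length \<open>\<ell>(Q)\<close> is \<open>2\<^sup>-\<^sup>j\<close>, although its sides have
  Euclidean length \<open>2\<^sup>-\<^sup>j\<^sup>-\<^sup>N\<close>; thus \<open>- log\<^sub>2 \<ell>(Q) = j\<close>.\<close>

definition dyadic_cube :: "nat \<Rightarrow> int \<Rightarrow> int^'n \<Rightarrow> (real^'n) set" where
  "dyadic_cube N j k = {x. \<forall>i.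
     2 powi (- j - int N) * of_int (k $ i) \<le> x $ i \<and>
     x $ i < 2 powi (- j - int N) * (of_int (k $ i) + 1)}"

text \<open>The square root on the extended half-line.\<close>

definition ennsqrt :: "ennreal \<Rightarrow> ennreal" where
  "ennsqrt x = (if x = top then top else ennreal (sqrt (enn2real x)))"

text \<open>The expression common to both quantities, for a given choice \<open>a j Q\<close> of the quantity attached
  to a cube \<open>Q\<close> with \<open>\<ell>(Q) = 2\<^sup>-\<^sup>j\<close>.  The supremum over \<open>P\<close> is over its indices \<open>i\<close>, \<open>m\<close>, and
  the sum over \<open>Q\<close> is over its index \<open>k\<close>.\<close>

definition carleson ::
    "nat \<Rightarrow> (real^'n \<Rightarrow> real) \<Rightarrow> (int \<Rightarrow> (real^'n) set \<Rightarrow> ennreal) \<Rightarrow> ennreal" where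
  "carleson N p a = (SUP (i, m).
     let P = dyadic_cube N i m in
     ennsqrt (emeasure lborel P / (Lp_norm p (indicat_real P))\<^sup>2 *
       (\<Sum>\<^sub>\<infinity>j\<in>{i..}. \<Sum>\<^sub>\<infinity>k\<in>{k. dyadic_cube N j k \<subseteq> P}.
          (a j (dyadic_cube N j k))\<^sup>2 * emeasure lborel (dyadic_cube N j k))))"

definition U_quantity ::
    "nat \<Rightarrow> (real^'n \<Rightarrow> real) \<Rightarrow> (real^'n \<Rightarrow> complex) \<Rightarrow>
     ((real^'n \<Rightarrow> complex) \<Rightarrow> complex) \<Rightarrow> ennreal" where
  "U_quantity N p \<phi> f = carleson N p
     (\<lambda>j Q. SUP z\<in>Q. ennreal (norm (conv_dist (dilate j (tilde \<phi>)) f z)))"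

definition I_quantity ::
    "nat \<Rightarrow> (real^'n \<Rightarrow> real) \<Rightarrow> (real^'n \<Rightarrow> complex) \<Rightarrow>
     ((real^'n \<Rightarrow> complex) \<Rightarrow> complex) \<Rightarrow> ennreal" where
  "I_quantity N p \<phi> f = carleson N p
     (\<lambda>j Q. INF z\<in>Q. ennreal (norm (conv_dist (dilate j (tilde \<phi>)) f z)))"

end

theory Submission
  imports Defs "HOL-Probability.Characteristic_Functions" "HOL-Probability.Sinc_Integral"
begin

text \<open>
  Since \<open>I_quantity \<le> U_quantity\<close> for one and the same function, both inequalities follow from the
  single estimate \<open>U_quantity N p \<phi> f \<le> K * I_quantity N p \<phi>' f\<close> for arbitrary admissible
  \<open>\<phi>\<close>, \<open>\<phi>'\<close>: it is applied once to \<open>(\<phi>, \<phi>')\<close> and once to \<open>(\<phi>', \<phi>)\<close>.  Write \<open>\<Phi>\<close>, \<open>\<Phi>'\<close> for the complex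
  conjugates of \<open>\<phi>\<close>, \<open>\<phi>'\<close>.  The value of the convolution of \<open>f\<close> with the \<open>j\<close>-th dilate at \<open>z\<close> is
  \<open>f\<close> applied to the translate by \<open>z\<close> of \<open>dilate j \<Phi>\<close>.  Three ingredients carry the estimate.

  Reproduction.  The admissibility of \<open>\<phi>'\<close> gives, on the Fourier side,
  \<open>\<Phi> = (\<Sum>\<bar>m\<bar> \<le> 2. g m \<star> dilate m \<Phi>')\<close> and \<open>\<Phi>' = \<eta> \<star> \<Phi>'\<close> with rapidly decreasing \<open>g m\<close> and \<open>\<eta>\<close>
  (\<open>reproducing_identity\<close>).  A continuous functional may be applied under such an integral, up to
  constants: the integral is a limit in the Schwartz topology of finite combinations of translates
  (\<open>functional_superposition\<close>).  Hence \<open>f\<close> at the \<open>j\<close>-th scale of \<open>\<Phi>\<close> is controlled by \<open>f\<close> at the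
  scales \<open>j - 2\<close> to \<open>j + 2\<close> of \<open>\<Phi>'\<close>, with any power of decay in the distance.

  Sampling.  Let \<open>u x\<close> be the value of the functional at the translate of \<open>\<Phi>'\<close> by \<open>x\<close>.  The identity
  \<open>\<Phi>' = \<eta> \<star> \<Phi>'\<close> shows that \<open>u\<close> oscillates on a cube of side \<open>2\<^sup>-\<^sup>N\<close> by at most a multiple of \<open>2\<^sup>-\<^sup>N\<close> times a weighted
  supremum of \<open>\<bar>u\<bar>\<close>.  For large \<open>N\<close> this is absorbed, and the weighted supremum of \<open>\<bar>u\<bar>\<close> is
  controlled by the infima of \<open>\<bar>u\<bar>\<close> over the cubes (\<open>sampling\<close>).  Absorption needs the supremum to
  be finite, and the polynomial growth of \<open>u\<close> depends on \<open>f\<close>, whereas \<open>N\<close> must not.  An additional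
  weight \<open>(1 + \<epsilon> * norm x) ^ M\<close> provides finiteness; for small \<open>\<epsilon>\<close> it changes the oscillation
  constant by a factor two only, and it disappears as \<open>\<epsilon>\<close> tends to zero.

  Summation.  The two steps give \<open>pointwise_domination\<close>: the supremum over \<open>Q\<close> is bounded by the
  infima over all cubes \<open>R\<close> of neighbouring generations, with decay in the distance from \<open>Q\<close> to \<open>R\<close>.
  In the sum for a cube \<open>P\<close>, the cubes \<open>R\<close> are grouped according to the cube \<open>P'\<close>, comparable to \<open>P\<close>
  in size, that contains them.  Each group contributes at most the Carleson sum of \<open>P'\<close>, and the
  decay beats both the number of the cubes \<open>P'\<close> and the quotient of the norms of the
  characteristic functions of \<open>P'\<close> and \<open>P\<close>, which grows at most polynomially in the relative distance
  because the exponent is log-Hoelder continuous (\<open>Lp_norm_indicator_growth\<close>).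
\<close>

section \<open>Integration\<close>

text \<open>Lebesgue measure on \<^typ>\<open>real^'n\<close> is the image of the product of one-dimensional Lebesgue
  measures under the map that sends coordinates to the vector with these coordinates.\<close>

lemma prod_vec_integral:
  fixes f :: "'n::finite \<Rightarrow> real \<Rightarrow> 'b::{real_normed_field,banach,second_countable_topology}"
  assumes f: "\<And>i. integrable lborel (f i)"
  shows "integrable lborel (\<lambda>x::real^'n. \<Prod>i\<in>UNIV. f i (x $ i))"
    and "(LINT x|lborel. (\<Prod>i\<in>UNIV. f i ((x::real^'n) $ i))) = (\<Prod>i\<in>UNIV. LINT t|lborel. f i t)"
proof -
  interpret product_sigma_finite "\<lambda>_::real^'n. lborel::real measure" ..
  let ?P = "\<Pi>\<^sub>M b\<in>(Basis::(real^'n) set). (lborel::real measure)"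
  let ?T = "\<lambda>h. \<Sum>b\<in>(Basis::(real^'n) set). h b *\<^sub>R b"
  have bij: "bij_betw (\<lambda>i. axis i 1) (UNIV::'n set) (Basis::(real^'n) set)"
    by (auto simp: bij_betw_def inj_on_def axis_eq_axis Basis_vec_def)
  define ix where "ix = the_inv_into (UNIV::'n set) (\<lambda>i. axis i 1 :: real^'n)"
  have inj: "inj (\<lambda>i::'n. axis i 1 :: real^'n)" by (auto simp: inj_on_def axis_eq_axis)
  have ix: "ix (axis i 1) = i" for i unfolding ix_def by (rule the_inv_into_f_f[OF inj]) simp
  have T: "(?T h) $ i = h (axis i 1)" for h and i :: 'n
  proof -
    have "?T h = (\<Sum>j\<in>UNIV. h (axis j 1) *\<^sub>R axis j 1)"
      by (rule sum.reindex_bij_betw[OF bij, symmetric])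
    thus ?thesis by (simp add: axis_def if_distrib sum.delta cong: if_cong)
  qed
  have eq: "(\<Prod>i\<in>UNIV. f i (?T h $ i)) = (\<Prod>b\<in>Basis. f (ix b) (h b))" for h
    unfolding T by (subst prod.reindex_bij_betw[OF bij, symmetric]) (simp add: ix)
  have [measurable]: "f i \<in> borel_measurable borel" for i
    using borel_measurable_integrable[OF f[of i]] by simp
  have Tm[measurable]: "?T \<in> measurable ?P borel" by measurable
  have m[measurable]: "(\<lambda>x::real^'n. \<Prod>i\<in>UNIV. f i (x $ i)) \<in> borel_measurable borel"
    by measurable
  have int: "integrable ?P (\<lambda>h. \<Prod>b\<in>Basis. f (ix b) (h b))"
    by (rule product_integrable_prod) (auto simp: f)
  show "integrable lborel (\<lambda>x::real^'n. \<Prod>i\<in>UNIV. f i (x $ i))"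
    unfolding lborel_eq[where 'a="real^'n"]
    by (subst integrable_distr_eq[OF Tm m]) (simp only: eq int)
  have "(LINT x|lborel. (\<Prod>i\<in>UNIV. f i ((x::real^'n) $ i))) = (LINT h|?P. (\<Prod>b\<in>Basis. f (ix b) (h b)))"
    unfolding lborel_eq[where 'a="real^'n"] by (subst integral_distr[OF Tm m]) (simp only: eq)
  also have "\<dots> = (\<Prod>b\<in>(Basis::(real^'n) set). LINT t|lborel. f (ix b) t)"
    by (rule product_integral_prod) (auto simp: f)
  also have "\<dots> = (\<Prod>i\<in>UNIV. LINT t|lborel. f i t)"
    by (subst prod.reindex_bij_betw[OF bij, symmetric]) (simp add: ix)
  finally show "(LINT x|lborel. (\<Prod>i\<in>UNIV. f i ((x::real^'n) $ i))) = (\<Prod>i\<in>UNIV. LINT t|lborel. f i t)" .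
qed

lemma integral_affine:
  fixes f :: "real^'n \<Rightarrow> 'b::{banach,second_countable_topology}"
  assumes c: "c \<noteq> 0" and f[measurable]: "f \<in> borel_measurable borel"
  shows "integrable lborel f \<longleftrightarrow> integrable lborel (\<lambda>x. f (c *\<^sub>R x + b))"
    and "(LINT x|lborel. f x) = \<bar>c\<bar> ^ CARD('n) *\<^sub>R (LINT x|lborel. f (c *\<^sub>R x + b))"
proof -
  have E: "lborel = density (distr lborel borel (\<lambda>x::real^'n. b + c *\<^sub>R x)) (\<lambda>_. ennreal (\<bar>c\<bar> ^ CARD('n)))"
    using lborel_affine[OF c, of b] by (simp add: ennreal_power)
  show "integrable lborel f \<longleftrightarrow> integrable lborel (\<lambda>x. f (c *\<^sub>R x + b))"
  proof -
    have "integrable lborel (\<lambda>x. f (c *\<^sub>R x + b))"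
      if "integrable lborel (\<lambda>x. \<bar>c\<bar> ^ CARD('n) *\<^sub>R f (c *\<^sub>R x + b))"
      using integrable_scaleR_right[of "inverse (\<bar>c\<bar> ^ CARD('n))", OF that] c by simp
    thus ?thesis
      by (subst E, subst integrable_density) (auto simp: integrable_distr_eq add.commute)
  qed
  show "(LINT x|lborel. f x) = \<bar>c\<bar> ^ CARD('n) *\<^sub>R (LINT x|lborel. f (c *\<^sub>R x + b))"
    by (subst E, subst integral_density) 
      (use c in \<open>auto simp: integral_distr add.commute\<close>)
qed

text \<open>The power \<open>2 * CARD('n)\<close> is a convenient one for which the function is integrable: it is dominated
  by the product of the one-dimensional functions \<open>1 / (1 + t\<^sup>2)\<close>.\<close>

definition weight :: "real^'n \<Rightarrow> real" where
  "weight x = inverse ((1 + norm x) ^ (2 * CARD('n)))"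

lemma weight_nonneg: "0 \<le> weight x"
  by (simp add: weight_def)

lemma weight_measurable[measurable]: "weight \<in> borel_measurable borel"
  unfolding weight_def[abs_def] by measurable

lemma integrable_weight: "integrable lborel (weight :: real^'n \<Rightarrow> real)"
proof (rule Bochner_Integration.integrable_bound)
  have "integrable lborel (\<lambda>t::real. inverse (1 + t\<^sup>2))"
    using integrable_inverse_1_plus_square by (simp add: set_integrable_def)
  then show "integrable lborel (\<lambda>x::real^'n. \<Prod>i\<in>UNIV. inverse (1 + (x $ i)\<^sup>2))"
    by (rule prod_vec_integral(1))
  show "AE x in lborel. norm (weight x) \<le> norm (\<Prod>i\<in>UNIV. inverse (1 + ((x::real^'n) $ i)\<^sup>2))"
  proof (rule AE_I2)
    fix x :: "real^'n"
    have "weight x = (\<Prod>i\<in>(UNIV::'n set). inverse ((1 + norm x)\<^sup>2))"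
      by (simp add: weight_def power_mult power_inverse)
    also have "\<dots> \<le> (\<Prod>i\<in>UNIV. inverse (1 + (x $ i)\<^sup>2))"
    proof (rule prod_mono, safe)
      fix i :: 'n
      have "(x $ i)\<^sup>2 \<le> (norm x)\<^sup>2"
        using component_le_norm_cart[of x i] by (metis abs_le_square_iff abs_norm_cancel)
      hence "1 + (x $ i)\<^sup>2 \<le> (1 + norm x)\<^sup>2"
        using norm_ge_zero[of x] by (simp add: power2_eq_square algebra_simps del: norm_ge_zero)
      thus "inverse ((1 + norm x)\<^sup>2) \<le> inverse (1 + (x $ i)\<^sup>2)"
        by (intro le_imp_inverse_le) (auto simp: add_pos_nonneg)
    qed auto
    finally show "norm (weight x) \<le> norm (\<Prod>i\<in>UNIV. inverse (1 + (x $ i)\<^sup>2))"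
      using weight_nonneg[of x] by (simp add: prod_nonneg)
  qed
qed auto

section \<open>Continuous functions of rapid decay\<close>

text \<open>These are the properties of Schwartz functions that survive convolution for elementary reasons
  and suffice for Fourier uniqueness; derivatives are not involved.\<close>

definition rapid :: "(real^'n \<Rightarrow> complex) \<Rightarrow> bool" where
  "rapid f \<longleftrightarrow> continuous_on UNIV f \<and> (\<forall>K::nat. \<exists>C. \<forall>x. (1 + norm x) ^ K * norm (f x) \<le> C)"

lemma rapid_cont: "rapid f \<Longrightarrow> continuous_on UNIV f"
  by (simp add: rapid_def)

lemma rapid_measurable: "rapid f \<Longrightarrow> f \<in> borel_measurable borel"
  by (simp add: rapid_def borel_measurable_continuous_onI)

lemma rapid_bound:
  assumes "rapid f" obtains C where "C \<ge> 1" "\<And>x. (1 + norm x) ^ K * norm (f x) \<le> C"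
proof -
  obtain C where "\<And>x. (1 + norm x) ^ K * norm (f x) \<le> C" using assms by (auto simp: rapid_def)
  hence "\<And>x. (1 + norm x) ^ K * norm (f x) \<le> max C 1" by (simp add: le_max_iff_disj)
  thus ?thesis using that[of "max C 1"] by auto
qed

lemma rapid_bound_weight:
  fixes f :: "real^'n \<Rightarrow> complex"
  assumes "rapid f" obtains C where "C \<ge> 1" "\<And>x. (1 + norm x) ^ K * norm (f x) \<le> C * weight x"
proof -
  obtain C where "C \<ge> 1" and C: "\<And>x. (1 + norm x) ^ (K + 2 * CARD('n)) * norm (f x) \<le> C"
    using rapid_bound[OF assms] by metis
  have "(1 + norm x) ^ K * norm (f x) \<le> C * weight x" for x
    using C[of x] by (simp add: weight_def divide_inverse[symmetric] pos_le_divide_eq power_add mult.assoc mult.left_commute mult.commute add_pos_nonneg)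
  thus ?thesis using that \<open>C \<ge> 1\<close> by blast
qed

lemma rapid_integrable_mult:
  fixes f h :: "real^'n \<Rightarrow> complex"
  assumes "rapid f" and h[measurable]: "h \<in> borel_measurable borel"
    and hb: "\<And>x. norm (h x) \<le> B * (1 + norm x) ^ K"
  shows "integrable lborel (\<lambda>x. f x * h x)"
proof -
  obtain C where C: "C \<ge> 1" "\<And>x. (1 + norm x) ^ K * norm (f x) \<le> C * weight x"
    using rapid_bound_weight[OF assms(1)] by metis
  have B: "0 \<le> B" using order_trans[OF norm_ge_zero hb[of 0]] by simp
  show ?thesis
  proof (rule Bochner_Integration.integrable_bound)
  show "integrable lborel (\<lambda>x::real^'n. B * (C * weight x))" using integrable_weight[where 'n='n] by simp
  show "(\<lambda>x. f x * h x) \<in> borel_measurable lborel"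
    using rapid_measurable[OF assms(1)] by simp
  show "AE x in lborel. norm (f x * h x) \<le> norm (B * (C * weight x))"
  proof (rule AE_I2)
    fix x
    have "norm (f x * h x) \<le> norm (f x) * (B * (1 + norm x) ^ K)"
      by (simp add: norm_mult mult_left_mono hb)
    also have "\<dots> = B * ((1 + norm x) ^ K * norm (f x))" by simp
    also have "\<dots> \<le> B * (C * weight x)" using B C by (intro mult_left_mono) auto
    finally show "norm (f x * h x) \<le> norm (B * (C * weight x))" by simp
  qed
qed
qed

lemma rapid_integrable: "rapid f \<Longrightarrow> integrable lborel f"
  using rapid_integrable_mult[of f "\<lambda>_. 1" 1 0] by simp

lemma rapid_integrable_moment: "rapid f \<Longrightarrow> integrable lborel (\<lambda>x. (1 + norm x) ^ K * norm (f x))"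
  using integrable_norm[OF rapid_integrable_mult[of f "\<lambda>x. of_real ((1 + norm x) ^ K)" 1 K]]
  by (simp add: norm_mult mult.commute del: of_real_power of_real_add)

lemma one_plus_norm_add: "1 + norm (x + y) \<le> (1 + norm x) * (1 + norm (y::'a::real_normed_vector))"
  using norm_triangle_ineq[of x y] mult_nonneg_nonneg[of "norm x" "norm y"]
  by (simp add: algebra_simps del: mult_nonneg_nonneg)

lemma one_plus_norm_diff: "1 + norm x \<le> (1 + norm (x - y)) * (1 + norm (y::'a::real_normed_vector))"
  using one_plus_norm_add[of "x - y" y] by simp

lemma one_plus_norm_pow_add:
  "(1 + norm (x + y)) ^ K \<le> (1 + norm x) ^ K * (1 + norm (y::'a::real_normed_vector)) ^ K"
  unfolding power_mult_distrib[symmetric] by (intro power_mono one_plus_norm_add) simp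

lemma one_plus_norm_pow_diff:
  "(1 + norm x) ^ K \<le> (1 + norm (x - y)) ^ K * (1 + norm (y::'a::real_normed_vector)) ^ K"
  using one_plus_norm_pow_add[of "x - y" y K] by simp

lemma rapid_affine:
  assumes f: "rapid f" and c: "c \<noteq> 0"
  shows "rapid (\<lambda>x. f (c *\<^sub>R x + b))"
  unfolding rapid_def
proof safe
  show "continuous_on UNIV (\<lambda>x. f (c *\<^sub>R x + b))"
    by (rule continuous_on_compose2[OF rapid_cont[OF f]]) (auto intro!: continuous_intros)
  fix K :: nat
  obtain C where C: "C \<ge> 1" "\<And>x. (1 + norm x) ^ K * norm (f x) \<le> C"
    using rapid_bound[OF f] by metis
  define A where "A = (1 + inverse \<bar>c\<bar>) * (1 + norm b)"
  have A: "1 + norm x \<le> A * (1 + norm (c *\<^sub>R x + b))" for x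
  proof -
    have "norm x = inverse \<bar>c\<bar> * norm (c *\<^sub>R x)" using c by simp
    hence "1 + norm x \<le> (1 + inverse \<bar>c\<bar>) * (1 + norm (c *\<^sub>R x))"
      using c by (simp add: field_simps)
    also have "\<dots> \<le> (1 + inverse \<bar>c\<bar>) * ((1 + norm (c *\<^sub>R x + b)) * (1 + norm (- b)))"
      using one_plus_norm_add[of "c *\<^sub>R x + b" "- b"] by (intro mult_left_mono) auto
    finally show ?thesis by (simp add: A_def mult_ac)
  qed
  have A0: "A \<ge> 0" by (simp add: A_def)
  have "(1 + norm x) ^ K * norm (f (c *\<^sub>R x + b)) \<le> A ^ K * C" for x
  proof -
    have "(1 + norm x) ^ K \<le> A ^ K * (1 + norm (c *\<^sub>R x + b)) ^ K"
      unfolding power_mult_distrib[symmetric] by (rule power_mono[OF A]) simp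
    hence "(1 + norm x) ^ K * norm (f (c *\<^sub>R x + b)) \<le>
        A ^ K * ((1 + norm (c *\<^sub>R x + b)) ^ K * norm (f (c *\<^sub>R x + b)))"
      unfolding mult.assoc[symmetric] by (rule mult_right_mono) simp
    also have "\<dots> \<le> A ^ K * C" by (intro mult_left_mono C) (simp add: A0)
    finally show ?thesis .
  qed
  thus "\<exists>C. \<forall>x. (1 + norm x) ^ K * norm (f (c *\<^sub>R x + b)) \<le> C" by blast
qed

lemma rapid_cmult: "rapid f \<Longrightarrow> rapid (\<lambda>x. c * f x)"
  unfolding rapid_def
proof safe
  fix K assume "\<forall>K. \<exists>C. \<forall>x. (1 + norm x) ^ K * norm (f x) \<le> C"
  then obtain C where "\<And>x. (1 + norm x) ^ K * norm (f x) \<le> C" by blast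
  hence "\<And>x. norm c * ((1 + norm x) ^ K * norm (f x)) \<le> norm c * C" by (intro mult_left_mono) auto
  thus "\<exists>C. \<forall>x. (1 + norm x) ^ K * norm (c * f x) \<le> C" by (auto simp: norm_mult mult_ac)
qed (auto intro!: continuous_intros)

lemma rapid_add: assumes "rapid f" "rapid g" shows "rapid (\<lambda>x. f x + g x)"
  unfolding rapid_def
proof safe
  show "continuous_on UNIV (\<lambda>x. f x + g x)" using assms by (intro continuous_intros rapid_cont)
  fix K :: nat
  obtain C where C: "\<And>x. (1 + norm x) ^ K * norm (f x) \<le> C"
    using rapid_bound[OF assms(1)] by metis
  obtain D where D: "\<And>x. (1 + norm x) ^ K * norm (g x) \<le> D"
    using rapid_bound[OF assms(2)] by metis
  have "(1 + norm x) ^ K * norm (f x + g x) \<le> C + D" for x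
  proof -
    have "(1 + norm x) ^ K * norm (f x + g x) \<le> (1 + norm x) ^ K * (norm (f x) + norm (g x))"
      by (intro mult_left_mono norm_triangle_ineq) simp
    thus ?thesis using C[of x] D[of x] by (simp add: algebra_simps)
  qed
  thus "\<exists>C. \<forall>x. (1 + norm x) ^ K * norm (f x + g x) \<le> C" by blast
qed

lemma rapid_diff: "rapid f \<Longrightarrow> rapid g \<Longrightarrow> rapid (\<lambda>x. f x - g x)"
  using rapid_add[of f "\<lambda>x. -1 * g x"] rapid_cmult[of g "-1"] by simp

lemma rapid_zero: "rapid (\<lambda>x. 0)" by (auto simp: rapid_def)

lemma rapid_sum: "(\<And>m. m \<in> F \<Longrightarrow> rapid (f m)) \<Longrightarrow> rapid (\<lambda>x. \<Sum>m\<in>F. f m x)"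
  by (induction F rule: infinite_finite_induct) (auto simp: rapid_zero intro: rapid_add)

lemma rapid_cnj: "rapid f \<Longrightarrow> rapid (\<lambda>x. cnj (f x))"
  unfolding rapid_def by (auto intro!: continuous_intros)

lemma rapid_dilate: "rapid f \<Longrightarrow> rapid (dilate j f)"
  unfolding dilate_def[abs_def] using rapid_affine[of f "2 powi j" 0] by (intro rapid_cmult) simp

section \<open>Convolution and the Fourier transform\<close>

definition convolve :: "(real^'n \<Rightarrow> complex) \<Rightarrow> (real^'n \<Rightarrow> complex) \<Rightarrow> real^'n \<Rightarrow> complex" where
  "convolve g k y = (LINT w|lborel. g w * k (y - w))"

lemma rapid_conv_integrable: 
  assumes g: "rapid g" and k: "rapid k"
  shows "integrable lborel (\<lambda>w. g w * k (y - w))"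
proof -
  obtain C where "\<And>x. (1 + norm x) ^ 0 * norm (k x) \<le> C" using rapid_bound[OF k] by metis
  thus ?thesis using rapid_measurable[OF k] 
    by (intro rapid_integrable_mult[OF g, of _ C 0]) auto
qed

lemma rapid_conv:
  assumes g: "rapid g" and k: "rapid k"
  shows "rapid (convolve g k)"
  unfolding rapid_def
proof safe
  have [measurable]: "g \<in> borel_measurable borel" "k \<in> borel_measurable borel"
    using assms by (simp_all add: rapid_measurable)
  obtain B where B: "\<And>x. norm (k x) \<le> B" using rapid_bound[OF k, of 0] by auto
  show "continuous_on UNIV (convolve g k)"
    unfolding continuous_on_eq_continuous_at[OF open_UNIV]
  proof safe
    fix y
    show "isCont (convolve g k) y"
    proof (rule continuous_at_sequentiallyI)
      fix u assume u: "u \<longlonglongrightarrow> y"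
      show "(\<lambda>i. convolve g k (u i)) \<longlonglongrightarrow> convolve g k y"
        unfolding convolve_def
      proof (rule integral_dominated_convergence[where w="\<lambda>w. B * norm (g w)"])
        show "integrable lborel (\<lambda>w. B * norm (g w))"
          using rapid_integrable[OF g] by (simp add: integrable_norm)
        show "AE x in lborel. (\<lambda>i. g x * k (u i - x)) \<longlonglongrightarrow> g x * k (y - x)"
          using rapid_cont[OF k] u
          by (intro AE_I2 tendsto_intros continuous_on_tendsto_compose[where f=k and s=UNIV]) auto
        show "AE x in lborel. norm (g x * k (u i - x)) \<le> B * norm (g x)" for i
          using B by (intro AE_I2) (auto simp: norm_mult mult.commute[of B] intro!: mult_left_mono)
      qed auto
    qed
  qed
  fix K :: nat
  obtain C where C: "C \<ge> 1" "\<And>x. (1 + norm x) ^ K * norm (k x) \<le> C" using rapid_bound[OF k] by metis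
  have "(1 + norm y) ^ K * norm (convolve g k y) \<le> C * (LINT w|lborel. (1 + norm w) ^ K * norm (g w))" for y
  proof -
    have "norm (convolve g k y) * (1 + norm y) ^ K \<le> (LINT w|lborel. norm (g w * k (y - w))) * (1 + norm y) ^ K"
      unfolding convolve_def by (intro mult_right_mono integral_norm_bound) simp
    also have "\<dots> = (LINT w|lborel. norm (g w * k (y - w)) * (1 + norm y) ^ K)" by simp
    also have "\<dots> \<le> (LINT w|lborel. C * ((1 + norm w) ^ K * norm (g w)))"
    proof (rule integral_mono)
      show "integrable lborel (\<lambda>w. norm (g w * k (y - w)) * (1 + norm y) ^ K)"
        using rapid_conv_integrable[OF g k] by (intro integrable_mult_left integrable_norm)
      show "integrable lborel (\<lambda>w. C * ((1 + norm w) ^ K * norm (g w)))"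
        using rapid_integrable_moment[OF g] by simp
      fix w
      have "norm (g w * k (y - w)) * (1 + norm y) ^ K \<le>
        norm (g w) * norm (k (y - w)) * ((1 + norm (y - w)) ^ K * (1 + norm w) ^ K)"
        unfolding norm_mult by (intro mult_left_mono one_plus_norm_pow_diff) simp
      also have "\<dots> = ((1 + norm (y - w)) ^ K * norm (k (y - w))) * ((1 + norm w) ^ K * norm (g w))"
        by (simp add: mult_ac)
      also have "\<dots> \<le> C * ((1 + norm w) ^ K * norm (g w))"
        by (intro mult_right_mono C) simp
      finally show "norm (g w * k (y - w)) * (1 + norm y) ^ K \<le> C * ((1 + norm w) ^ K * norm (g w))" .
    qed
    finally show ?thesis by (simp add: mult.commute)
  qed
  thus "\<exists>C. \<forall>y. (1 + norm y) ^ K * norm (convolve g k y) \<le> C" by blast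
qed

lemma fourier_integrable: "rapid f \<Longrightarrow> integrable lborel (\<lambda>x. f x * cis (- (x \<bullet> \<xi>)))"
  by (rule rapid_integrable_mult[where B=1 and K=0]) (auto intro!: borel_measurable_continuous_onI continuous_intros)

lemma fourier_add: "rapid f \<Longrightarrow> rapid g \<Longrightarrow> fourier (\<lambda>x. f x + g x) \<xi> = fourier f \<xi> + fourier g \<xi>"
  unfolding fourier_def by (simp add: distrib_right fourier_integrable)

lemma fourier_cmult: "fourier (\<lambda>x. c * f x) \<xi> = c * fourier f \<xi>"
  unfolding fourier_def by (simp add: mult.assoc)

lemma fourier_sum: "(\<And>m. m \<in> F \<Longrightarrow> rapid (f m)) \<Longrightarrow> fourier (\<lambda>x. \<Sum>m\<in>F. f m x) \<xi> = (\<Sum>m\<in>F. fourier (f m) \<xi>)"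
  unfolding fourier_def by (simp add: sum_distrib_right fourier_integrable)

lemma fourier_affine:
  fixes f :: "real^'n \<Rightarrow> complex"
  assumes f: "rapid f" and c: "c \<noteq> 0"
  shows "fourier (\<lambda>x. f (c *\<^sub>R x + b)) \<xi> =
    of_real (inverse (\<bar>c\<bar> ^ CARD('n))) * cis (inverse c * (b \<bullet> \<xi>)) * fourier f (inverse c *\<^sub>R \<xi>)"
proof -
  have [measurable]: "f \<in> borel_measurable borel" using f by (rule rapid_measurable)
  have m: "(\<lambda>x. f x * cis (- (x \<bullet> (inverse c *\<^sub>R \<xi>)))) \<in> borel_measurable borel"
    by (intro borel_measurable_continuous_onI continuous_intros rapid_cont[OF f])
  have "fourier f (inverse c *\<^sub>R \<xi>) = \<bar>c\<bar> ^ CARD('n) *\<^sub>R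
      (LINT x|lborel. f (c *\<^sub>R x + b) * cis (- ((c *\<^sub>R x + b) \<bullet> (inverse c *\<^sub>R \<xi>))))"
    unfolding fourier_def by (rule integral_affine(2)[OF c m])
  also have "(\<lambda>x. f (c *\<^sub>R x + b) * cis (- ((c *\<^sub>R x + b) \<bullet> (inverse c *\<^sub>R \<xi>)))) =
      (\<lambda>x. cis (- (inverse c * (b \<bullet> \<xi>))) * (f (c *\<^sub>R x + b) * cis (- (x \<bullet> \<xi>))))"
  proof
    fix x
    have "inverse c * (c * (x \<bullet> \<xi>) + b \<bullet> \<xi>) = x \<bullet> \<xi> + inverse c * (b \<bullet> \<xi>)"
      using c by (simp add: field_simps)
    thus "f (c *\<^sub>R x + b) * cis (- ((c *\<^sub>R x + b) \<bullet> (inverse c *\<^sub>R \<xi>))) =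
      cis (- (inverse c * (b \<bullet> \<xi>))) * (f (c *\<^sub>R x + b) * cis (- (x \<bullet> \<xi>)))"
      by (simp add: inner_add_left mult.left_commute cis_mult minus_diff_commute)
  qed
  also have "(LINT x|lborel. \<dots> x) = cis (- (inverse c * (b \<bullet> \<xi>))) * fourier (\<lambda>x. f (c *\<^sub>R x + b)) \<xi>"
    unfolding fourier_def by simp
  finally have E: "fourier f (inverse c *\<^sub>R \<xi>) = of_real (\<bar>c\<bar> ^ CARD('n)) * (cis (- (inverse c * (b \<bullet> \<xi>))) * fourier (\<lambda>x. f (c *\<^sub>R x + b)) \<xi>)"
    by (simp only: scaleR_conv_of_real)
  have 1: "complex_of_real (inverse (\<bar>c\<bar> ^ CARD('n))) * complex_of_real (\<bar>c\<bar> ^ CARD('n)) = 1"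
    using c by (simp flip: of_real_mult)
  have 2: "cis (inverse c * (b \<bullet> \<xi>)) * cis (- (inverse c * (b \<bullet> \<xi>))) = 1"
    by (simp add: cis_mult)
  have "complex_of_real (inverse (\<bar>c\<bar> ^ CARD('n))) * cis (inverse c * (b \<bullet> \<xi>)) * fourier f (inverse c *\<^sub>R \<xi>) =
      (complex_of_real (inverse (\<bar>c\<bar> ^ CARD('n))) * complex_of_real (\<bar>c\<bar> ^ CARD('n))) *
      (cis (inverse c * (b \<bullet> \<xi>)) * cis (- (inverse c * (b \<bullet> \<xi>)))) * fourier (\<lambda>x. f (c *\<^sub>R x + b)) \<xi>"
    unfolding E by (simp only: mult_ac)
  thus ?thesis unfolding 1 2 by simp
qed

lemma fourier_dilate:
  fixes f :: "real^'n \<Rightarrow> complex"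
  assumes f: "rapid f" shows "fourier (dilate j f) \<xi> = fourier f ((2 powi (- j)) *\<^sub>R \<xi>)"
proof -
  have "(2::real) powi (j * int CARD('n)) = (2 powi j) ^ CARD('n)"
    by (simp add: power_int_mult)
  thus ?thesis
    unfolding dilate_def[abs_def] fourier_cmult
    using fourier_affine[OF f, of "2 powi j" 0 \<xi>]
    by (simp add: power_int_minus)
qed

lemma fourier_reflect:
  assumes f: "rapid f" shows "fourier (\<lambda>x. f (- x)) \<xi> = fourier f (- \<xi>)"
  using fourier_affine[OF f, of "-1" 0 \<xi>] by simp

lemma fourier_cnj: "fourier (\<lambda>x. cnj (f x)) \<xi> = cnj (fourier f (- \<xi>))"
  unfolding fourier_def Bochner_Integration.integral_cnj[symmetric] by (simp add: cis_cnj)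

lemma fourier_conv:
  fixes g k :: "real^'n \<Rightarrow> complex"
  assumes g: "rapid g" and k: "rapid k"
  shows "fourier (convolve g k) \<xi> = fourier g \<xi> * fourier k \<xi>"
proof -
  have [measurable]: "g \<in> borel_measurable borel" "k \<in> borel_measurable borel"
    using assms by (simp_all add: rapid_measurable)
  have [measurable]: "(\<lambda>x::real^'n. cis (- (x \<bullet> \<xi>))) \<in> borel_measurable borel"
    by (intro borel_measurable_continuous_onI continuous_intros)
  have shift: "integrable lborel (\<lambda>y. h (y - w)) = integrable lborel h"
    "(LINT y|lborel. h (y - w)) = (LINT y|lborel. h y)" 
    if "h \<in> borel_measurable borel" for h :: "real^'n \<Rightarrow> 'b::{banach,second_countable_topology}" and w
    using integral_affine[of 1 h "-w"] that by auto
  have int: "integrable (lborel \<Otimes>\<^sub>M lborel) (\<lambda>(w, y). g w * k (y - w) * cis (- (y \<bullet> \<xi>)))"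
  proof (rule lborel_pair.Fubini_integrable)
    show "(\<lambda>(w, y). g w * k (y - w) * cis (- (y \<bullet> \<xi>))) \<in> borel_measurable (lborel \<Otimes>\<^sub>M lborel)"
      by measurable
    have "(\<lambda>w. LINT y|lborel. norm (g w * k (y - w) * cis (- (y \<bullet> \<xi>)))) = (\<lambda>w. norm (g w) * (LINT y|lborel. norm (k y)))"
      using shift(2)[of "\<lambda>y. norm (k y)"] by (simp add: norm_mult)
    thus "integrable lborel (\<lambda>w. LINT y|lborel. norm (case (w, y) of (w, y) \<Rightarrow> g w * k (y - w) * cis (- (y \<bullet> \<xi>))))"
      using rapid_integrable[OF g] by (simp add: integrable_norm)
    show "AE w in lborel. integrable lborel (\<lambda>y. case (w, y) of (w, y) \<Rightarrow> g w * k (y - w) * cis (- (y \<bullet> \<xi>)))"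
    proof (rule AE_I2)
      fix w
      have "integrable lborel (\<lambda>y. g w * (k (y - w) * cis (- (y \<bullet> \<xi>))))"
        using fourier_integrable[OF rapid_affine[OF k, of 1 "-w"]] by simp
      thus "integrable lborel (\<lambda>y. case (w, y) of (w, y) \<Rightarrow> g w * k (y - w) * cis (- (y \<bullet> \<xi>)))"
        by (simp add: mult.assoc)
    qed
  qed
  have "fourier (convolve g k) \<xi> = (LINT y|lborel. LINT w|lborel. g w * k (y - w) * cis (- (y \<bullet> \<xi>)))"
    unfolding fourier_def convolve_def by simp
  also have "\<dots> = (LINT w|lborel. LINT y|lborel. g w * k (y - w) * cis (- (y \<bullet> \<xi>)))"
    by (rule lborel_pair.Fubini_integral[OF int])
  also have "\<dots> = (LINT w|lborel. g w * (cis (- (w \<bullet> \<xi>)) * fourier k \<xi>))"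
  proof (rule Bochner_Integration.integral_cong)
    fix w
    have "(LINT y|lborel. g w * k (y - w) * cis (- (y \<bullet> \<xi>))) = g w * fourier (\<lambda>y. k (y - w)) \<xi>"
      unfolding fourier_def by (simp add: mult.assoc)
    thus "(LINT y|lborel. g w * k (y - w) * cis (- (y \<bullet> \<xi>))) = g w * (cis (- (w \<bullet> \<xi>)) * fourier k \<xi>)"
      using fourier_affine[OF k, of 1 "-w" \<xi>] by simp
  qed simp
  also have "\<dots> = fourier g \<xi> * fourier k \<xi>"
    unfolding fourier_def[of g] by (simp flip: mult.assoc)
  finally show ?thesis .
qed

lemma gaussian_fourier_1d:
  "(LINT t|lborel. complex_of_real (std_normal_density t) * cis (- (a * t))) = of_real (exp (- (a\<^sup>2) / 2))"
proof -
  have "char std_normal_distribution (- a) = of_real (exp (- (a\<^sup>2) / 2))"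
    by (simp add: char_std_normal_distribution)
  moreover have "char std_normal_distribution (- a) =
      (LINT t|lborel. std_normal_density t *\<^sub>R iexp (- a * t))"
    unfolding char_def by (subst integral_density) auto
  ultimately show ?thesis
    by (simp add: cis_conv_exp scaleR_conv_of_real)
qed

lemma gaussian_fourier:
  fixes z :: "real^'n"
  defines "\<gamma> \<equiv> \<lambda>\<xi>::real^'n. \<Prod>i\<in>UNIV. complex_of_real (std_normal_density (\<xi> $ i))"
  shows "integrable lborel \<gamma>"
    and "(LINT \<xi>|lborel. \<gamma> \<xi> * cis (- (z \<bullet> \<xi>))) = (\<Prod>i\<in>UNIV. of_real (exp (- ((z $ i)\<^sup>2) / 2)))"
proof -
  have i: "integrable lborel (\<lambda>t. complex_of_real (std_normal_density t))"
    using integrable_std_normal_moment[of 0] by simp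
  show "integrable lborel \<gamma>" unfolding \<gamma>_def using i by (rule prod_vec_integral(1))
  have i2: "integrable lborel (\<lambda>t. complex_of_real (std_normal_density t) * cis (- (a * t)))" for a
  proof (rule Bochner_Integration.integrable_bound[OF i])
    have [measurable]: "(\<lambda>t::real. cis (- (a * t))) \<in> borel_measurable borel"
      by (intro borel_measurable_continuous_onI continuous_intros)
    show "(\<lambda>t. complex_of_real (std_normal_density t) * cis (- (a * t))) \<in> borel_measurable lborel"
      by measurable
  qed (simp add: norm_mult)
  have "\<gamma> \<xi> * cis (- (z \<bullet> \<xi>)) =
     (\<Prod>i\<in>UNIV. complex_of_real (std_normal_density (\<xi> $ i)) * cis (- ((z $ i) * (\<xi> $ i))))" for \<xi>
  proof -
    have "cis (- (z \<bullet> \<xi>)) = (\<Prod>i\<in>UNIV. cis (- ((z $ i) * (\<xi> $ i))))"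
      by (simp add: inner_vec_def cis_conv_exp sum_distrib_left sum_negf flip: exp_sum)
    thus ?thesis by (simp add: \<gamma>_def prod.distrib)
  qed
  thus "(LINT \<xi>|lborel. \<gamma> \<xi> * cis (- (z \<bullet> \<xi>))) = (\<Prod>i\<in>UNIV. of_real (exp (- ((z $ i)\<^sup>2) / 2)))"
    using prod_vec_integral(2)[OF i2, of "\<lambda>i. z $ i"] by (simp only: gaussian_fourier_1d)
qed

text \<open>Integrating the transform of the rescaled function \<open>z \<mapsto> F (d *\<^sub>R z + x)\<close> against a Gaussian
  and exchanging the integrals shows that the Gaussian average of \<open>F\<close> around \<open>x\<close> at scale \<open>d\<close>
  vanishes.  As \<open>d\<close> tends to zero the average tends to a nonzero multiple of \<open>F x\<close>.\<close>

lemma fourier_inj_zero: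
  fixes F :: "real^'n \<Rightarrow> complex"
  assumes F: "rapid F" and zero: "\<And>\<xi>. fourier F \<xi> = 0"
  shows "F x = 0"
proof -
  define \<gamma> where "\<gamma> = (\<lambda>\<xi>::real^'n. \<Prod>i\<in>UNIV. complex_of_real (std_normal_density (\<xi> $ i)))"
  define E where "E = (\<lambda>z::real^'n. \<Prod>i\<in>UNIV. complex_of_real (exp (- ((z $ i)\<^sup>2) / 2)))"
  have [measurable]: "F \<in> borel_measurable borel" using F by (rule rapid_measurable)
  have \<gamma>i: "integrable lborel \<gamma>" unfolding \<gamma>_def by (rule gaussian_fourier(1))
  have [measurable]: "\<gamma> \<in> borel_measurable borel" using borel_measurable_integrable[OF \<gamma>i] by simp
  have \<gamma>E: "(LINT \<xi>|lborel. \<gamma> \<xi> * cis (- (z \<bullet> \<xi>))) = E z" for z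
    unfolding \<gamma>_def E_def by (rule gaussian_fourier(2))
  have eE: "complex_of_real (exp (- (t\<^sup>2) / 2)) = of_real (sqrt (2 * pi)) * of_real (std_normal_density t)" for t
  proof -
    have "exp (- (t\<^sup>2) / 2) = sqrt (2 * pi) * std_normal_density t" by (simp add: std_normal_density_def)
    thus ?thesis by (simp only: of_real_mult)
  qed
  have E\<gamma>: "E z = of_real (sqrt (2 * pi)) ^ CARD('n) * \<gamma> z" for z
    unfolding E_def eE \<gamma>_def by (simp add: prod.distrib)
  have Ei: "integrable lborel E" using \<gamma>i unfolding E\<gamma>[abs_def] by simp
  have [measurable]: "E \<in> borel_measurable borel" using borel_measurable_integrable[OF Ei] by simp
  have "(LINT t|lborel. complex_of_real (std_normal_density t)) = 1"
    using gaussian_fourier_1d[of 0] by simp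
  hence "integral\<^sup>L lborel \<gamma> = 1"
    unfolding \<gamma>_def
    using prod_vec_integral(2)[of "\<lambda>_::'n. \<lambda>t. complex_of_real (std_normal_density t)"] integrable_std_normal_moment[of 0]
    by simp
  hence E1: "integral\<^sup>L lborel E = of_real (sqrt (2 * pi)) ^ CARD('n)"
    unfolding E\<gamma>[abs_def] by simp
  have int0: "(LINT z|lborel. F (d *\<^sub>R z + x) * E z) = 0" if d: "d > 0" for d
  proof -
    have int: "integrable (lborel \<Otimes>\<^sub>M lborel) (\<lambda>(z, \<xi>). F (d *\<^sub>R z + x) * (\<gamma> \<xi> * cis (- (z \<bullet> \<xi>))))"
    proof (rule lborel_pair.Fubini_integrable)
      show "(\<lambda>(z, \<xi>). F (d *\<^sub>R z + x) * (\<gamma> \<xi> * cis (- (z \<bullet> \<xi>)))) \<in> borel_measurable (lborel \<Otimes>\<^sub>M lborel)"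
      proof -
        have "(\<lambda>q::(real^'n)\<times>(real^'n). cis (- (fst q \<bullet> snd q))) \<in> borel_measurable borel"
          by (intro borel_measurable_continuous_onI continuous_intros)
        hence [measurable]: "(\<lambda>q::(real^'n)\<times>(real^'n). cis (- (fst q \<bullet> snd q))) \<in> borel_measurable (lborel \<Otimes>\<^sub>M lborel)"
          by (simp add: lborel_prod)
        show ?thesis by (simp add: split_beta')
      qed
      have 1: "integrable lborel (\<lambda>z. F (d *\<^sub>R z + x))"
        using rapid_integrable[OF rapid_affine[OF F]] d by simp
      show "integrable lborel (\<lambda>z. LINT \<xi>|lborel. norm (case (z, \<xi>) of (z, \<xi>) \<Rightarrow> F (d *\<^sub>R z + x) * (\<gamma> \<xi> * cis (- (z \<bullet> \<xi>)))))"
        using 1 by (simp add: norm_mult integrable_norm)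
      show "AE z in lborel. integrable lborel (\<lambda>\<xi>. case (z, \<xi>) of (z, \<xi>) \<Rightarrow> F (d *\<^sub>R z + x) * (\<gamma> \<xi> * cis (- (z \<bullet> \<xi>))))"
      proof (rule AE_I2)
        fix z
        have [measurable]: "(\<lambda>\<xi>::real^'n. cis (- (z \<bullet> \<xi>))) \<in> borel_measurable borel"
          by (intro borel_measurable_continuous_onI continuous_intros)
        have "integrable lborel (\<lambda>\<xi>. \<gamma> \<xi> * cis (- (z \<bullet> \<xi>)))"
          by (rule Bochner_Integration.integrable_bound[OF \<gamma>i]) (auto simp: norm_mult)
        thus "integrable lborel (\<lambda>\<xi>. case (z, \<xi>) of (z, \<xi>) \<Rightarrow> F (d *\<^sub>R z + x) * (\<gamma> \<xi> * cis (- (z \<bullet> \<xi>))))"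
          by simp
      qed
    qed
    have "(LINT z|lborel. F (d *\<^sub>R z + x) * E z) =
        (LINT z|lborel. LINT \<xi>|lborel. F (d *\<^sub>R z + x) * (\<gamma> \<xi> * cis (- (z \<bullet> \<xi>))))"
      by (simp add: \<gamma>E)
    also have "\<dots> = (LINT \<xi>|lborel. LINT z|lborel. F (d *\<^sub>R z + x) * (\<gamma> \<xi> * cis (- (z \<bullet> \<xi>))))"
      by (rule lborel_pair.Fubini_integral[OF int, symmetric])
    also have "\<dots> = (LINT \<xi>|lborel. \<gamma> \<xi> * fourier (\<lambda>z. F (d *\<^sub>R z + x)) \<xi>)"
    proof (rule Bochner_Integration.integral_cong)
      fix \<xi>
      have "(LINT z|lborel. F (d *\<^sub>R z + x) * (\<gamma> \<xi> * cis (- (z \<bullet> \<xi>)))) =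
          (LINT z|lborel. \<gamma> \<xi> * (F (d *\<^sub>R z + x) * cis (- (z \<bullet> \<xi>))))"
        by (simp only: mult.left_commute)
      thus "(LINT z|lborel. F (d *\<^sub>R z + x) * (\<gamma> \<xi> * cis (- (z \<bullet> \<xi>)))) =
          \<gamma> \<xi> * fourier (\<lambda>z. F (d *\<^sub>R z + x)) \<xi>"
        unfolding fourier_def by simp
    qed simp
    also have "\<dots> = 0"
      using d by (simp add: fourier_affine[OF F] zero)
    finally show ?thesis .
  qed
  obtain B where B: "\<And>x. norm (F x) \<le> B" using rapid_bound[OF F, of 0] by auto
  have "(\<lambda>n. LINT z|lborel. F (inverse (real (Suc n)) *\<^sub>R z + x) * E z) \<longlonglongrightarrow> (LINT z|lborel. F x * E z)"
  proof (rule integral_dominated_convergence[where w="\<lambda>z. B * norm (E z)"])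
    show "integrable lborel (\<lambda>z. B * norm (E z))" using Ei by simp
    have "(\<lambda>n. inverse (real (Suc n)) *\<^sub>R z + x) \<longlonglongrightarrow> 0 *\<^sub>R z + x" for z
      by (intro tendsto_intros LIMSEQ_inverse_real_of_nat)
    thus "AE z in lborel. (\<lambda>n. F (inverse (real (Suc n)) *\<^sub>R z + x) * E z) \<longlonglongrightarrow> F x * E z"
      using rapid_cont[OF F]
      by (intro AE_I2 tendsto_intros continuous_on_tendsto_compose[where f=F and s=UNIV]) auto
    show "AE z in lborel. norm (F (inverse (real (Suc n)) *\<^sub>R z + x) * E z) \<le> B * norm (E z)" for n
      using B by (intro AE_I2) (auto simp: norm_mult intro!: mult_right_mono)
  qed auto
  hence "(\<lambda>n::nat. 0) \<longlonglongrightarrow> (LINT z|lborel. F x * E z)" by (simp add: int0)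
  hence "(LINT z|lborel. F x * E z) = 0" by (simp add: LIMSEQ_const_iff)
  thus ?thesis by (simp add: E1)
qed

lemma fourier_inj:
  assumes F: "rapid F" and G: "rapid G" and eq: "\<And>\<xi>. fourier F \<xi> = fourier G \<xi>"
  shows "F = G"
proof
  fix x
  have "fourier (\<lambda>x. F x - G x) \<xi> = 0" for \<xi>
    using fourier_add[OF F rapid_cmult[OF G, of "-1"], of \<xi>] fourier_cmult[of "-1" G \<xi>] eq by simp
  from fourier_inj_zero[OF rapid_diff[OF F G] this] show "F x = G x" by simp
qed

section \<open>Partial derivatives\<close>

lemma partial_eqI: "(f has_derivative D) (at x) \<Longrightarrow> partial i f x = D (axis i 1)"
  unfolding partial_def using frechet_derivative_at by metis

lemma partials_Nil [simp]: "partials [] f = f"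
  by (simp add: partials_def)

lemma partials_Cons: "partials (i # is) f = partial i (partials is f)"
  by (simp add: partials_def)

lemma smooth_has_derivative:
  "smooth f \<Longrightarrow> (partials is f has_derivative frechet_derivative (partials is f) (at x)) (at x)"
  by (simp add: smooth_def differentiable_on_def frechet_derivative_works)

lemma partials_affine:
  assumes f: "smooth f"
  shows "partials is (\<lambda>x. a * f (c *\<^sub>R x + b)) = (\<lambda>x. a * of_real (c ^ length is) * partials is f (c *\<^sub>R x + b))"
proof (induction "is")
  case (Cons i "is")
  show ?case
  proof
    fix x
    define D where "D = frechet_derivative (partials is f) (at (c *\<^sub>R x + b))"
    have D: "(partials is f has_derivative D) (at (c *\<^sub>R x + b))"
      unfolding D_def by (rule smooth_has_derivative[OF f])
    have "((\<lambda>x. partials is f (c *\<^sub>R x + b)) has_derivative (\<lambda>v. D (c *\<^sub>R v))) (at x)"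
      by (rule has_derivative_compose[where f="\<lambda>x. c *\<^sub>R x + b" and g="partials is f", OF _ D])
        (auto intro!: derivative_eq_intros)
    hence "((\<lambda>x. a * of_real (c ^ length is) * partials is f (c *\<^sub>R x + b)) has_derivative
        (\<lambda>v. a * of_real (c ^ length is) * D (c *\<^sub>R v))) (at x)"
      by (rule has_derivative_mult_right)
    from partial_eqI[OF this]
    have "partials (i # is) (\<lambda>x. a * f (c *\<^sub>R x + b)) x = a * of_real (c ^ length is) * D (c *\<^sub>R axis i 1)"
      unfolding partials_Cons Cons.IH .
    also have "D (c *\<^sub>R axis i 1) = of_real c * D (axis i 1)"
      using linear_scale[OF has_derivative_linear[OF D]] by (simp add: scaleR_conv_of_real)
    also have "D (axis i 1) = partials (i # is) f (c *\<^sub>R x + b)"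
      unfolding partials_Cons using partial_eqI[OF D] by simp
    finally show "partials (i # is) (\<lambda>x. a * f (c *\<^sub>R x + b)) x =
        a * of_real (c ^ length (i # is)) * partials (i # is) f (c *\<^sub>R x + b)"
      by (simp add: mult_ac)
  qed
qed simp

lemma partials_add:
  assumes f: "smooth f" and g: "smooth g"
  shows "partials is (\<lambda>x. f x + g x) = (\<lambda>x. partials is f x + partials is g x)"
proof (induction "is")
  case (Cons i "is")
  show ?case
    unfolding partials_Cons Cons.IH
    by (rule ext, subst partial_eqI[OF has_derivative_add[OF smooth_has_derivative[OF f] smooth_has_derivative[OF g]]])
      (simp only: partial_def)
qed simp

lemma partials_cnj:
  assumes f: "smooth f"
  shows "partials is (\<lambda>x. cnj (f x)) = (\<lambda>x. cnj (partials is f x))"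
proof (induction "is")
  case (Cons i "is")
  show ?case
    unfolding partials_Cons Cons.IH
    by (rule ext, subst partial_eqI[OF has_derivative_cnj[OF smooth_has_derivative[OF f]]])
      (simp only: partial_def)
qed simp

lemma smooth_affine: assumes f: "smooth f" shows "smooth (\<lambda>x. a * f (c *\<^sub>R x + b))"
  unfolding smooth_def partials_affine[OF f]
proof
  fix "is"
  have "(\<lambda>x. partials is f (c *\<^sub>R x + b)) differentiable at x" for x
    by (rule differentiable_compose[where f="partials is f"])
      (use f in \<open>auto simp: smooth_def differentiable_on_def\<close>)
  thus "(\<lambda>x. a * of_real (c ^ length is) * partials is f (c *\<^sub>R x + b)) differentiable_on UNIV"
    unfolding differentiable_on_def by (auto intro!: differentiable_mult)
qed

lemma smooth_add: "smooth f \<Longrightarrow> smooth g \<Longrightarrow> smooth (\<lambda>x. f x + g x)"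
  by (auto simp: smooth_def partials_add intro!: differentiable_on_add)

lemma smooth_cnj: assumes f: "smooth f" shows "smooth (\<lambda>x. cnj (f x))"
  unfolding smooth_def partials_cnj[OF f] differentiable_on_def
  using has_derivative_cnj[OF smooth_has_derivative[OF f]] by (auto simp: differentiable_def)

lemma schwartz_smooth: "f \<in> schwartz \<Longrightarrow> smooth f"
  by (simp add: schwartz_def)

lemma schwartz_rapid: assumes f: "f \<in> schwartz" shows "rapid (partials is f)"
  unfolding rapid_def
proof safe
  have "partials is f differentiable_on UNIV" using f by (simp add: schwartz_def smooth_def)
  thus "continuous_on UNIV (partials is f)" by (rule differentiable_imp_continuous_on)
  fix K
  have "bdd_above (range (\<lambda>x. (1 + norm x) ^ K * norm (partials is f x)))"
    using f by (simp add: schwartz_def)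
  thus "\<exists>C. \<forall>x. (1 + norm x) ^ K * cmod (partials is f x) \<le> C" by (auto simp: bdd_above_def)
qed

lemma schwartzI: "smooth f \<Longrightarrow> (\<And>is. rapid (partials is f)) \<Longrightarrow> f \<in> schwartz"
  unfolding schwartz_def rapid_def bdd_above_def by (auto simp: image_iff)

lemma schwartz_affine: "f \<in> schwartz \<Longrightarrow> c \<noteq> 0 \<Longrightarrow> (\<lambda>x. a * f (c *\<^sub>R x + b)) \<in> schwartz"
  by (rule schwartzI)
    (auto simp: schwartz_smooth smooth_affine partials_affine intro!: rapid_cmult rapid_affine schwartz_rapid)

lemma schwartz_translate: "f \<in> schwartz \<Longrightarrow> (\<lambda>x. f (x - b)) \<in> schwartz"
  using schwartz_affine[of f 1 1 "-b"] by simp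

lemma partials_translate: "smooth f \<Longrightarrow> partials is (\<lambda>x. f (x - b)) = (\<lambda>x. partials is f (x - b))"
  using partials_affine[of f "is" 1 1 "-b"] by simp

lemma partials_cmult: "smooth f \<Longrightarrow> partials is (\<lambda>x. a * f x) = (\<lambda>x. a * partials is f x)"
  using partials_affine[of f "is" a 1 "0"] by simp

lemma schwartz_cmult: "f \<in> schwartz \<Longrightarrow> (\<lambda>x. a * f x) \<in> schwartz"
  using schwartz_affine[of f 1 a 0] by simp

lemma schwartz_add: "f \<in> schwartz \<Longrightarrow> g \<in> schwartz \<Longrightarrow> (\<lambda>x. f x + g x) \<in> schwartz"
  by (rule schwartzI)
    (auto simp: schwartz_smooth smooth_add partials_add intro!: rapid_add schwartz_rapid)

lemma schwartz_diff: "f \<in> schwartz \<Longrightarrow> g \<in> schwartz \<Longrightarrow> (\<lambda>x. f x - g x) \<in> schwartz"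
  using schwartz_add[of f "\<lambda>x. -1 * g x"] schwartz_cmult[of g "-1"] by simp

lemma partials_diff: "smooth f \<Longrightarrow> smooth g \<Longrightarrow>
    partials is (\<lambda>x. f x - g x) = (\<lambda>x. partials is f x - partials is g x)"
  using partials_add[of f "\<lambda>x. -1 * g x" "is"] smooth_affine[of g "-1" 1 0] partials_cmult[of g "is" "-1"]
  by simp

lemma schwartz_cnj: "f \<in> schwartz \<Longrightarrow> (\<lambda>x. cnj (f x)) \<in> schwartz"
  by (rule schwartzI)
    (auto simp: schwartz_smooth smooth_cnj partials_cnj intro!: rapid_cnj schwartz_rapid)

lemma partials_zero: "partials is (\<lambda>x. 0) = (\<lambda>x. 0)"
  by (induction "is") (auto simp: partials_Cons partial_eqI[OF has_derivative_const])

lemma smooth_zero: "smooth (\<lambda>x. 0)"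
  by (simp add: smooth_def partials_zero)

lemma schwartz_zero: "(\<lambda>x. 0) \<in> schwartz"
  by (auto intro: schwartzI simp: smooth_zero partials_zero rapid_zero)

lemma schwartz_sum: "(\<And>m. m \<in> F \<Longrightarrow> f m \<in> schwartz) \<Longrightarrow> (\<lambda>x. \<Sum>m\<in>F. f m x) \<in> schwartz"
  by (induction F rule: infinite_finite_induct) (auto simp: schwartz_zero intro: schwartz_add)

lemma partials_sum: "(\<And>m. m \<in> F \<Longrightarrow> f m \<in> schwartz) \<Longrightarrow>
    partials is (\<lambda>x. \<Sum>m\<in>F. f m x) = (\<lambda>x. \<Sum>m\<in>F. partials is (f m) x)"
proof (induction F rule: infinite_finite_induct)
  case (insert a F)
  have "partials is (\<lambda>x. f a x + (\<Sum>m\<in>F. f m x)) = (\<lambda>x. partials is (f a) x + partials is (\<lambda>x. \<Sum>m\<in>F. f m x) x)"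
    by (intro partials_add schwartz_smooth schwartz_sum insert) (auto intro: insert)
  thus ?case using insert by simp
qed (auto simp: partials_zero)

lemma partials_dilate: "smooth f \<Longrightarrow> partials is (dilate j f :: real^'n \<Rightarrow> complex) =
    (\<lambda>x. of_real (2 powi (j * int CARD('n))) * of_real ((2 powi j) ^ length is) * partials is f (2 powi j *\<^sub>R x))"
  using partials_affine[of f "is" _ "2 powi j" 0] unfolding dilate_def[abs_def] by simp

section \<open>Weighted Lipschitz functions\<close>

text \<open>The factor \<open>(1 + norm (x - y)) ^ K\<close> makes the condition meaningful for arbitrary pairs of points,
  so that no smallness of \<open>x - y\<close> has to be tracked.\<close>

definition weighted_lipschitz :: "(real^'n \<Rightarrow> complex) \<Rightarrow> bool" where
  "weighted_lipschitz f \<longleftrightarrow> (\<forall>K::nat. \<exists>C. \<forall>x y.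
     (1 + norm x) ^ K * norm (f x - f y) \<le> C * norm (x - y) * (1 + norm (x - y)) ^ K)"

lemma wlip_bound:
  assumes "weighted_lipschitz f"
  obtains C where "C \<ge> 1"
    "\<And>x y. (1 + norm x) ^ K * norm (f x - f y) \<le> C * norm (x - y) * (1 + norm (x - y)) ^ K"
proof -
  obtain C where C: "\<And>x y. (1 + norm x) ^ K * norm (f x - f y) \<le> C * norm (x - y) * (1 + norm (x - y)) ^ K"
    using assms unfolding weighted_lipschitz_def by metis
  have "(1 + norm x) ^ K * norm (f x - f y) \<le> max C 1 * norm (x - y) * (1 + norm (x - y)) ^ K" for x y
    by (rule order_trans[OF C]) (intro mult_right_mono, auto)
  thus ?thesis using that[of "max C 1"] by simp
qed

text \<open>The mean value inequality on the segment from \<open>x\<close> to \<open>y\<close>; the weight at \<open>x\<close> is compared with the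
  weight at a point of the segment at the cost of \<open>(1 + norm (x - y)) ^ K\<close>.\<close>

lemma schwartz_wlip:
  fixes f :: "real^'n \<Rightarrow> complex"
  assumes f: "f \<in> schwartz" shows "weighted_lipschitz (partials is f)"
  unfolding weighted_lipschitz_def
proof
  fix K
  let ?g = "partials is f"
  have "\<exists>C. \<forall>x. (1 + norm x) ^ K * norm (partials (i # is) f x) \<le> C" for i
    using rapid_bound[OF schwartz_rapid[OF f, of "i # is"], of K] by metis
  then obtain C where C: "\<And>i x. (1 + norm x) ^ K * norm (partials (i # is) f x) \<le> C i" by metis
  define B where "B = (\<Sum>i\<in>UNIV. C i)"
  have on: "(1 + norm x) ^ K * onorm (frechet_derivative ?g (at x)) \<le> B" for x
  proof -
    let ?D = "frechet_derivative ?g (at x)"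
    have D: "(?g has_derivative ?D) (at x)" by (rule smooth_has_derivative[OF schwartz_smooth[OF f]])
    have lin: "linear ?D" by (rule has_derivative_linear[OF D])
    have "norm (?D v) \<le> (\<Sum>i\<in>UNIV. norm (partials (i # is) f x)) * norm v" for v
    proof -
      have "v = (\<Sum>i\<in>UNIV. v $ i *\<^sub>R axis i 1)"
        by (simp add: basis_expansion scalar_mult_eq_scaleR[symmetric])
      hence "?D v = (\<Sum>i\<in>UNIV. v $ i *\<^sub>R ?D (axis i 1))"
        using linear_sum[OF lin, of "\<lambda>i. v $ i *\<^sub>R axis i 1" UNIV] by (simp add: linear_scale[OF lin])
      hence "norm (?D v) \<le> (\<Sum>i\<in>UNIV. norm (v $ i *\<^sub>R ?D (axis i 1)))"
        by (simp only: norm_sum)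
      also have "\<dots> \<le> (\<Sum>i\<in>UNIV. norm (partials (i # is) f x) * norm v)"
        by (rule sum_mono)
          (simp add: partials_Cons partial_eqI[OF D] mult.commute[of _ "norm v"] mult_right_mono component_le_norm_cart)
      finally show ?thesis by (simp add: sum_distrib_right)
    qed
    hence "onorm ?D \<le> (\<Sum>i\<in>UNIV. norm (partials (i # is) f x))"
      by (rule onorm_bound[rotated]) (simp add: sum_nonneg)
    hence "(1 + norm x) ^ K * onorm ?D \<le> (1 + norm x) ^ K * (\<Sum>i\<in>UNIV. norm (partials (i # is) f x))"
      by (intro mult_left_mono) auto
    also have "\<dots> \<le> B" unfolding B_def sum_distrib_left by (intro sum_mono C)
    finally show ?thesis .
  qed
  have "(1 + norm x) ^ K * norm (?g x - ?g y) \<le> B * norm (x - y) * (1 + norm (x - y)) ^ K" for x y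
  proof -
    define M where "M = B * (1 + norm (x - y)) ^ K / (1 + norm x) ^ K"
    have "norm (?g x - ?g y) \<le> M * norm (x - y)"
    proof (rule differentiable_bound[OF convex_closed_segment[of x y]])
      fix z assume z: "z \<in> closed_segment x y"
      show "(?g has_derivative frechet_derivative ?g (at z)) (at z within closed_segment x y)"
        using smooth_has_derivative[OF schwartz_smooth[OF f]] has_derivative_at_withinI by blast
      have "norm (x - z) \<le> norm (x - y)"
        using segment_bound(1)[OF z] by (simp add: norm_minus_commute)
      hence "(1 + norm (x - z)) ^ K * (1 + norm z) ^ K \<le> (1 + norm (x - y)) ^ K * (1 + norm z) ^ K"
        by (intro mult_right_mono power_mono) auto
      from order_trans[OF one_plus_norm_pow_diff this]
      have "(1 + norm x) ^ K \<le> (1 + norm (x - y)) ^ K * (1 + norm z) ^ K" .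
      hence "(1 + norm x) ^ K * onorm (frechet_derivative ?g (at z)) \<le>
          (1 + norm (x - y)) ^ K * (1 + norm z) ^ K * onorm (frechet_derivative ?g (at z))"
        by (intro mult_right_mono onorm_pos_le has_derivative_bounded_linear[OF smooth_has_derivative[OF schwartz_smooth[OF f]]])
      also have "\<dots> \<le> (1 + norm (x - y)) ^ K * B"
        unfolding mult.assoc by (intro mult_left_mono on) auto
      finally show "onorm (frechet_derivative ?g (at z)) \<le> M"
        by (simp add: M_def pos_le_divide_eq add_pos_nonneg mult.commute)
    qed auto
    thus ?thesis by (simp add: M_def field_simps add_pos_nonneg)
  qed
  thus "\<exists>C. \<forall>x y. (1 + norm x) ^ K * norm (?g x - ?g y) \<le> C * norm (x - y) * (1 + norm (x - y)) ^ K"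
    by blast
qed

lemma wlip_add: assumes f: "weighted_lipschitz f" and g: "weighted_lipschitz g" shows "weighted_lipschitz (\<lambda>x. f x + g x)"
  unfolding weighted_lipschitz_def
proof
  fix K
  obtain C where C: "\<And>x y. (1 + norm x) ^ K * norm (f x - f y) \<le> C * norm (x - y) * (1 + norm (x - y)) ^ K"
    using wlip_bound[OF f, of K] by metis
  obtain D where D: "\<And>x y. (1 + norm x) ^ K * norm (g x - g y) \<le> D * norm (x - y) * (1 + norm (x - y)) ^ K"
    using wlip_bound[OF g, of K] by metis
  have "(1 + norm x) ^ K * norm (f x + g x - (f y + g y)) \<le> (C + D) * norm (x - y) * (1 + norm (x - y)) ^ K" for x y
  proof -
    have "norm (f x + g x - (f y + g y)) \<le> norm (f x - f y) + norm (g x - g y)"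
      using norm_triangle_ineq[of "f x - f y" "g x - g y"] by (simp add: algebra_simps)
    hence "(1 + norm x) ^ K * norm (f x + g x - (f y + g y)) \<le> (1 + norm x) ^ K * (norm (f x - f y) + norm (g x - g y))"
      by (intro mult_left_mono) auto
    thus ?thesis using C[of x y] D[of x y] by (simp add: algebra_simps)
  qed
  thus "\<exists>C. \<forall>x y. (1 + norm x) ^ K * norm (f x + g x - (f y + g y)) \<le> C * norm (x - y) * (1 + norm (x - y)) ^ K"
    by blast
qed

lemma wlip_sum: "(\<And>m. m \<in> F \<Longrightarrow> weighted_lipschitz (f m)) \<Longrightarrow> weighted_lipschitz (\<lambda>x. \<Sum>m\<in>F. f m x)"
proof (induction F rule: infinite_finite_induct)
  case empty
  show ?case unfolding weighted_lipschitz_def by (intro allI exI[of _ 0]) simp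
next
  case (infinite F)
  show ?case using infinite(1) unfolding weighted_lipschitz_def by (intro allI exI[of _ 0]) simp
qed (auto intro: wlip_add)

lemma wlip_conv:
  assumes g: "rapid g" and k: "rapid k" and l: "weighted_lipschitz k"
  shows "weighted_lipschitz (convolve g k)"
  unfolding weighted_lipschitz_def
proof
  fix K
  obtain C where C: "C \<ge> 1" "\<And>x y. (1 + norm x) ^ K * norm (k x - k y) \<le> C * norm (x - y) * (1 + norm (x - y)) ^ K"
    using wlip_bound[OF l, of K] by metis
  define A where "A = (LINT w|lborel. (1 + norm w) ^ K * norm (g w))"
  have "(1 + norm x) ^ K * norm (convolve g k x - convolve g k y) \<le> (C * A) * norm (x - y) * (1 + norm (x - y)) ^ K" for x y
  proof -
    have i: "integrable lborel (\<lambda>w. g w * k (x - w) - g w * k (y - w))"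
      by (intro Bochner_Integration.integrable_diff rapid_conv_integrable g k)
    have "convolve g k x - convolve g k y = (LINT w|lborel. g w * k (x - w) - g w * k (y - w))"
      unfolding convolve_def by (rule Bochner_Integration.integral_diff[symmetric]) (intro rapid_conv_integrable g k)+
    hence "norm (convolve g k x - convolve g k y) \<le> (LINT w|lborel. norm (g w * k (x - w) - g w * k (y - w)))"
      by (simp add: integral_norm_bound)
    hence "(1 + norm x) ^ K * norm (convolve g k x - convolve g k y) \<le>
       (1 + norm x) ^ K * (LINT w|lborel. norm (g w * k (x - w) - g w * k (y - w)))"
      by (intro mult_left_mono) auto
    also have "\<dots> = (LINT w|lborel. (1 + norm x) ^ K * norm (g w * k (x - w) - g w * k (y - w)))"
      by simp
    also have "\<dots> \<le> (LINT w|lborel. C * norm (x - y) * (1 + norm (x - y)) ^ K * ((1 + norm w) ^ K * norm (g w)))"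
    proof (rule integral_mono)
      show "integrable lborel (\<lambda>w. (1 + norm x) ^ K * norm (g w * k (x - w) - g w * k (y - w)))"
        using i by (intro integrable_mult_right integrable_norm)
      show "integrable lborel (\<lambda>w. C * norm (x - y) * (1 + norm (x - y)) ^ K * ((1 + norm w) ^ K * norm (g w)))"
        by (intro integrable_mult_right rapid_integrable_moment g)
      fix w
      have "(1 + norm x) ^ K * norm (g w * k (x - w) - g w * k (y - w)) \<le>
        ((1 + norm (x - w)) ^ K * (1 + norm w) ^ K) * (norm (g w) * norm (k (x - w) - k (y - w)))"
        unfolding right_diff_distrib[symmetric] norm_mult
        by (intro mult_right_mono one_plus_norm_pow_diff) simp
      also have "\<dots> = ((1 + norm (x - w)) ^ K * norm (k (x - w) - k (y - w))) * ((1 + norm w) ^ K * norm (g w))"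
        by (simp add: mult_ac)
      also have "\<dots> \<le> (C * norm (x - y) * (1 + norm (x - y)) ^ K) * ((1 + norm w) ^ K * norm (g w))"
        using C(2)[of "x - w" "y - w"] by (intro mult_right_mono) auto
      finally show "(1 + norm x) ^ K * norm (g w * k (x - w) - g w * k (y - w)) \<le>
        C * norm (x - y) * (1 + norm (x - y)) ^ K * ((1 + norm w) ^ K * norm (g w))" .
    qed
    also have "\<dots> = (C * A) * norm (x - y) * (1 + norm (x - y)) ^ K"
      by (simp add: A_def)
    finally show ?thesis .
  qed
  thus "\<exists>C. \<forall>x y. (1 + norm x) ^ K * norm (convolve g k x - convolve g k y) \<le> C * norm (x - y) * (1 + norm (x - y)) ^ K"
    by blast
qed

section \<open>Schwartz functions whose Fourier transform vanishes near the origin\<close>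

text \<open>This subspace of \<open>\<S>\<^sub>\<infinity>\<close> is visibly stable under translations and dilations, and it contains all
  test functions to which the functionals below are applied.\<close>

definition away :: "(real^'n \<Rightarrow> complex) set" where
  "away = {g \<in> schwartz. \<exists>r>0. \<forall>\<xi>. norm \<xi> < r \<longrightarrow> fourier g \<xi> = 0}"

lemma away_schwartz: "g \<in> away \<Longrightarrow> g \<in> schwartz"
  by (simp add: away_def)

lemma away_rapid: "g \<in> away \<Longrightarrow> rapid g"
  using schwartz_rapid[of g "[]"] by (simp add: away_def)

lemma away_affine: assumes g: "g \<in> away" and c: "c \<noteq> 0" shows "(\<lambda>x. a * g (c *\<^sub>R x + b)) \<in> away"
proof -
  obtain r where r: "r > 0" "\<And>\<xi>. norm \<xi> < r \<Longrightarrow> fourier g \<xi> = 0" using g by (auto simp: away_def)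
  have "fourier (\<lambda>x. a * g (c *\<^sub>R x + b)) \<xi> = 0" if "norm \<xi> < r * \<bar>c\<bar>" for \<xi>
    unfolding fourier_cmult fourier_affine[OF away_rapid[OF g] c]
    using r(2)[of "inverse c *\<^sub>R \<xi>"] that c by (simp add: field_simps)
  thus ?thesis using r(1) c schwartz_affine[OF away_schwartz[OF g] c]
    unfolding away_def by (auto intro!: exI[of _ "r * \<bar>c\<bar>"])
qed

lemma away_translate: "g \<in> away \<Longrightarrow> (\<lambda>x. g (x - b)) \<in> away"
  using away_affine[of g 1 1 "-b"] by simp

lemma away_cmult: "g \<in> away \<Longrightarrow> (\<lambda>x. a * g x) \<in> away"
  using away_affine[of g 1 a 0] by simp

lemma away_dilate: "g \<in> away \<Longrightarrow> dilate j g \<in> away"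
  using away_affine[of g "2 powi j" _ 0] unfolding dilate_def[abs_def] by simp

lemma away_add: assumes "f \<in> away" "g \<in> away" shows "(\<lambda>x. f x + g x) \<in> away"
proof -
  obtain r where r: "r > 0" "\<And>\<xi>. norm \<xi> < r \<Longrightarrow> fourier f \<xi> = 0" using assms(1) by (auto simp: away_def)
  obtain s where s: "s > 0" "\<And>\<xi>. norm \<xi> < s \<Longrightarrow> fourier g \<xi> = 0" using assms(2) by (auto simp: away_def)
  show ?thesis using assms r s unfolding away_def
    by (auto simp: schwartz_add fourier_add[OF away_rapid away_rapid] assms intro!: exI[of _ "min r s"])
qed

lemma away_diff: "f \<in> away \<Longrightarrow> g \<in> away \<Longrightarrow> (\<lambda>x. f x - g x) \<in> away"
  using away_add[of f "\<lambda>x. -1 * g x"] away_cmult[of g "-1"] by simp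

lemma away_zero: "(\<lambda>x. 0) \<in> away"
  unfolding away_def by (auto simp: schwartz_zero fourier_def intro: exI[of _ 1])

lemma away_sum: "(\<And>m. m \<in> F \<Longrightarrow> f m \<in> away) \<Longrightarrow> (\<lambda>x. \<Sum>m\<in>F. f m x) \<in> away"
  by (induction F rule: infinite_finite_induct) (auto simp: away_zero intro: away_add)

lemma norm_cis_diff_le: "norm (cis a - cis b) \<le> \<bar>a - b\<bar>"
proof -
  have "norm (cis (a - b) - 1) \<le> \<bar>a - b\<bar>"
    using iexp_approx1[of "a - b" 0] by (simp add: cis_conv_exp)
  moreover have "cis a - cis b = cis b * (cis (a - b) - 1)"
    by (simp add: right_diff_distrib cis_mult)
  ultimately show ?thesis by (simp add: norm_mult)
qed

lemma cis_quotient_tendsto: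
  "(\<lambda>n. of_real (real (Suc n)) * (cis (a - inverse (real (Suc n)) * b) - cis a)) \<longlonglongrightarrow> - \<i> * of_real b * cis a"
proof -
  have "DERIV (\<lambda>z. exp (- \<i> * of_real b * z)) 0 :> - \<i> * of_real b"
    by (auto intro!: derivative_eq_intros)
  hence L: "((\<lambda>h. (exp (- \<i> * of_real b * h) - 1) / h) \<longlongrightarrow> - \<i> * of_real b) (at 0)"
    by (simp add: DERIV_def)
  have T: "filterlim (\<lambda>n. complex_of_real (inverse (real (Suc n)))) (at 0) sequentially"
  proof (rule filterlim_atI)
    show "(\<lambda>n. complex_of_real (inverse (real (Suc n)))) \<longlonglongrightarrow> 0"
      using tendsto_of_real[OF LIMSEQ_inverse_real_of_nat, where 'a=complex] by (simp only: of_real_0)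
    show "eventually (\<lambda>n. complex_of_real (inverse (real (Suc n))) \<noteq> 0) sequentially"
      by (rule always_eventually) (simp only: of_real_eq_0_iff inverse_nonzero_iff_nonzero of_nat_eq_0_iff, simp)
  qed
  have A: "(\<lambda>n. cis a * ((exp (- \<i> * of_real b * of_real (inverse (real (Suc n)))) - 1) / of_real (inverse (real (Suc n)))))
      \<longlonglongrightarrow> cis a * (- \<i> * of_real b)"
    by (intro tendsto_mult tendsto_const filterlim_compose[OF L T])
  have B: "cis a * ((exp (- \<i> * of_real b * of_real t) - 1) / of_real t) =
      of_real (inverse t) * (cis (a - t * b) - cis a)" for t
  proof -
    have "exp (- \<i> * of_real b * of_real t) = cis (- (t * b))" by (simp add: cis_conv_exp mult_ac)
    moreover have "cis a * cis (- (t * b)) = cis (a - t * b)" by (simp add: cis_mult)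
    ultimately show ?thesis by (simp add: divide_inverse mult_ac right_diff_distrib left_diff_distrib)
  qed
  show ?thesis
    using A unfolding B by (simp only: inverse_inverse_eq mult.commute[of "cis a"])
qed

text \<open>Up to the factor \<open>- \<i>\<close>, the integral with the additional factor \<open>x $ i\<close> is the \<open>i\<close>-th partial
  derivative of the integral without it, which vanishes in a neighbourhood of \<open>\<xi>\<close>.\<close>

lemma fourier_moment_step:
  fixes g :: "real^'n \<Rightarrow> complex" and h :: "real^'n \<Rightarrow> real"
  assumes g: "rapid g" and hm[measurable]: "h \<in> borel_measurable borel"
    and hb: "\<And>x. \<bar>h x\<bar> \<le> (1 + norm x) ^ K"
    and zero: "\<And>\<xi>. norm \<xi> < r \<Longrightarrow> (LINT x|lborel. g x * of_real (h x) * cis (- (x \<bullet> \<xi>))) = 0"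
    and \<xi>: "norm \<xi> < r"
  shows "(LINT x|lborel. g x * of_real (x $ i * h x) * cis (- (x \<bullet> \<xi>))) = 0"
proof -
  have [measurable]: "g \<in> borel_measurable borel" using g by (rule rapid_measurable)
  have [measurable]: "(\<lambda>x::real^'n. cis (- (x \<bullet> \<xi>))) \<in> borel_measurable borel" for \<xi>
    by (intro borel_measurable_continuous_onI continuous_intros)
  define t where "t n = inverse (real (Suc n))" for n
  define q where "q n x = g x * of_real (h x) * (of_real (real (Suc n)) * (cis (- (x \<bullet> \<xi>) - t n * x $ i) - cis (- (x \<bullet> \<xi>))))" for n x
  have qeq: "q n x = of_real (real (Suc n)) * (g x * of_real (h x) * cis (- (x \<bullet> (\<xi> + t n *\<^sub>R axis i 1))))
      - of_real (real (Suc n)) * (g x * of_real (h x) * cis (- (x \<bullet> \<xi>)))" for n x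
    by (simp add: q_def inner_add_right inner_axis algebra_simps)
  have int: "integrable lborel (\<lambda>x. g x * of_real (h x) * cis (- (x \<bullet> \<eta>)))" for \<eta>
  proof -
    have "integrable lborel (\<lambda>x. g x * (of_real (h x) * cis (- (x \<bullet> \<eta>))))"
      by (rule rapid_integrable_mult[OF g, where B=1 and K=K]) (use hb in \<open>auto simp: norm_mult\<close>)
    thus ?thesis by (simp add: mult.assoc)
  qed
  have lim: "(\<lambda>n. LINT x|lborel. q n x) \<longlonglongrightarrow>
      (LINT x|lborel. g x * of_real (h x) * (- \<i> * of_real (x $ i) * cis (- (x \<bullet> \<xi>))))"
  proof (rule integral_dominated_convergence[where w="\<lambda>x. (1 + norm x) ^ Suc K * norm (g x)"])
    show "integrable lborel (\<lambda>x. (1 + norm x) ^ Suc K * norm (g x))"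
      by (rule rapid_integrable_moment[OF g])
    show "AE x in lborel. (\<lambda>n. q n x) \<longlonglongrightarrow> g x * of_real (h x) * (- \<i> * of_real (x $ i) * cis (- (x \<bullet> \<xi>)))"
      unfolding q_def t_def by (intro AE_I2 tendsto_mult tendsto_const cis_quotient_tendsto)
    show "AE x in lborel. norm (q n x) \<le> (1 + norm x) ^ Suc K * norm (g x)" for n
    proof (rule AE_I2)
      fix x
      have "norm (cis (- (x \<bullet> \<xi>) - t n * x $ i) - cis (- (x \<bullet> \<xi>))) \<le> t n * norm x"
        using norm_cis_diff_le[of "- (x \<bullet> \<xi>) - t n * x $ i" "- (x \<bullet> \<xi>)"] component_le_norm_cart[of x i]
        by (simp add: abs_mult t_def) (smt (verit) mult_left_mono of_nat_0_le_iff inverse_nonnegative_iff_nonnegative)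
      hence "real (Suc n) * norm (cis (- (x \<bullet> \<xi>) - t n * x $ i) - cis (- (x \<bullet> \<xi>))) \<le> real (Suc n) * (t n * norm x)"
        by (rule mult_left_mono) simp
      also have "\<dots> = norm x" by (simp add: t_def flip: mult.assoc)
      also have "\<dots> \<le> 1 + norm x" by simp
      finally have 1: "norm (complex_of_real (real (Suc n)) * (cis (- (x \<bullet> \<xi>) - t n * x $ i) - cis (- (x \<bullet> \<xi>)))) \<le> 1 + norm x"
        by (simp only: norm_mult norm_of_real abs_of_nat)
      have "norm (q n x) \<le> norm (g x) * (1 + norm x) ^ K * (1 + norm x)"
        unfolding q_def norm_mult[of "g x * of_real (h x)"]
        by (rule mult_mono[OF _ 1]) (use hb in \<open>auto simp: norm_mult mult_left_mono\<close>)
      thus "norm (q n x) \<le> (1 + norm x) ^ Suc K * norm (g x)" by (simp add: mult_ac)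
    qed
    show "(\<lambda>x. q n x) \<in> borel_measurable lborel" for n unfolding qeq by measurable
  qed auto
  have "(\<lambda>n. \<xi> + t n *\<^sub>R axis i 1) \<longlonglongrightarrow> \<xi> + 0 *\<^sub>R axis i 1"
    unfolding t_def by (intro tendsto_intros LIMSEQ_inverse_real_of_nat)
  hence "(\<lambda>n. norm (\<xi> + t n *\<^sub>R axis i 1)) \<longlonglongrightarrow> norm \<xi>" by (auto intro: tendsto_norm)
  hence "eventually (\<lambda>n. norm (\<xi> + t n *\<^sub>R axis i 1) < r) sequentially"
    using \<xi> by (rule order_tendstoD)
  hence "eventually (\<lambda>n. (LINT x|lborel. q n x) = 0) sequentially"
  proof eventually_elim
    case (elim n)
    have "(LINT x|lborel. q n x) =
      of_real (real (Suc n)) * (LINT x|lborel. g x * of_real (h x) * cis (- (x \<bullet> (\<xi> + t n *\<^sub>R axis i 1))))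
      - of_real (real (Suc n)) * (LINT x|lborel. g x * of_real (h x) * cis (- (x \<bullet> \<xi>)))"
      unfolding qeq
      by (subst Bochner_Integration.integral_diff)
        (simp_all only: integrable_mult_right[OF int] integral_mult_right_zero)
    thus ?case unfolding zero[OF elim] zero[OF \<xi>] by simp
  qed
  hence "(\<lambda>n. LINT x|lborel. q n x) \<longlonglongrightarrow> 0"
    by (simp add: tendsto_eventually)
  from LIMSEQ_unique[OF lim this]
  have "(LINT x|lborel. - \<i> * (g x * of_real (x $ i * h x) * cis (- (x \<bullet> \<xi>)))) = 0"
    by (simp add: mult_ac)
  thus ?thesis by (simp only: integral_mult_right_zero) simp
qed

text \<open>The moments are derivatives of the Fourier transform at the origin, up to constants.\<close>

lemma away_subset_schwartz_inf: "away \<subseteq> schwartz_inf"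
proof
  fix g :: "real^'n \<Rightarrow> complex" assume g: "g \<in> away"
  obtain r where r: "r > 0" "\<And>\<xi>. norm \<xi> < r \<Longrightarrow> fourier g \<xi> = 0" using g by (auto simp: away_def)
  define Q where "Q h \<longleftrightarrow> h \<in> borel_measurable borel \<and> (\<exists>K. \<forall>x. \<bar>h x\<bar> \<le> (1 + norm x) ^ K) \<and>
     (\<forall>\<xi>. norm \<xi> < r \<longrightarrow> (LINT x|lborel. g x * of_real (h x) * cis (- (x \<bullet> \<xi>))) = 0)" for h :: "real^'n \<Rightarrow> real"
  have step: "Q (\<lambda>x. x $ i * h x)" if "Q h" for h i
  proof -
    from that obtain K where hm[measurable]: "h \<in> borel_measurable borel" and K: "\<And>x. \<bar>h x\<bar> \<le> (1 + norm x) ^ K"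
      and z: "\<And>\<xi>. norm \<xi> < r \<Longrightarrow> (LINT x|lborel. g x * of_real (h x) * cis (- (x \<bullet> \<xi>))) = 0"
      unfolding Q_def by blast
    have "\<bar>x $ i * h x\<bar> \<le> (1 + norm x) ^ Suc K" for x
      unfolding abs_mult power_Suc using component_le_norm_cart[of x i] by (intro mult_mono K) auto
    thus ?thesis
      unfolding Q_def using fourier_moment_step[OF away_rapid[OF g] hm K z]
      by (auto intro!: exI[of _ "Suc K"])
  qed
  have "Q (\<lambda>x. \<Prod>i\<in>S. (x $ i) ^ \<alpha> i)" if "finite S" for S and \<alpha> :: "'n \<Rightarrow> nat"
    using that
  proof induction
    case empty
    show ?case using r(2) by (auto simp: Q_def fourier_def intro!: exI[of _ 0])
  next
    case (insert j S)
    have "Q (\<lambda>x. (x $ j) ^ k * (\<Prod>i\<in>S. (x $ i) ^ \<alpha> i))" for k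
    proof (induction k)
      case (Suc k)
      from step[OF this, of j] show ?case by (simp add: mult.assoc)
    qed (use insert in simp)
    thus ?case using insert by simp
  qed
  hence Z: "\<forall>\<xi>. norm \<xi> < r \<longrightarrow> (LINT x|lborel. g x * of_real (\<Prod>i\<in>UNIV. (x $ i) ^ \<alpha> i) * cis (- (x \<bullet> \<xi>))) = 0" for \<alpha>
    unfolding Q_def using finite_class.finite_UNIV by blast
  have "(LINT x|lborel. g x * of_real (\<Prod>i\<in>UNIV. (x $ i) ^ \<alpha> i)) = 0" for \<alpha>
  proof -
    have "norm (0::real^'n) < r" using r(1) by simp
    with Z[of \<alpha>] have "(LINT x|lborel. g x * of_real (\<Prod>i\<in>UNIV. (x $ i) ^ \<alpha> i) * cis (- (x \<bullet> 0))) = 0"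
      by blast
    thus ?thesis by (simp only: inner_zero_right minus_zero cis_zero mult_1_right)
  qed
  thus "g \<in> schwartz_inf" using away_schwartz[OF g] by (simp add: schwartz_inf_def)
qed

section \<open>Sequentially continuous functionals\<close>

text \<open>Convergence in all Schwartz seminorms; majorants \<open>e\<close> are used in place of the seminorms themselves
  to spare arguments about boundedness of suprema.\<close>

definition schwartz_lim :: "(nat \<Rightarrow> real^'n \<Rightarrow> complex) \<Rightarrow> (real^'n \<Rightarrow> complex) \<Rightarrow> bool" where
  "schwartz_lim G g \<longleftrightarrow> (\<forall>k is. \<exists>e. e \<longlonglongrightarrow> 0 \<and>
     (\<forall>n y. (1 + norm y) ^ k * norm (partials is (G n) y - partials is g y) \<le> e n))"

text \<open>Sequential continuity on \<^const>\<open>away\<close> is all that is used of a distribution.  Unlike membership in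
  \<^const>\<open>schwartz_inf_dual\<close>, this property is easily seen to be inherited by the composition with
  a dilation, which allows every estimate to be made at unit scale.\<close>

definition functional :: "((real^'n \<Rightarrow> complex) \<Rightarrow> complex) \<Rightarrow> bool" where
  "functional u \<longleftrightarrow>
     (\<forall>f\<in>away. \<forall>g\<in>away. u (\<lambda>x. f x + g x) = u f + u g) \<and>
     (\<forall>f\<in>away. \<forall>c. u (\<lambda>x. c * f x) = c * u f) \<and>
     (\<forall>G g. (\<forall>n. G n \<in> away) \<longrightarrow> g \<in> away \<longrightarrow> schwartz_lim G g \<longrightarrow> (\<lambda>n. u (G n)) \<longlonglongrightarrow> u g)"

lemma functional_add: "functional u \<Longrightarrow> f \<in> away \<Longrightarrow> g \<in> away \<Longrightarrow> u (\<lambda>x. f x + g x) = u f + u g"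
  unfolding functional_def by blast

lemma functional_cmult: "functional u \<Longrightarrow> f \<in> away \<Longrightarrow> u (\<lambda>x. c * f x) = c * u f"
  unfolding functional_def by blast

lemma functional_lim: "functional u \<Longrightarrow> (\<And>n. G n \<in> away) \<Longrightarrow> g \<in> away \<Longrightarrow> schwartz_lim G g \<Longrightarrow>
    (\<lambda>n. u (G n)) \<longlonglongrightarrow> u g"
  unfolding functional_def by blast

lemma functional_zero: "functional u \<Longrightarrow> u (\<lambda>x. 0) = 0"
  using functional_cmult[of u "\<lambda>x. 0" 0] by (simp add: away_zero)

lemma functional_sum:
  assumes u: "functional u"
  shows "(\<And>m. m \<in> F \<Longrightarrow> f m \<in> away) \<Longrightarrow> u (\<lambda>x. \<Sum>m\<in>F. f m x) = (\<Sum>m\<in>F. u (f m))"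
proof (induction F rule: infinite_finite_induct)
  case (insert a F)
  have "u (\<lambda>x. f a x + (\<Sum>m\<in>F. f m x)) = u (f a) + u (\<lambda>x. \<Sum>m\<in>F. f m x)"
    by (intro functional_add u away_sum insert) (auto intro: insert)
  thus ?case using insert by simp
qed (simp_all add: functional_zero u)

lemma schwartz_seminorm_upper:
  assumes "f \<in> schwartz"
  shows "(1 + norm x) ^ k * norm (partials is f x) \<le> schwartz_seminorm k is f"
  unfolding schwartz_seminorm_def by (rule cSUP_upper) (use assms in \<open>auto simp: schwartz_def\<close>)

text \<open>The subbasic neighbourhoods of \<open>g\<close> are seminorm balls with centres \<open>f\<close> other than \<open>g\<close>, so the
  triangle inequality is needed to see that they absorb the sequence.\<close>

lemma schwartz_lim_limitin:
  assumes G: "\<And>n. G n \<in> schwartz" and g: "g \<in> schwartz" and lim: "schwartz_lim G g"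
  shows "limitin schwartz_topology G g sequentially"
proof -
  let ?B = "{{g \<in> schwartz. schwartz_seminorm k is (\<lambda>x. g x - f x) < \<epsilon>} |k is f \<epsilon>. f \<in> schwartz \<and> 0 < \<epsilon>}"
  have basic: "eventually (\<lambda>n. schwartz_seminorm k is (\<lambda>x. G n x - f x) < \<epsilon>) sequentially"
    if f: "f \<in> schwartz" and "schwartz_seminorm k is (\<lambda>x. g x - f x) < \<epsilon>" for k "is" f \<epsilon>
  proof -
    obtain e where e: "e \<longlonglongrightarrow> 0" and le: "\<And>n y. (1 + norm y) ^ k * norm (partials is (G n) y - partials is g y) \<le> e n"
      using lim unfolding schwartz_lim_def by metis
    have "eventually (\<lambda>n. e n < \<epsilon> - schwartz_seminorm k is (\<lambda>x. g x - f x)) sequentially"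
      by (rule order_tendstoD(2)[OF e]) (use that in simp)
    thus ?thesis
    proof eventually_elim
      case (elim n)
      have "schwartz_seminorm k is (\<lambda>x. G n x - f x) \<le> e n + schwartz_seminorm k is (\<lambda>x. g x - f x)"
        unfolding schwartz_seminorm_def[of k "is" "\<lambda>x. G n x - f x"]
      proof (rule cSUP_least)
        fix y
        have "norm (partials is (\<lambda>x. G n x - f x) y) \<le>
            norm (partials is (G n) y - partials is g y) + norm (partials is (\<lambda>x. g x - f x) y)"
          using norm_triangle_ineq[of "partials is (G n) y - partials is g y" "partials is g y - partials is f y"]
          by (simp add: partials_diff schwartz_smooth G g f)
        hence "(1 + norm y) ^ k * norm (partials is (\<lambda>x. G n x - f x) y) \<le>
            (1 + norm y) ^ k * (norm (partials is (G n) y - partials is g y) + norm (partials is (\<lambda>x. g x - f x) y))"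
          by (intro mult_left_mono) auto
        also have "\<dots> \<le> e n + schwartz_seminorm k is (\<lambda>x. g x - f x)"
          unfolding distrib_left by (intro add_mono le schwartz_seminorm_upper schwartz_diff g f)
        finally show "(1 + norm y) ^ k * norm (partials is (\<lambda>x. G n x - f x) y) \<le> e n + schwartz_seminorm k is (\<lambda>x. g x - f x)" .
      qed simp
      thus ?case using elim by simp
    qed
  qed
  have ev: "eventually (\<lambda>n. G n \<in> U) sequentially" if "generate_topology_on ?B U" "g \<in> U" for U
    using that
  proof induction
    case (Basis s)
    then obtain k "is" f \<epsilon> where s: "s = {g \<in> schwartz. schwartz_seminorm k is (\<lambda>x. g x - f x) < \<epsilon>}" "f \<in> schwartz"
      by auto
    with Basis(2) basic[of f k "is" \<epsilon>] G show ?case by auto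
  next
    case (UN K)
    then obtain X where "X \<in> K" "g \<in> X" by blast
    with UN have "eventually (\<lambda>n. G n \<in> X) sequentially" by blast
    thus ?case using \<open>X \<in> K\<close> by (auto elim: eventually_mono)
  qed (auto intro: eventually_conj)
  have "g \<in> topspace schwartz_topology"
    unfolding schwartz_topology_def topology_generated_by_topspace
  proof (rule UnionI)
    show "{h \<in> schwartz. schwartz_seminorm 0 [] (\<lambda>x. h x - g x) < 1} \<in> ?B"
      by (rule CollectI, intro exI[of _ 0] exI[of _ "[]"] exI[of _ g] exI[of _ "1::real"]) (simp add: g)
    show "g \<in> {h \<in> schwartz. schwartz_seminorm 0 [] (\<lambda>x. h x - g x) < 1}"
      by (simp add: g schwartz_seminorm_def)
  qed
  thus ?thesis unfolding limitin_def
    using ev by (auto simp: schwartz_topology_def openin_topology_generated_by_iff)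
qed

lemma schwartz_inf_dual_functional:
  fixes u :: "(real^'n \<Rightarrow> complex) \<Rightarrow> complex"
  assumes "u \<in> schwartz_inf_dual" shows "functional u"
  unfolding functional_def
proof safe
  fix f g :: "real^'n \<Rightarrow> complex" and c
  assume "f \<in> away" 
  hence f: "f \<in> schwartz_inf" using away_subset_schwartz_inf by blast
  show "u (\<lambda>x. c * f x) = c * u f" using f assms by (simp add: schwartz_inf_dual_def)
  assume "g \<in> away" hence "g \<in> schwartz_inf" using away_subset_schwartz_inf by blast
  thus "u (\<lambda>x. f x + g x) = u f + u g" using f assms by (simp add: schwartz_inf_dual_def)
next
  fix G :: "nat \<Rightarrow> real^'n \<Rightarrow> complex" and g
  assume G: "\<forall>n. G n \<in> away" and g: "g \<in> away" and lim: "schwartz_lim G g"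
  have "limitin schwartz_topology G g sequentially"
    by (rule schwartz_lim_limitin) (use G g lim in \<open>auto simp: away_schwartz\<close>)
  moreover have "g \<in> schwartz_inf" using g away_subset_schwartz_inf by blast
  moreover have "G n \<in> schwartz_inf" for n using G away_subset_schwartz_inf by blast
  ultimately have "limitin (subtopology schwartz_topology schwartz_inf) G g sequentially"
    unfolding limitin_subtopology by (intro conjI always_eventually) auto
  moreover have "continuous_map (subtopology schwartz_topology schwartz_inf) euclidean u"
    using assms by (simp add: schwartz_inf_dual_def)
  ultimately have "limitin euclidean (u \<circ> G) (u g) sequentially"
    by (rule continuous_map_limit[rotated])
  thus "(\<lambda>n. u (G n)) \<longlonglongrightarrow> u g" by (simp add: o_def)
qed

lemma schwartz_lim_dilate:
  fixes g :: "real^'n \<Rightarrow> complex"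
  assumes G: "\<And>n. G n \<in> schwartz" and g: "g \<in> schwartz" and lim: "schwartz_lim G g"
  shows "schwartz_lim (\<lambda>n. dilate j (G n)) (dilate j g)"
  unfolding schwartz_lim_def
proof (intro allI)
  fix k and "is" :: "'n list"
  obtain e where e: "e \<longlonglongrightarrow> 0" and le: "\<And>n y. (1 + norm y) ^ k * norm (partials is (G n) y - partials is g y) \<le> e n"
    using lim unfolding schwartz_lim_def by metis
  define c :: real where "c = 2 powi j"
  have c: "c > 0" by (simp add: c_def)
  define A where "A = 2 powi (j * int CARD('n)) * c ^ length is"
  have A: "A \<ge> 0" using c by (simp add: A_def)
  have eq: "partials is (dilate j h) y = of_real A * partials is h (c *\<^sub>R y)" if "h \<in> schwartz" for h :: "real^'n \<Rightarrow> complex" and y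
    by (simp add: partials_dilate schwartz_smooth that A_def c_def)
  have "(1 + norm y) ^ k * norm (partials is (dilate j (G n)) y - partials is (dilate j g) y) \<le>
      A * (1 + inverse c) ^ k * e n" for n y
  proof -
    have "1 + norm y \<le> (1 + inverse c) * (1 + norm (c *\<^sub>R y))"
      using c by (simp add: field_simps)
    hence "(1 + norm y) ^ k \<le> (1 + inverse c) ^ k * (1 + norm (c *\<^sub>R y)) ^ k"
      unfolding power_mult_distrib[symmetric] by (intro power_mono) auto
    moreover have "norm (partials is (dilate j (G n)) y - partials is (dilate j g) y) =
        A * norm (partials is (G n) (c *\<^sub>R y) - partials is g (c *\<^sub>R y))"
      unfolding eq[OF G] eq[OF g] right_diff_distrib[symmetric] norm_mult using A by simp
    ultimately have "(1 + norm y) ^ k * norm (partials is (dilate j (G n)) y - partials is (dilate j g) y) \<le>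
      ((1 + inverse c) ^ k * (1 + norm (c *\<^sub>R y)) ^ k) * (A * norm (partials is (G n) (c *\<^sub>R y) - partials is g (c *\<^sub>R y)))"
      using A by (simp only:) (intro mult_right_mono, auto)
    also have "\<dots> = A * (1 + inverse c) ^ k * ((1 + norm (c *\<^sub>R y)) ^ k * norm (partials is (G n) (c *\<^sub>R y) - partials is g (c *\<^sub>R y)))"
      by (simp add: mult_ac)
    also have "\<dots> \<le> A * (1 + inverse c) ^ k * e n"
      using A c by (intro mult_left_mono le) auto
    finally show ?thesis .
  qed
  moreover have "(\<lambda>n. A * (1 + inverse c) ^ k * e n) \<longlonglongrightarrow> 0"
    using tendsto_mult_right_zero[OF e] by simp
  ultimately show "\<exists>e. e \<longlonglongrightarrow> 0 \<and> (\<forall>n y. (1 + norm y) ^ k *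
      norm (partials is (dilate j (G n)) y - partials is (dilate j g) y) \<le> e n)"
    by blast
qed

lemma functional_dilate:
  fixes u :: "(real^'n \<Rightarrow> complex) \<Rightarrow> complex"
  assumes u: "functional u" shows "functional (\<lambda>g. u (dilate j g))"
  unfolding functional_def
proof safe
  fix f g :: "real^'n \<Rightarrow> complex" and c
  assume f: "f \<in> away"
  have "dilate j (\<lambda>x. c * f x) = (\<lambda>x. c * dilate j f x)" by (simp add: dilate_def fun_eq_iff)
  thus "u (dilate j (\<lambda>x. c * f x)) = c * u (dilate j f)"
    using functional_cmult[OF u away_dilate[OF f]] by simp
  assume g: "g \<in> away"
  have "dilate j (\<lambda>x. f x + g x) = (\<lambda>x. dilate j f x + dilate j g x)"
    by (simp add: dilate_def fun_eq_iff distrib_left)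
  thus "u (dilate j (\<lambda>x. f x + g x)) = u (dilate j f) + u (dilate j g)"
    using functional_add[OF u away_dilate[OF f] away_dilate[OF g]] by simp
next
  fix G :: "nat \<Rightarrow> real^'n \<Rightarrow> complex" and g
  assume G: "\<forall>n. G n \<in> away" and g: "g \<in> away" and lim: "schwartz_lim G g"
  show "(\<lambda>n. u (dilate j (G n))) \<longlonglongrightarrow> u (dilate j g)"
  proof -
    have "schwartz_lim (\<lambda>n. dilate j (G n)) (dilate j g)"
      using schwartz_lim_dilate[OF _ _ lim, of j] G g by (simp add: away_schwartz)
    thus ?thesis using G g by (intro functional_lim[OF u] away_dilate) auto
  qed
qed

section \<open>Superposition of translates\<close>

lemma directional_quotient_tendsto:
  fixes f :: "'a::real_normed_vector \<Rightarrow> 'b::real_normed_vector"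
  assumes D: "(f has_derivative D) (at x)" and v: "v \<noteq> 0"
  shows "(\<lambda>n. real (Suc n) *\<^sub>R (f (x + inverse (real (Suc n)) *\<^sub>R v) - f x)) \<longlonglongrightarrow> D v"
proof -
  define h where "h n = inverse (real (Suc n)) *\<^sub>R v" for n
  have h0: "h n \<noteq> 0" for n using v by (simp add: h_def del: of_nat_Suc)
  have "h \<longlonglongrightarrow> 0 *\<^sub>R v"
    unfolding h_def by (intro tendsto_intros LIMSEQ_inverse_real_of_nat)
  hence "filterlim h (at 0) sequentially"
    using h0 by (intro filterlim_atI always_eventually) auto
  moreover have "((\<lambda>h. norm (f (x + h) - f x - D h) / norm h) \<longlongrightarrow> 0) (at 0)"
    using D by (simp add: has_derivative_at)
  ultimately have "(\<lambda>n. norm (f (x + h n) - f x - D (h n)) / norm (h n)) \<longlonglongrightarrow> 0"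
    by (rule filterlim_compose[rotated])
  hence "(\<lambda>n. norm (f (x + h n) - f x - D (h n)) / norm (h n) * norm v) \<longlonglongrightarrow> 0 * norm v"
    by (intro tendsto_intros)
  moreover have "norm (f (x + h n) - f x - D (h n)) / norm (h n) * norm v =
      norm (real (Suc n) *\<^sub>R (f (x + h n) - f x) - D v)" for n
  proof -
    have "D (h n) = inverse (real (Suc n)) *\<^sub>R D v"
      using linear_scale[OF has_derivative_linear[OF D]] by (simp add: h_def)
    hence "real (Suc n) *\<^sub>R (f (x + h n) - f x) - D v = real (Suc n) *\<^sub>R (f (x + h n) - f x - D (h n))"
      by (simp add: scaleR_right_diff_distrib del: of_nat_Suc)
    moreover have "norm (h n) = inverse (real (Suc n)) * norm v" by (simp add: h_def)
    ultimately show ?thesis using v by (simp add: divide_inverse del: of_nat_Suc)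
  qed
  ultimately have "(\<lambda>n. norm (real (Suc n) *\<^sub>R (f (x + h n) - f x) - D v)) \<longlonglongrightarrow> 0" by simp
  thus ?thesis unfolding h_def by (simp only: tendsto_norm_zero_iff LIM_zero_iff)
qed

text \<open>Differentiation under the integral along a coordinate axis, by dominated convergence.\<close>

lemma partial_conv_tendsto:
  fixes g k :: "real^'n \<Rightarrow> complex"
  assumes g: "rapid g" and k: "k \<in> schwartz"
  shows "(\<lambda>n. real (Suc n) *\<^sub>R (convolve g (partials is k) (y + inverse (real (Suc n)) *\<^sub>R axis i 1) - convolve g (partials is k) y))
    \<longlonglongrightarrow> convolve g (partials (i # is) k) y"
proof -
  let ?k = "partials is k"
  have rk: "rapid ?k" "rapid (partials (i # is) k)" by (intro schwartz_rapid k)+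
  have [measurable]: "g \<in> borel_measurable borel" "?k \<in> borel_measurable borel"
      "partials (i # is) k \<in> borel_measurable borel"
    using g rk by (simp_all add: rapid_measurable)
  obtain C where C: "C \<ge> 1" "\<And>x y. norm (?k x - ?k y) \<le> C * norm (x - y)"
    using wlip_bound[OF schwartz_wlip[OF k], of 0 "is"] by auto
  define e where "e n = inverse (real (Suc n)) *\<^sub>R (axis i 1 :: real^'n)" for n
  have eq: "real (Suc n) *\<^sub>R (convolve g ?k (y + e n) - convolve g ?k y) =
      (LINT w|lborel. g w * (real (Suc n) *\<^sub>R (?k (y - w + e n) - ?k (y - w))))" for n
  proof -
    have "convolve g ?k (y + e n) - convolve g ?k y = (LINT w|lborel. g w * ?k (y + e n - w) - g w * ?k (y - w))"
      unfolding convolve_def by (rule Bochner_Integration.integral_diff[symmetric]) (intro rapid_conv_integrable g rk)+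
    hence "real (Suc n) *\<^sub>R (convolve g ?k (y + e n) - convolve g ?k y) =
        (LINT w|lborel. real (Suc n) *\<^sub>R (g w * ?k (y + e n - w) - g w * ?k (y - w)))"
      by simp
    also have "\<dots> = (LINT w|lborel. g w * (real (Suc n) *\<^sub>R (?k (y - w + e n) - ?k (y - w))))"
      by (rule Bochner_Integration.integral_cong) (simp_all add: algebra_simps)
    finally show ?thesis .
  qed
  have "(\<lambda>n. LINT w|lborel. g w * (real (Suc n) *\<^sub>R (?k (y - w + e n) - ?k (y - w)))) \<longlonglongrightarrow>
      (LINT w|lborel. g w * partials (i # is) k (y - w))"
  proof (rule integral_dominated_convergence[where w="\<lambda>w. C * norm (g w)"])
    show "integrable lborel (\<lambda>w. C * norm (g w))" using rapid_integrable[OF g] by simp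
    show "AE w in lborel. (\<lambda>n. g w * (real (Suc n) *\<^sub>R (?k (y - w + e n) - ?k (y - w)))) \<longlonglongrightarrow> g w * partials (i # is) k (y - w)"
    proof (intro AE_I2 tendsto_mult tendsto_const)
      fix w
      have "partials (i # is) k (y - w) = frechet_derivative ?k (at (y - w)) (axis i 1)"
        by (simp add: partials_Cons partial_def)
      thus "(\<lambda>n. real (Suc n) *\<^sub>R (?k (y - w + e n) - ?k (y - w))) \<longlonglongrightarrow> partials (i # is) k (y - w)"
        unfolding e_def
        using directional_quotient_tendsto[OF smooth_has_derivative[OF schwartz_smooth[OF k]], of "axis i 1" "is" "y - w"]
        by (simp add: axis_eq_0_iff)
    qed
    show "AE w in lborel. norm (g w * (real (Suc n) *\<^sub>R (?k (y - w + e n) - ?k (y - w)))) \<le> C * norm (g w)" for n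
    proof (rule AE_I2)
      fix w
      have "norm (real (Suc n) *\<^sub>R (?k (y - w + e n) - ?k (y - w))) \<le> real (Suc n) * (C * norm (e n))"
        using C(2)[of "y - w + e n" "y - w"] by (simp add: mult_left_mono del: of_nat_Suc)
      also have "\<dots> = C" by (simp add: e_def norm_axis_1 del: of_nat_Suc)
      finally have "norm (real (Suc n) *\<^sub>R (?k (y - w + e n) - ?k (y - w))) \<le> C" .
      from mult_left_mono[OF this, of "norm (g w)"]
      show "norm (g w * (real (Suc n) *\<^sub>R (?k (y - w + e n) - ?k (y - w)))) \<le> C * norm (g w)"
        by (simp only: norm_mult mult.commute[of C]) simp
    qed
  qed auto
  thus ?thesis unfolding e_def[symmetric] eq convolve_def[of g "partials (i # is) k"] .
qed

text \<open>As \<open>T\<close> is known to be smooth, its partial derivatives are limits of difference quotients along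
  sequences, and no differentiability of the convolutions has to be proved.\<close>

lemma partials_superposition:
  fixes g k :: "'m \<Rightarrow> real^'n \<Rightarrow> complex"
  assumes g: "\<And>m. m \<in> F \<Longrightarrow> rapid (g m)" and k: "\<And>m. m \<in> F \<Longrightarrow> k m \<in> schwartz"
    and T: "smooth T" and eq: "\<And>y. T y = (\<Sum>m\<in>F. convolve (g m) (k m) y)"
  shows "partials is T y = (\<Sum>m\<in>F. convolve (g m) (partials is (k m)) y)"
proof (induction "is" arbitrary: y)
  case (Cons i "is")
  have "(\<lambda>n. real (Suc n) *\<^sub>R (partials is T (y + inverse (real (Suc n)) *\<^sub>R axis i 1) - partials is T y))
      \<longlonglongrightarrow> partials (i # is) T y"
    using directional_quotient_tendsto[OF smooth_has_derivative[OF T], of "axis i 1" "is" y]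
    by (simp add: axis_eq_0_iff partials_Cons partial_def)
  moreover have "(\<lambda>n. real (Suc n) *\<^sub>R (partials is T (y + inverse (real (Suc n)) *\<^sub>R axis i 1) - partials is T y))
      \<longlonglongrightarrow> (\<Sum>m\<in>F. convolve (g m) (partials (i # is) (k m)) y)"
    unfolding Cons.IH sum_subtractf[symmetric] scaleR_sum_right
    by (intro tendsto_sum partial_conv_tendsto g k)
  ultimately show ?case by (rule LIMSEQ_unique)
qed (simp add: eq)

lemma integral_simple_decomp:
  fixes g :: "real^'n \<Rightarrow> complex" and s :: "real^'n \<Rightarrow> 'c"
  assumes g: "integrable lborel g" and s: "simple_function lborel s"
  shows "(LINT w|lborel. g w * K (s w)) = (\<Sum>v\<in>range s. (LINT w|lborel. indicator (s -` {v}) w *\<^sub>R g w) * K v)"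
    and "integrable lborel (\<lambda>w. g w * K (s w))"
proof -
  have fin: "finite (range s)" using s by (simp add: simple_function_def)
  have sm: "s -` {v} \<in> sets lborel" for v
    using simple_functionD(2)[OF s, where X="{v}"] by simp
  have i: "integrable lborel (\<lambda>w. indicator (s -` {v}) w *\<^sub>R g w)" for v
    using integrable_mult_indicator[OF sm g] .
  have eq: "g w * K (s w) = (\<Sum>v\<in>range s. (indicator (s -` {v}) w *\<^sub>R g w) * K v)" for w
  proof -
    have "(\<Sum>v\<in>range s. (indicator (s -` {v}) w *\<^sub>R g w) * K v) = (\<Sum>v\<in>range s. if v = s w then g w * K v else 0)"
      by (rule sum.cong) (auto simp: indicator_def)
    thus ?thesis using fin by simp
  qed
  show "(LINT w|lborel. g w * K (s w)) = (\<Sum>v\<in>range s. (LINT w|lborel. indicator (s -` {v}) w *\<^sub>R g w) * K v)"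
  proof -
    have "(LINT w|lborel. g w * K (s w)) = (\<Sum>v\<in>range s. LINT w|lborel. (indicator (s -` {v}) w *\<^sub>R g w) * K v)"
      unfolding eq by (rule Bochner_Integration.integral_sum) (intro integrable_mult_left i)
    thus ?thesis by (simp only: integral_mult_left_zero)
  qed
  show "integrable lborel (\<lambda>w. g w * K (s w))"
    unfolding eq by (intro Bochner_Integration.integrable_sum integrable_mult_left i)
qed

text \<open>Replacing \<open>w\<close> by a simple function \<open>s n w\<close> turns the convolution integrals into finite linear
  combinations of translates, for which linearity gives the bound.  With \<open>s n w\<close> converging to \<open>w\<close>
  and \<open>norm (s n w) \<le> 2 * norm w\<close> these combinations converge to \<open>T\<close> in the Schwartz topology by
  dominated convergence; the factor 2 in the hypothesis comes from here.\<close>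

lemma functional_superposition:
  fixes u :: "(real^'n \<Rightarrow> complex) \<Rightarrow> complex" and g k :: "'m \<Rightarrow> real^'n \<Rightarrow> complex"
  assumes u: "functional u" and F: "finite F"
    and g: "\<And>m. m \<in> F \<Longrightarrow> rapid (g m)" and k: "\<And>m. m \<in> F \<Longrightarrow> k m \<in> away"
    and T: "T \<in> away" and eq: "\<And>y. T y = (\<Sum>m\<in>F. convolve (g m) (k m) y)"
    and bound: "\<And>m v w. m \<in> F \<Longrightarrow> norm v \<le> 2 * norm w \<Longrightarrow>
      norm (g m w) * norm (u (\<lambda>y. k m (y - v))) \<le> B * weight w"
  shows "norm (u T) \<le> real (card F) * B * (LINT w|lborel. weight (w::real^'n))"
proof -
  have "(\<lambda>x::real^'n. x) \<in> borel_measurable lborel" by simp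
  from borel_measurable_implies_sequence_metric[OF this, of 0]
  obtain s :: "nat \<Rightarrow> real^'n \<Rightarrow> real^'n" where s: "\<And>n. simple_function lborel (s n)"
    and slim: "\<And>x. (\<lambda>n. s n x) \<longlonglongrightarrow> x" and sb: "\<And>n x. norm (s n x) \<le> 2 * norm x"
    by (auto simp: dist_norm)
  have sm[measurable]: "s n \<in> borel_measurable borel" for n
    using borel_measurable_simple_function[OF s[of n]] by simp
  have fin: "finite (range (s n))" for n using s[of n] by (simp add: simple_function_def)
  have smv: "s n -` {v} \<in> sets lborel" for n v
    using simple_functionD(2)[OF s, where X="{v}"] by simp
  define c where "c n m v = (LINT w|lborel. indicator (s n -` {v}) w *\<^sub>R g m w)" for n m v
  \<comment> \<open>the convolution integrals with \<open>y - w\<close> replaced by \<open>y - s n w\<close>\<close>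
  define R where "R n y = (\<Sum>m\<in>F. \<Sum>v\<in>range (s n). c n m v * k m (y - v))" for n y
  have gi: "integrable lborel (g m)" if "m \<in> F" for m using rapid_integrable[OF g[OF that]] .
  have Raway: "R n \<in> away" for n
    unfolding R_def by (intro away_sum away_cmult away_translate k)
  have Rpart: "partials is (R n) y = (\<Sum>m\<in>F. LINT w|lborel. g m w * partials is (k m) (y - s n w))" for n "is" y
  proof -
    have ks: "m \<in> F \<Longrightarrow> k m \<in> schwartz" for m using k away_schwartz by blast
    have "partials is (R n) y = (\<Sum>m\<in>F. partials is (\<lambda>y. \<Sum>v\<in>range (s n). c n m v * k m (y - v)) y)"
      unfolding R_def by (subst partials_sum) (auto intro!: schwartz_sum schwartz_cmult schwartz_translate ks)
    also have "\<dots> = (\<Sum>m\<in>F. \<Sum>v\<in>range (s n). c n m v * partials is (k m) (y - v))"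
    proof (rule sum.cong)
      fix m assume m: "m \<in> F"
      have "partials is (\<lambda>y. \<Sum>v\<in>range (s n). c n m v * k m (y - v)) y =
          (\<Sum>v\<in>range (s n). partials is (\<lambda>y. c n m v * k m (y - v)) y)"
        by (subst partials_sum) (auto intro!: schwartz_cmult schwartz_translate ks m)
      also have "\<dots> = (\<Sum>v\<in>range (s n). c n m v * partials is (k m) (y - v))"
        by (intro sum.cong refl)
          (simp add: partials_cmult partials_translate schwartz_smooth schwartz_translate ks m)
      finally show "partials is (\<lambda>y. \<Sum>v\<in>range (s n). c n m v * k m (y - v)) y =
          (\<Sum>v\<in>range (s n). c n m v * partials is (k m) (y - v))" .
    qed simp
    also have "\<dots> = (\<Sum>m\<in>F. LINT w|lborel. g m w * partials is (k m) (y - s n w))"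
      unfolding c_def
      by (intro sum.cong refl integral_simple_decomp(1)[OF gi s, symmetric, where K="\<lambda>v. partials is (k _) (y - v)"])
    finally show ?thesis .
  qed
  have lim: "schwartz_lim R T"
    unfolding schwartz_lim_def
  proof (intro allI)
    fix K and "is" :: "'n list"
    have "\<exists>C\<ge>1. \<forall>x y. (1 + norm x) ^ K * norm (partials is (k m) x - partials is (k m) y) \<le> C * norm (x - y) * (1 + norm (x - y)) ^ K"
      if "m \<in> F" for m
      using wlip_bound[OF schwartz_wlip[OF away_schwartz[OF k[OF that]], of "is"], of K] by metis
    then obtain C where C1: "\<And>m. m \<in> F \<Longrightarrow> C m \<ge> 1" and C: "\<And>m x y. m \<in> F \<Longrightarrow> (1 + norm x) ^ K * norm (partials is (k m) x - partials is (k m) y) \<le> C m * norm (x - y) * (1 + norm (x - y)) ^ K"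
      by metis
    define d where "d n m w = norm (g m w) * (1 + norm w) ^ K * (C m * norm (s n w - w) * (1 + norm (s n w - w)) ^ K)" for n m w
    define dom where "dom m w = C m * 3 * 3 ^ K * ((1 + norm w) ^ (K + 1 + K) * norm (g m w))" for m w
    have snw: "norm (s n w - w) \<le> 3 * norm w" for n w
      using norm_triangle_ineq4[of "s n w" w] sb[of n w] by simp
    have ddom: "0 \<le> d n m w \<and> d n m w \<le> dom m w" if "m \<in> F" for n m w
    proof -
      have "norm (s n w - w) \<le> 3 * (1 + norm w)" "1 + norm (s n w - w) \<le> 3 * (1 + norm w)"
        using snw[of n w] norm_ge_zero[of w] by auto
      hence "norm (s n w - w) * (1 + norm (s n w - w)) ^ K \<le> (3 * (1 + norm w)) * (3 * (1 + norm w)) ^ K"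
        by (intro mult_mono power_mono) auto
      hence "norm (g m w) * (1 + norm w) ^ K * (C m * (norm (s n w - w) * (1 + norm (s n w - w)) ^ K)) \<le>
        norm (g m w) * (1 + norm w) ^ K * (C m * ((3 * (1 + norm w)) * (3 * (1 + norm w)) ^ K))"
        using C1[OF that] by (intro mult_left_mono) auto
      also have "\<dots> = dom m w"
        by (simp only: dom_def power_add power_mult_distrib power_one_right mult_ac)
      finally show ?thesis using C1[OF that] by (simp add: d_def mult.assoc)
    qed
    have domi: "integrable lborel (dom m)" if "m \<in> F" for m
      unfolding dom_def by (intro integrable_mult_right rapid_integrable_moment g that)
    have dm: "d n m \<in> borel_measurable lborel" if "m \<in> F" for n m
    proof -
      have [measurable]: "g m \<in> borel_measurable borel" using rapid_measurable[OF g[OF that]] .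
      show ?thesis unfolding d_def by measurable
    qed
    have di: "integrable lborel (d n m)" if "m \<in> F" for n m
      by (rule Bochner_Integration.integrable_bound[OF domi[OF that] dm[OF that]])
        (use ddom[OF that] in \<open>auto intro!: AE_I2\<close>, smt (verit))
    have "(\<lambda>n. \<Sum>m\<in>F. LINT w|lborel. d n m w) \<longlonglongrightarrow> (\<Sum>m\<in>F. LINT w|(lborel::(real^'n) measure). (0::real))"
    proof (intro tendsto_sum)
      fix m assume m: "m \<in> F"
      show "(\<lambda>n. LINT w|lborel. d n m w) \<longlonglongrightarrow> (LINT w|(lborel::(real^'n) measure). (0::real))"
      proof (rule integral_dominated_convergence[where w="dom m"])
        show "AE w in lborel. (\<lambda>n. d n m w) \<longlonglongrightarrow> 0"
        proof (rule AE_I2)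
          fix w
          have "(\<lambda>n. d n m w) \<longlonglongrightarrow> norm (g m w) * (1 + norm w) ^ K * (C m * norm (w - w) * (1 + norm (w - w)) ^ K)"
            unfolding d_def by (intro tendsto_intros slim)
          thus "(\<lambda>n. d n m w) \<longlonglongrightarrow> 0" by simp
        qed
        show "AE w in lborel. norm (d n m w) \<le> dom m w" for n
          using ddom[OF m] by (intro AE_I2) simp
      qed (use dm[OF m] domi[OF m] in auto)
    qed
    hence e0: "(\<lambda>n. \<Sum>m\<in>F. LINT w|lborel. d n m w) \<longlonglongrightarrow> 0" by simp
    have "(1 + norm y) ^ K * norm (partials is (R n) y - partials is T y) \<le> (\<Sum>m\<in>F. LINT w|lborel. d n m w)" for n y
    proof -
      have P: "partials is T y = (\<Sum>m\<in>F. convolve (g m) (partials is (k m)) y)"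
        by (rule partials_superposition[OF g away_schwartz[OF k] schwartz_smooth[OF away_schwartz[OF T]] eq])
      have "partials is (R n) y - partials is T y =
          (\<Sum>m\<in>F. (LINT w|lborel. g m w * partials is (k m) (y - s n w)) - convolve (g m) (partials is (k m)) y)"
        unfolding Rpart sum_subtractf P ..
      hence "norm (partials is (R n) y - partials is T y) \<le>
          (\<Sum>m\<in>F. norm ((LINT w|lborel. g m w * partials is (k m) (y - s n w)) - convolve (g m) (partials is (k m)) y))"
        by (simp only: norm_sum)
      hence "(1 + norm y) ^ K * norm (partials is (R n) y - partials is T y) \<le>
          (1 + norm y) ^ K * (\<Sum>m\<in>F. norm ((LINT w|lborel. g m w * partials is (k m) (y - s n w)) - convolve (g m) (partials is (k m)) y))"
        by (rule mult_left_mono) simp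
      also have "\<dots> \<le> (\<Sum>m\<in>F. LINT w|lborel. d n m w)"
        unfolding sum_distrib_left
      proof (rule sum_mono)
        fix m assume m: "m \<in> F"
        let ?k = "partials is (k m)"
        have rk: "rapid ?k" by (rule schwartz_rapid[OF away_schwartz[OF k[OF m]]])
        have i1: "integrable lborel (\<lambda>w. g m w * ?k (y - s n w))"
          using integral_simple_decomp(2)[OF gi[OF m] s, where K="\<lambda>v. ?k (y - v)"] .
        have i2: "integrable lborel (\<lambda>w. g m w * ?k (y - w))"
          by (rule rapid_conv_integrable[OF g[OF m] rk])
        have "norm ((LINT w|lborel. g m w * ?k (y - s n w)) - convolve (g m) ?k y) =
            norm (LINT w|lborel. g m w * ?k (y - s n w) - g m w * ?k (y - w))"
          unfolding convolve_def by (subst Bochner_Integration.integral_diff[OF i1 i2]) simp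
        also have "\<dots> \<le> (LINT w|lborel. norm (g m w * ?k (y - s n w) - g m w * ?k (y - w)))"
          by (rule integral_norm_bound)
        finally have "(1 + norm y) ^ K * norm ((LINT w|lborel. g m w * ?k (y - s n w)) - convolve (g m) ?k y) \<le>
            (1 + norm y) ^ K * (LINT w|lborel. norm (g m w * ?k (y - s n w) - g m w * ?k (y - w)))"
          by (rule mult_left_mono) simp
        also have "\<dots> = (LINT w|lborel. (1 + norm y) ^ K * norm (g m w * ?k (y - s n w) - g m w * ?k (y - w)))"
          by simp
        also have "\<dots> \<le> (LINT w|lborel. d n m w)"
        proof (rule integral_mono)
          show "integrable lborel (\<lambda>w. (1 + norm y) ^ K * norm (g m w * ?k (y - s n w) - g m w * ?k (y - w)))"
            using i1 i2 by (intro integrable_mult_right integrable_norm Bochner_Integration.integrable_diff)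
          show "integrable lborel (d n m)" by (rule di[OF m])
          fix w
          have "(1 + norm y) ^ K * norm (g m w * ?k (y - s n w) - g m w * ?k (y - w)) \<le>
            ((1 + norm (y - w)) ^ K * (1 + norm w) ^ K) * (norm (g m w) * norm (?k (y - s n w) - ?k (y - w)))"
            unfolding right_diff_distrib[symmetric] norm_mult
            by (intro mult_right_mono one_plus_norm_pow_diff) simp
          also have "\<dots> = norm (g m w) * (1 + norm w) ^ K * ((1 + norm (y - w)) ^ K * norm (?k (y - w) - ?k (y - s n w)))"
            by (simp add: mult_ac norm_minus_commute)
          also have "\<dots> \<le> d n m w"
            unfolding d_def using C[OF m, of "y - w" "y - s n w"] by (intro mult_left_mono) auto
          finally show "(1 + norm y) ^ K * norm (g m w * ?k (y - s n w) - g m w * ?k (y - w)) \<le> d n m w" .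
        qed
        finally show "(1 + norm y) ^ K * norm ((LINT w|lborel. g m w * ?k (y - s n w)) - convolve (g m) ?k y) \<le>
            (LINT w|lborel. d n m w)" .
      qed
      finally show ?thesis .
    qed
    with e0 show "\<exists>e. e \<longlonglongrightarrow> 0 \<and> (\<forall>n y. (1 + norm y) ^ K * norm (partials is (R n) y - partials is T y) \<le> e n)"
      by blast
  qed
  have "(\<lambda>n. u (R n)) \<longlonglongrightarrow> u T" by (rule functional_lim[OF u Raway T lim])
  hence "(\<lambda>n. norm (u (R n))) \<longlonglongrightarrow> norm (u T)" by (rule tendsto_norm)
  moreover have "norm (u (R n)) \<le> real (card F) * B * (LINT w|lborel. weight (w::real^'n))" for n
  proof -
    have "u (R n) = (\<Sum>m\<in>F. \<Sum>v\<in>range (s n). c n m v * u (\<lambda>y. k m (y - v)))"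
    proof -
      have "u (R n) = (\<Sum>m\<in>F. u (\<lambda>y. \<Sum>v\<in>range (s n). c n m v * k m (y - v)))"
        unfolding R_def by (intro functional_sum u away_sum away_cmult away_translate k)
      also have "\<dots> = (\<Sum>m\<in>F. \<Sum>v\<in>range (s n). u (\<lambda>y. c n m v * k m (y - v)))"
        by (intro sum.cong refl functional_sum u away_cmult away_translate k)
      also have "\<dots> = (\<Sum>m\<in>F. \<Sum>v\<in>range (s n). c n m v * u (\<lambda>y. k m (y - v)))"
        by (intro sum.cong refl functional_cmult u away_translate k)
      finally show ?thesis .
    qed
    hence "norm (u (R n)) \<le> (\<Sum>m\<in>F. \<Sum>v\<in>range (s n). norm (c n m v * u (\<lambda>y. k m (y - v))))"
      by (simp only:) (intro sum_norm_le order_refl)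
    also have "\<dots> \<le> (\<Sum>m\<in>F. \<Sum>v\<in>range (s n). LINT w|lborel. indicator (s n -` {v}) w *\<^sub>R (B * weight w))"
    proof (intro sum_mono)
      fix m v assume m: "m \<in> F" and v: "v \<in> range (s n)"
      have wi: "integrable lborel (\<lambda>w::real^'n. B * weight w)" using integrable_weight[where 'n='n] by simp
      have "norm (c n m v * u (\<lambda>y. k m (y - v))) \<le>
          (LINT w|lborel. norm (indicator (s n -` {v}) w *\<^sub>R g m w)) * norm (u (\<lambda>y. k m (y - v)))"
        unfolding c_def norm_mult by (intro mult_right_mono integral_norm_bound) simp
      also have "\<dots> = (LINT w|lborel. norm (indicator (s n -` {v}) w *\<^sub>R g m w) * norm (u (\<lambda>y. k m (y - v))))"
        by simp
      also have "\<dots> \<le> (LINT w|lborel. indicator (s n -` {v}) w *\<^sub>R (B * weight w))"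
      proof (rule integral_mono)
        show "integrable lborel (\<lambda>w. norm (indicator (s n -` {v}) w *\<^sub>R g m w) * norm (u (\<lambda>y. k m (y - v))))"
          by (intro integrable_mult_left integrable_norm integrable_mult_indicator smv gi m)
        show "integrable lborel (\<lambda>w. indicator (s n -` {v}) w *\<^sub>R (B * weight w))"
          by (intro integrable_mult_indicator smv wi)
        show "norm (indicator (s n -` {v}) w *\<^sub>R g m w) * norm (u (\<lambda>y. k m (y - v))) \<le>
            indicator (s n -` {v}) w *\<^sub>R (B * weight w)" for w
          using bound[OF m, of v w] sb[of n w] by (auto simp: indicator_def)
      qed
      finally show "norm (c n m v * u (\<lambda>y. k m (y - v))) \<le> (LINT w|lborel. indicator (s n -` {v}) w *\<^sub>R (B * weight w))" .
    qed
    also have "\<dots> = (\<Sum>m\<in>F. LINT w|lborel. B * weight (w::real^'n))"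
    proof (rule sum.cong[OF refl])
      fix m assume "m \<in> F"
      have wi: "integrable lborel (\<lambda>w::real^'n. complex_of_real (B * weight w))"
        using integrable_weight[where 'n='n] by (simp del: of_real_mult)
      have "complex_of_real (LINT w|lborel. B * weight (w::real^'n)) = (LINT w|lborel. complex_of_real (B * weight (w::real^'n)) * 1)"
        by (simp only: mult_1_right integral_complex_of_real)
      also have "\<dots> = (\<Sum>v\<in>range (s n). (LINT w|lborel. indicator (s n -` {v}) w *\<^sub>R complex_of_real (B * weight w)) * 1)"
        by (rule integral_simple_decomp(1)[OF wi s, where K="\<lambda>_. 1"])
      also have "\<dots> = (\<Sum>v\<in>range (s n). complex_of_real (LINT w|lborel. indicator (s n -` {v}) w *\<^sub>R (B * weight w)))"
      proof (rule sum.cong[OF refl])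
        fix v
        have "(\<lambda>w. indicator (s n -` {v}) w *\<^sub>R complex_of_real (B * weight w)) =
            (\<lambda>w. complex_of_real (indicator (s n -` {v}) w *\<^sub>R (B * weight w)))"
          by (simp add: fun_eq_iff scaleR_conv_of_real)
        thus "(LINT w|lborel. indicator (s n -` {v}) w *\<^sub>R complex_of_real (B * weight w)) * 1 =
            complex_of_real (LINT w|lborel. indicator (s n -` {v}) w *\<^sub>R (B * weight w))"
          by (simp only: integral_complex_of_real mult_1_right)
      qed
      also have "\<dots> = complex_of_real (\<Sum>v\<in>range (s n). LINT w|lborel. indicator (s n -` {v}) w *\<^sub>R (B * weight w))"
        by (rule of_real_sum[symmetric])
      finally show "(\<Sum>v\<in>range (s n). LINT w|lborel. indicator (s n -` {v}) w *\<^sub>R (B * weight w)) = (LINT w|lborel. B * weight (w::real^'n))"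
        by (simp only: of_real_eq_iff)
    qed
    also have "\<dots> = real (card F) * B * (LINT w|lborel. weight (w::real^'n))" by simp
    finally show ?thesis .
  qed
  ultimately show ?thesis by (intro tendsto_upperbound[OF _ always_eventually]) auto
qed

section \<open>Sampling\<close>

text \<open>Otherwise translates, normalised to have value one under the functional, would tend to zero in
  the Schwartz topology, since translation by \<open>z\<close> enlarges the seminorms only polynomially in \<open>z\<close>.\<close>

lemma functional_poly_growth:
  fixes k :: "real^'n \<Rightarrow> complex"
  assumes u: "functional u" and k: "k \<in> away"
  obtains M :: nat where "\<And>z. norm (u (\<lambda>y. k (y - z))) \<le> real M * (1 + norm z) ^ M"
proof (rule ccontr)
  assume "\<not> thesis"
  hence "\<forall>M::nat. \<exists>z. real M * (1 + norm z) ^ M < norm (u (\<lambda>y. k (y - z)))"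
    using that by (metis linorder_not_le)
  then obtain z where z: "\<And>M::nat. real M * (1 + norm (z M)) ^ M < norm (u (\<lambda>y. k (y - z M)))"
    by metis
  define a where "a n = u (\<lambda>y. k (y - z n))" for n
  have a: "real n * (1 + norm (z n)) ^ n < norm (a n)" for n unfolding a_def by (rule z)
  have a0: "a n \<noteq> 0" for n
  proof -
    have "0 < norm (a n)" by (rule le_less_trans[OF _ a[of n]]) simp
    thus ?thesis by simp
  qed
  \<comment> \<open>translates normalised to \<open>u (G n) = 1\<close>\<close>
  define G where "G n = (\<lambda>y. inverse (a n) * k (y - z n))" for n
  have GA: "G n \<in> away" for n unfolding G_def by (intro away_cmult away_translate k)
  have uG: "u (G n) = 1" for n
    unfolding G_def using functional_cmult[OF u away_translate[OF k]] a0[of n] by (simp add: a_def)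
  have "schwartz_lim G (\<lambda>x. 0)"
    unfolding schwartz_lim_def
  proof (intro allI)
    fix K and "is" :: "'n list"
    obtain C where C: "C \<ge> 1" "\<And>x. (1 + norm x) ^ K * norm (partials is k x) \<le> C"
      using rapid_bound[OF schwartz_rapid[OF away_schwartz[OF k]]] by metis
    define e where "e n = C * (1 + norm (z n)) ^ K / norm (a n)" for n
    have "(1 + norm y) ^ K * norm (partials is (G n) y - partials is (\<lambda>x. 0) y) \<le> e n" for n y
    proof -
      have "(1 + norm y) ^ K * norm (partials is k (y - z n)) \<le>
          ((1 + norm (y - z n)) ^ K * (1 + norm (z n)) ^ K) * norm (partials is k (y - z n))"
        by (intro mult_right_mono one_plus_norm_pow_diff) simp
      also have "\<dots> = (1 + norm (z n)) ^ K * ((1 + norm (y - z n)) ^ K * norm (partials is k (y - z n)))"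
        by (simp add: mult_ac)
      also have "\<dots> \<le> (1 + norm (z n)) ^ K * C" by (intro mult_left_mono C) simp
      finally have "(1 + norm y) ^ K * norm (partials is k (y - z n)) \<le> (1 + norm (z n)) ^ K * C" .
      hence "(1 + norm y) ^ K * norm (partials is k (y - z n)) / norm (a n) \<le> (1 + norm (z n)) ^ K * C / norm (a n)"
        by (rule divide_right_mono) simp
      thus ?thesis
        by (simp add: G_def partials_zero partials_cmult partials_translate schwartz_smooth schwartz_translate
          away_schwartz[OF k] norm_mult norm_inverse divide_inverse e_def mult_ac)
    qed
    moreover have "e \<longlonglongrightarrow> 0"
    proof (rule tendsto_sandwich)
      show "eventually (\<lambda>n. 0 \<le> e n) sequentially" using C by (simp add: e_def)
      show "eventually (\<lambda>n. e n \<le> C * inverse (real n)) sequentially"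
        using eventually_ge_at_top[of "max K 1"]
      proof eventually_elim
        case (elim n)
        have p: "0 < real n * (1 + norm (z n)) ^ n" using elim by (simp add: add_pos_nonneg)
        have "(1 + norm (z n)) ^ K \<le> (1 + norm (z n)) ^ n"
          by (rule power_increasing) (use elim in auto)
        hence "C * (1 + norm (z n)) ^ K \<le> C * (1 + norm (z n)) ^ n"
          using C(1) by (intro mult_left_mono) auto
        hence "e n \<le> C * (1 + norm (z n)) ^ n / (real n * (1 + norm (z n)) ^ n)"
          unfolding e_def using C(1) p a[of n] by (intro frac_le) auto
        also have "\<dots> = C * inverse (real n)"
        proof -
          have "0 < (1 + norm (z n)) ^ n" by (intro zero_less_power add_pos_nonneg) auto
          hence "(1 + norm (z n)) ^ n \<noteq> 0" by (rule less_imp_neq[symmetric])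
          from nonzero_mult_divide_mult_cancel_right[OF this] show ?thesis by (simp only: divide_inverse)
        qed
        finally show ?case .
      qed
      show "(\<lambda>n. C * inverse (real n)) \<longlonglongrightarrow> 0"
        using tendsto_mult_right_zero[OF lim_inverse_n, of C] by simp
    qed auto
    ultimately show "\<exists>e. e \<longlonglongrightarrow> 0 \<and> (\<forall>n y. (1 + norm y) ^ K * norm (partials is (G n) y - partials is (\<lambda>x. 0) y) \<le> e n)"
      by blast
  qed
  from functional_lim[OF u GA away_zero this] have "(\<lambda>n::nat. 1::complex) \<longlonglongrightarrow> 0"
    by (simp add: uG functional_zero[OF u])
  thus False by (simp add: LIMSEQ_const_iff)
qed

text \<open>For \<open>\<epsilon> * r\<close> below a threshold the weight \<open>(1 + \<epsilon> * r) ^ M\<close> is at most two; above it \<open>r\<close> is so large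
  that the stronger decay of \<open>a\<close> makes the product small.  The scaling factor \<open>t\<close> is there because
  \<open>\<epsilon>\<close> has to be chosen uniformly in the size of the increments considered later.\<close>

lemma slow_weight_absorption:
  fixes H1 H2 :: real and M :: nat
  assumes H1: "H1 > 0" and H2: "H2 \<ge> 0"
  obtains \<epsilon>0 where "0 < \<epsilon>0" "\<epsilon>0 \<le> 1"
    "\<And>\<epsilon> r a t. 0 < \<epsilon> \<Longrightarrow> \<epsilon> \<le> \<epsilon>0 \<Longrightarrow> 0 \<le> r \<Longrightarrow> 0 \<le> a \<Longrightarrow> 0 \<le> t \<Longrightarrow> a \<le> t * H1 \<Longrightarrow>
      a * (1 + r) ^ Suc M \<le> t * H2 \<Longrightarrow> a * (1 + \<epsilon> * r) ^ M \<le> 2 * t * H1"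
proof -
  have "((\<lambda>d::real. (1 + d) ^ M) \<longlongrightarrow> (1 + 0) ^ M) (at_right 0)" by (intro tendsto_intros)
  hence "eventually (\<lambda>d::real. (1 + d) ^ M < 2) (at_right 0)" by (rule order_tendstoD) simp
  then obtain d' :: real where d': "d' > 0" "\<And>d. 0 < d \<Longrightarrow> d < d' \<Longrightarrow> (1 + d) ^ M < 2"
    by (auto simp: eventually_at_right_field)
  define \<delta> where "\<delta> = d' / 2"
  have \<delta>: "\<delta> > 0" "(1 + \<delta>) ^ M < 2" using d' by (auto simp: \<delta>_def)
  define \<epsilon>0 where "\<epsilon>0 = min 1 (2 * H1 * \<delta> / (H2 + 1))"
  have e0: "0 < \<epsilon>0" "\<epsilon>0 \<le> 1" using H1 H2 \<delta> by (auto simp: \<epsilon>0_def)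
  have main: "a * (1 + \<epsilon> * r) ^ M \<le> 2 * t * H1"
    if "0 < \<epsilon>" "\<epsilon> \<le> \<epsilon>0" "0 \<le> r" "0 \<le> a" "0 \<le> t" "a \<le> t * H1" "a * (1 + r) ^ Suc M \<le> t * H2" for \<epsilon> r a t
  proof (cases "\<epsilon> * r \<le> \<delta>")
    case True
    have "(1 + \<epsilon> * r) ^ M \<le> (1 + \<delta>) ^ M" using True that by (intro power_mono) auto
    hence "a * (1 + \<epsilon> * r) ^ M \<le> (t * H1) * 2" using that \<delta> H1 by (intro mult_mono) auto
    thus ?thesis by (simp add: mult_ac)
  next
    case False
    have "\<epsilon> * r \<le> 1 * r" using that e0 by (intro mult_right_mono) auto
    hence "(1 + \<epsilon> * r) ^ M \<le> (1 + r) ^ M" using that by (intro power_mono) auto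
    hence "a * (1 + \<epsilon> * r) ^ M \<le> a * (1 + r) ^ M" using that by (intro mult_left_mono) auto
    also have "\<dots> \<le> t * H2 / (1 + r)" using that(3,7) by (simp add: field_simps)
    also have "\<dots> \<le> t * H2 / (\<delta> / \<epsilon>)"
    proof (rule divide_left_mono)
      have "\<delta> / \<epsilon> \<le> r" using False that(1) by (simp add: field_simps)
      thus "\<delta> / \<epsilon> \<le> 1 + r" by simp
    qed (use that \<delta> H2 in auto)
    also have "\<dots> = t * (H2 * \<epsilon> / \<delta>)" by simp
    also have "\<dots> \<le> t * (2 * H1)"
    proof (rule mult_left_mono)
      have "\<epsilon> * (H2 + 1) \<le> 2 * H1 * \<delta>"
        using that(2) H2 by (simp add: \<epsilon>0_def pos_le_divide_eq)
      hence "H2 * \<epsilon> \<le> 2 * H1 * \<delta>" using that(1) by (simp add: algebra_simps)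
      thus "H2 * \<epsilon> / \<delta> \<le> 2 * H1" using \<delta> by (simp add: pos_divide_le_eq)
    qed (use that in simp)
    finally show ?thesis by (simp add: mult_ac)
  qed
  show ?thesis by (rule that[OF e0 main])
qed

definition corner :: "nat \<Rightarrow> int \<Rightarrow> int^'n \<Rightarrow> real^'n" where
  "corner N j k = (\<chi> i. 2 powi (- j - int N) * of_int (k $ i))"

lemma dist_corner:
  fixes x :: "real^'n"
  assumes "x \<in> dyadic_cube N j k"
  shows "norm (x - corner N j k) \<le> real CARD('n) * 2 powi (- j - int N)"
proof -
  have "norm (x - corner N j k) \<le> (\<Sum>i\<in>UNIV. \<bar>(x - corner N j k) $ i\<bar>)" by (rule norm_le_l1_cart)
  also have "\<dots> \<le> (\<Sum>i\<in>(UNIV::'n set). 2 powi (- j - int N))"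
    using assms by (intro sum_mono) (auto simp: dyadic_cube_def corner_def algebra_simps abs_le_iff, smt (verit))
  finally show ?thesis by simp
qed

lemma corner_in_cube: "corner N j k \<in> dyadic_cube N j k"
  by (simp add: dyadic_cube_def corner_def)

lemma dyadic_cube_cover: "\<exists>k. x \<in> dyadic_cube N j k"
proof -
  define s :: real where "s = 2 powi (- j - int N)"
  have s: "s > 0" by (simp add: s_def)
  have "s * of_int \<lfloor>x $ i / s\<rfloor> \<le> x $ i \<and> x $ i < s * (of_int \<lfloor>x $ i / s\<rfloor> + 1)" for i
  proof -
    have f: "of_int \<lfloor>x $ i / s\<rfloor> \<le> x $ i / s" "x $ i / s < of_int \<lfloor>x $ i / s\<rfloor> + 1" by linarith+
    have "s * of_int \<lfloor>x $ i / s\<rfloor> \<le> s * (x $ i / s)" "s * (x $ i / s) < s * (of_int \<lfloor>x $ i / s\<rfloor> + 1)"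
      using mult_left_mono[OF f(1) less_imp_le[OF s]] mult_strict_left_mono[OF f(2) s] by simp_all
    moreover have "s * (x $ i / s) = x $ i" using s by simp
    ultimately show ?thesis by (simp only:)
  qed
  thus ?thesis unfolding dyadic_cube_def s_def[symmetric]
    by (intro exI[of _ "\<chi> i. \<lfloor>x $ i / s\<rfloor>"]) simp
qed

text \<open>Let \<open>A\<close> be the supremum of \<open>U / V\<close>, where \<open>U x\<close> is the modulus of the functional at the translate
  by \<open>x\<close> and \<open>V\<close> is the weight centred at \<open>x0\<close>, including the auxiliary factor with \<open>\<epsilon>\<close>.
  By \<open>k = \<eta> \<star> k\<close> the difference of two translates of \<open>k\<close> is a superposition of translates whose
  coefficient function, an increment of \<open>\<eta>\<close>, is as small as the distance of the two points.
  Hence \<open>U\<close> varies on a cube by at most \<open>A * V x / 2\<close>, and \<open>A\<close> is bounded by a multiple of \<open>B\<close> plus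
  \<open>A / 2\<close>.  The threshold \<open>N0\<close> and the constant are fixed before the functional, as required.\<close>

lemma sampling:
  fixes k \<eta> :: "real^'n \<Rightarrow> complex" and L :: nat
  assumes \<eta>: "rapid \<eta>" "weighted_lipschitz \<eta>" and k: "k \<in> away" and rep: "k = convolve \<eta> k"
  obtains N0 :: nat and C :: real where "C \<ge> 0"
    "\<And>N u x0 B x. N \<ge> N0 \<Longrightarrow> functional u \<Longrightarrow> 0 \<le> B \<Longrightarrow>
      (\<And>l. (INF z\<in>dyadic_cube N 0 l. ennreal (norm (u (\<lambda>y. k (y - z))))) \<le>
        ennreal (B * (1 + norm (corner N 0 l - x0)) ^ L)) \<Longrightarrow>
      norm (u (\<lambda>y. k (y - x))) \<le> C * B * (1 + norm (x - x0)) ^ L"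
proof -
  define n where "n = CARD('n)"
  define W where "W = (LINT w|lborel. weight (w::real^'n))"
  have W0: "W \<ge> 0" unfolding W_def by (simp add: weight_nonneg)
  have "\<exists>H\<ge>1. \<forall>v h. norm h \<le> real n \<longrightarrow> (1 + norm v) ^ K * norm (\<eta> v - \<eta> (v + h)) \<le> norm h * H" for K
  proof -
    obtain C where C: "C \<ge> 1" "\<And>x y. (1 + norm x) ^ K * norm (\<eta> x - \<eta> y) \<le> C * norm (x - y) * (1 + norm (x - y)) ^ K"
      using wlip_bound[OF \<eta>(2), of K] by metis
    have "(1 + norm v) ^ K * norm (\<eta> v - \<eta> (v + h)) \<le> norm h * (C * (1 + real n) ^ K)" if "norm h \<le> real n" for v h
    proof -
      have "(1 + norm v) ^ K * norm (\<eta> v - \<eta> (v + h)) \<le> C * norm h * (1 + norm h) ^ K"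
        using C(2)[of v "v + h"] by simp
      also have "\<dots> \<le> C * norm h * (1 + real n) ^ K"
        using that C(1) by (intro mult_left_mono power_mono) auto
      finally show ?thesis by (simp add: mult_ac)
    qed
    moreover have "1 * 1 \<le> C * (1 + real n) ^ K" using C(1) by (intro mult_mono one_le_power) auto
    ultimately show ?thesis by (intro exI[of _ "C * (1 + real n) ^ K"]) auto
  qed
  then obtain H where Hge1: "\<And>K. H K \<ge> 1" and H: "\<And>K v h. norm h \<le> real n \<Longrightarrow>
      (1 + norm v) ^ K * norm (\<eta> v - \<eta> (v + h)) \<le> norm h * H K"
    by metis
  define H1 where "H1 = 2 ^ L * H (2 * n + L)"
  have H1pos: "H1 > 0" unfolding H1_def using Hge1[of "2 * n + L"] by simp
  \<comment> \<open>\<open>H1\<close> involves \<open>L\<close> but not the growth order \<open>M\<close> of a functional, so \<open>N0\<close> is uniform\<close>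
  obtain N0 :: nat where N0: "W * (2 * real n * H1) * 2 \<le> real N0" using real_arch_simple by blast
  define C where "C = 2 * (1 + real n) ^ L"
  have "norm (u (\<lambda>y. k (y - x))) \<le> C * B * (1 + norm (x - x0)) ^ L"
    if N: "N \<ge> N0" and u: "functional u" and B: "0 \<le> B"
      and inf: "\<And>l. (INF z\<in>dyadic_cube N 0 l. ennreal (norm (u (\<lambda>y. k (y - z))))) \<le>
        ennreal (B * (1 + norm (corner N 0 l - x0)) ^ L)" for N u x0 B x
  proof -
    define U where "U z = norm (u (\<lambda>y. k (y - z)))" for z
    have side: "2 powi (- 0 - int N) \<le> (1::real)"
      by (simp add: power_int_minus field_simps)
    have small: "W * (2 * (real n * 2 powi (- 0 - int N)) * H1) \<le> 1 / 2"
    proof -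
      have "real N0 \<le> real N" using N by simp
      also have "real N \<le> 2 ^ N" by (metis of_nat_less_two_power less_imp_le)
      finally have "real N0 \<le> 2 ^ N" .
      from order_trans[OF N0 this] have "W * (2 * real n * H1) * 2 \<le> 2 ^ N" .
      thus ?thesis by (simp add: power_int_minus field_simps)
    qed
    obtain M :: nat where M: "\<And>z. U z \<le> real M * (1 + norm z) ^ M"
      using functional_poly_growth[OF u k] unfolding U_def by metis
    define H2 where "H2 = 2 ^ (L + Suc M) * H (2 * n + L + Suc M)"
    have H2pos: "H2 \<ge> 0" unfolding H2_def using Hge1[of "2 * n + L + Suc M"] by simp
    obtain \<epsilon>0 where e0: "0 < \<epsilon>0" "\<epsilon>0 \<le> 1" and absorb:
      "\<And>\<epsilon> r a t. 0 < \<epsilon> \<Longrightarrow> \<epsilon> \<le> \<epsilon>0 \<Longrightarrow> 0 \<le> r \<Longrightarrow> 0 \<le> a \<Longrightarrow> 0 \<le> t \<Longrightarrow> a \<le> t * H1 \<Longrightarrow>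
      a * (1 + r) ^ Suc M \<le> t * H2 \<Longrightarrow> a * (1 + \<epsilon> * r) ^ M \<le> 2 * t * H1"
      using slow_weight_absorption[OF H1pos H2pos, of M] by metis
    have main: "U x \<le> C * B * (1 + norm (x - x0)) ^ L * (1 + \<epsilon> * norm (x - x0)) ^ M"
      if \<epsilon>: "0 < \<epsilon>" "\<epsilon> \<le> \<epsilon>0" for \<epsilon> x
    proof -
      define V where "V z = (1 + norm (z - x0)) ^ L * (1 + \<epsilon> * norm (z - x0)) ^ M" for z
      have Vge: "(1 + norm (z - x0)) ^ L \<le> V z" for z
      proof -
        have "1 \<le> (1 + \<epsilon> * norm (z - x0)) ^ M" using \<epsilon> by (intro one_le_power) simp
        hence "(1 + norm (z - x0)) ^ L * 1 \<le> V z" unfolding V_def by (intro mult_left_mono) auto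
        thus ?thesis by simp
      qed
      have Vpos: "0 < V z" for z
        by (rule less_le_trans[OF _ Vge]) (simp add: add_pos_nonneg)
      have Vmult: "V (x + v) \<le> V x * ((1 + r) ^ L * (1 + \<epsilon> * r) ^ M)" if "norm v \<le> r" for x v r
      proof -
        have t: "norm (x + v - x0) \<le> norm (x - x0) + r"
          using norm_triangle_ineq[of "x - x0" v] that by (simp add: algebra_simps)
        have r: "0 \<le> r" using that norm_ge_zero order_trans by blast
        have "1 + norm (x + v - x0) \<le> (1 + norm (x - x0)) * (1 + r)"
          using t mult_nonneg_nonneg[OF norm_ge_zero[of "x - x0"] r] by (simp add: algebra_simps)
        hence 1: "(1 + norm (x + v - x0)) ^ L \<le> (1 + norm (x - x0)) ^ L * (1 + r) ^ L"
          unfolding power_mult_distrib[symmetric] by (intro power_mono) auto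
        have "\<epsilon> * norm (x + v - x0) \<le> \<epsilon> * (norm (x - x0) + r)"
          using t \<epsilon> by (intro mult_left_mono) auto
        moreover have "0 \<le> (\<epsilon> * norm (x - x0)) * (\<epsilon> * r)" using \<epsilon> r by simp
        ultimately have "1 + \<epsilon> * norm (x + v - x0) \<le> (1 + \<epsilon> * norm (x - x0)) * (1 + \<epsilon> * r)"
          by (simp add: algebra_simps)
        hence 2: "(1 + \<epsilon> * norm (x + v - x0)) ^ M \<le> (1 + \<epsilon> * norm (x - x0)) ^ M * (1 + \<epsilon> * r) ^ M"
          unfolding power_mult_distrib[symmetric] using \<epsilon> by (intro power_mono) auto
        have "V (x + v) \<le> ((1 + norm (x - x0)) ^ L * (1 + r) ^ L) * ((1 + \<epsilon> * norm (x - x0)) ^ M * (1 + \<epsilon> * r) ^ M)"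
          unfolding V_def using \<epsilon> r by (intro mult_mono 1 2) auto
        thus ?thesis by (simp add: V_def mult_ac)
      qed
      define A where "A = (SUP z. U z / V z)"
      have bdd: "bdd_above (range (\<lambda>z. U z / V z))"
      proof (rule bdd_aboveI2)
        fix z
        have "1 + norm z \<le> (1 + norm (z - x0)) * (1 + norm x0)" by (rule one_plus_norm_diff)
        moreover have "\<epsilon> * (1 + norm (z - x0)) \<le> 1 + \<epsilon> * norm (z - x0)"
          using \<epsilon> e0 by (simp add: algebra_simps)
        hence "1 + norm (z - x0) \<le> (1 + \<epsilon> * norm (z - x0)) / \<epsilon>"
          using \<epsilon> by (simp add: pos_le_divide_eq mult.commute)
        ultimately have "1 + norm z \<le> ((1 + \<epsilon> * norm (z - x0)) / \<epsilon>) * (1 + norm x0)"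
          by (meson mult_right_mono norm_ge_zero add_nonneg_nonneg zero_le_one order_trans)
        hence "(1 + norm z) ^ M \<le> (((1 + norm x0) / \<epsilon>) * (1 + \<epsilon> * norm (z - x0))) ^ M"
          by (intro power_mono) (auto simp: mult_ac)
        also have "\<dots> \<le> ((1 + norm x0) / \<epsilon>) ^ M * V z"
        proof -
          have "1 \<le> (1 + norm (z - x0)) ^ L" by (intro one_le_power) simp
          hence "1 * (1 + \<epsilon> * norm (z - x0)) ^ M \<le> V z"
            unfolding V_def using \<epsilon> by (intro mult_right_mono) auto
          thus ?thesis unfolding power_mult_distrib using \<epsilon> by (intro mult_left_mono) auto
        qed
        finally have "real M * (1 + norm z) ^ M \<le> real M * (((1 + norm x0) / \<epsilon>) ^ M * V z)"
          by (intro mult_left_mono) auto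
        with M[of z] have "U z \<le> (real M * ((1 + norm x0) / \<epsilon>) ^ M) * V z" by (simp add: mult_ac)
        thus "U z / V z \<le> real M * ((1 + norm x0) / \<epsilon>) ^ M" by (simp add: pos_divide_le_eq Vpos)
      qed
      have UA: "U z \<le> A * V z" for z
        using cSUP_upper[OF _ bdd, of z] by (simp add: A_def pos_divide_le_eq Vpos)
      have A0: "0 \<le> A"
        using UA[of x0] Vpos[of x0] order_trans[of 0 "U x0" "A * V x0"] by (simp add: U_def zero_le_mult_iff)
      \<comment> \<open>the oscillation of \<open>U\<close> over a cube, small compared with the weighted supremum\<close>
      have osc: "\<bar>U x - U x'\<bar> \<le> A * V x / 2" if h: "norm (x - x') \<le> real n * 2 powi (- 0 - int N)" for x x'
      proof -
        define h where "h = x - x'"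
        have hn: "norm h \<le> real n"
          using h side mult_left_mono[OF side, of "real n"] by (simp add: h_def)
        define g where "g v = \<eta> v - \<eta> (v + h)" for v
        have rg: "rapid g"
          unfolding g_def using rapid_diff[OF \<eta>(1) rapid_affine[OF \<eta>(1), of 1 h]] by simp
        define T where "T y = k (y - x) - k (y - x')" for y
        have Taway: "T \<in> away" unfolding T_def by (intro away_diff away_translate k)
        have kx: "(\<lambda>y. k (y - x)) \<in> away" by (intro away_translate k)
        have rk: "rapid k" by (rule away_rapid[OF k])
        have Teq: "T y = (\<Sum>m\<in>{()}. convolve g (\<lambda>y. k (y - x)) y)" for y
        proof -
          have [measurable]: "\<eta> \<in> borel_measurable borel" "k \<in> borel_measurable borel"
            using \<eta>(1) rk by (simp_all add: rapid_measurable)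
          have "integrable lborel (\<lambda>v. \<eta> v * k (y - x - v))" by (rule rapid_conv_integrable[OF \<eta>(1) rk])
          moreover have "integrable lborel (\<lambda>v. \<eta> (v + h) * k (y - x - v))"
            using rapid_conv_integrable[OF rapid_affine[OF \<eta>(1), of 1 h] rk, of "y - x"] by simp
          ultimately have "convolve g (\<lambda>y. k (y - x)) y =
              (LINT v|lborel. \<eta> v * k (y - x - v)) - (LINT v|lborel. \<eta> (v + h) * k (y - x - v))"
            unfolding convolve_def g_def left_diff_distrib
            by (subst Bochner_Integration.integral_diff[symmetric]) (simp_all add: algebra_simps)
          also have "(LINT v|lborel. \<eta> v * k (y - x - v)) = k (y - x)"
            using fun_cong[OF rep, of "y - x"] by (simp add: convolve_def)
          also have "(LINT v|lborel. \<eta> (v + h) * k (y - x - v)) = (LINT v|lborel. \<eta> v * k (y - x' - v))"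
            using integral_affine(2)[of 1 "\<lambda>v. \<eta> v * k (y - x' - v)" h] by (simp add: h_def algebra_simps)
          also have "\<dots> = k (y - x')"
            using fun_cong[OF rep, of "y - x'"] by (simp add: convolve_def)
          finally show ?thesis by (simp add: T_def)
        qed
        have "norm (u T) \<le> real (card {()}) * (A * V x * (2 * norm h * H1)) * (LINT w|lborel. weight (w::real^'n))"
        proof (rule functional_superposition[OF u _ _ _ Taway Teq])
          fix v w :: "real^'n" assume vw: "norm v \<le> 2 * norm w"
          have "norm (u (\<lambda>y. k (y - v - x))) \<le> A * V (x + v)"
            using UA[of "x + v"] by (simp add: U_def algebra_simps)
          also have "\<dots> \<le> A * (V x * ((1 + 2 * norm w) ^ L * (1 + \<epsilon> * (2 * norm w)) ^ M))"
            by (intro mult_left_mono Vmult vw A0)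
          finally have "norm (g w) * norm (u (\<lambda>y. k (y - v - x))) \<le>
              norm (g w) * (A * (V x * ((1 + 2 * norm w) ^ L * (1 + \<epsilon> * (2 * norm w)) ^ M)))"
            by (rule mult_left_mono) simp
          also have "\<dots> = A * V x * weight w *
              ((1 + norm w) ^ (2 * n) * norm (g w) * (1 + 2 * norm w) ^ L * (1 + \<epsilon> * (2 * norm w)) ^ M)"
          proof -
            have "weight w * (1 + norm w) ^ (2 * n) = 1"
              unfolding weight_def n_def by (rule left_inverse) (simp add: add_nonneg_eq_0_iff)
            thus ?thesis by (simp add: mult_ac)
          qed
          also have "\<dots> \<le> A * V x * weight w * (2 * norm h * H1)"
          proof (rule mult_left_mono)
            define a where "a = (1 + norm w) ^ (2 * n) * norm (g w) * (1 + 2 * norm w) ^ L"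
            have two: "(1 + 2 * norm w) ^ q \<le> 2 ^ q * (1 + norm w) ^ q" for q
              unfolding power_mult_distrib[symmetric] by (intro power_mono) auto
            have a1: "a \<le> norm h * H1"
            proof -
              have "a \<le> (1 + norm w) ^ (2 * n) * norm (g w) * (2 ^ L * (1 + norm w) ^ L)"
                unfolding a_def by (intro mult_left_mono two) auto
              also have "\<dots> = 2 ^ L * ((1 + norm w) ^ (2 * n + L) * norm (g w))"
                by (simp add: power_add mult_ac)
              also have "\<dots> \<le> 2 ^ L * (norm h * H (2 * n + L))"
                unfolding g_def by (intro mult_left_mono H hn) simp
              finally show ?thesis by (simp add: H1_def mult_ac)
            qed
            have a2: "a * (1 + 2 * norm w) ^ Suc M \<le> norm h * H2"
            proof -
              have "a * (1 + 2 * norm w) ^ Suc M = (1 + norm w) ^ (2 * n) * norm (g w) * (1 + 2 * norm w) ^ (L + Suc M)"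
                by (simp add: a_def power_add mult_ac)
              also have "\<dots> \<le> (1 + norm w) ^ (2 * n) * norm (g w) * (2 ^ (L + Suc M) * (1 + norm w) ^ (L + Suc M))"
                by (intro mult_left_mono two) auto
              also have "\<dots> = 2 ^ (L + Suc M) * ((1 + norm w) ^ (2 * n + L + Suc M) * norm (g w))"
                by (simp only: power_add mult_ac)
              also have "\<dots> \<le> 2 ^ (L + Suc M) * (norm h * H (2 * n + L + Suc M))"
                unfolding g_def by (intro mult_left_mono H hn) simp
              finally show ?thesis by (simp add: H2_def mult_ac)
            qed
            have "a * (1 + \<epsilon> * (2 * norm w)) ^ M \<le> 2 * norm h * H1"
              by (rule absorb[OF \<epsilon> _ _ _ a1 a2]) (auto simp: a_def)
            thus "(1 + norm w) ^ (2 * n) * norm (g w) * (1 + 2 * norm w) ^ L * (1 + \<epsilon> * (2 * norm w)) ^ M \<le> 2 * norm h * H1"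
              by (simp add: a_def)
            show "0 \<le> A * V x * weight w" using A0 Vpos[of x] weight_nonneg[of w] by simp
          qed
          finally show "norm (g w) * norm (u (\<lambda>y. k (y - v - x))) \<le> A * V x * (2 * norm h * H1) * weight w"
            by (simp add: mult_ac)
        qed (use rg kx in auto)
        also have "\<dots> = A * V x * (W * (2 * norm h * H1))" by (simp add: W_def mult_ac)
        also have "\<dots> \<le> A * V x * (W * (2 * (real n * 2 powi (- 0 - int N)) * H1))"
          using A0 Vpos[of x] W0 H1pos h by (intro mult_left_mono mult_right_mono) (auto simp: h_def)
        also have "\<dots> \<le> A * V x * (1 / 2)"
          using A0 Vpos[of x] small by (intro mult_left_mono) auto
        finally have uT: "norm (u T) \<le> A * V x / 2" by simp
        have "u T = u (\<lambda>y. k (y - x)) - u (\<lambda>y. k (y - x'))"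
          unfolding T_def using functional_add[OF u kx away_cmult[OF away_translate[OF k, of x'], of "-1"]]
            functional_cmult[OF u away_translate[OF k, of x'], of "-1"] by simp
        hence "\<bar>U x - U x'\<bar> \<le> norm (u T)"
          unfolding U_def by (simp add: norm_triangle_ineq3)
        with uT show ?thesis by linarith
      qed
      have "U x \<le> ((1 + real n) ^ L * B + A / 2) * V x" for x
      proof -
        obtain l where l: "x \<in> dyadic_cube N 0 l" using dyadic_cube_cover by blast
        have cn: "norm (corner N 0 l - x) \<le> real n"
        proof -
          have "real n * 2 powi (- 0 - int N) \<le> real n * 1" by (intro mult_left_mono side) simp
          from order_trans[OF dist_corner[OF l, folded n_def] this]
          show ?thesis by (simp only: norm_minus_commute[of _ x] mult_1_right)
        qed
        have "U x - A * V x / 2 \<le> B * (1 + norm (corner N 0 l - x0)) ^ L"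
        proof -
          have low: "U x - A * V x / 2 \<le> U z" if z: "z \<in> dyadic_cube N 0 l" for z
          proof -
            define s :: real where "s = 2 powi (- 0 - int N)"
            have "norm (x - z) \<le> (\<Sum>i\<in>UNIV. \<bar>(x - z) $ i\<bar>)" by (rule norm_le_l1_cart)
            also have "\<dots> \<le> (\<Sum>i\<in>(UNIV::'n set). s)"
            proof (rule sum_mono)
              fix i
              have "s * of_int (l $ i) \<le> x $ i" "x $ i < s * (of_int (l $ i) + 1)"
                "s * of_int (l $ i) \<le> z $ i" "z $ i < s * (of_int (l $ i) + 1)"
                using l z unfolding dyadic_cube_def s_def by blast+
              thus "\<bar>(x - z) $ i\<bar> \<le> s" by (simp add: algebra_simps abs_le_iff)
            qed
            finally have "norm (x - z) \<le> real n * 2 powi (- 0 - int N)" by (simp add: n_def s_def)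
            from osc[OF this] show ?thesis by linarith
          qed
          have "ennreal (U x - A * V x / 2) \<le> (INF z\<in>dyadic_cube N 0 l. ennreal (U z))"
            by (intro INF_greatest ennreal_leI low)
          also have "\<dots> \<le> ennreal (B * (1 + norm (corner N 0 l - x0)) ^ L)"
            using inf[of l] unfolding U_def .
          finally show ?thesis
            using B by (subst (asm) ennreal_le_iff) auto
        qed
        also have "\<dots> \<le> B * ((1 + real n) ^ L * (1 + norm (x - x0)) ^ L)"
        proof (intro mult_left_mono B)
          have "1 + norm (corner N 0 l - x0) \<le> (1 + norm (corner N 0 l - x)) * (1 + norm (x - x0))"
            using one_plus_norm_add[of "corner N 0 l - x" "x - x0"] by simp
          also have "\<dots> \<le> (1 + real n) * (1 + norm (x - x0))" using cn by (intro mult_right_mono) auto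
          finally show "(1 + norm (corner N 0 l - x0)) ^ L \<le> (1 + real n) ^ L * (1 + norm (x - x0)) ^ L"
            unfolding power_mult_distrib[symmetric] by (intro power_mono) auto
        qed
        also have "\<dots> \<le> B * ((1 + real n) ^ L * V x)"
          using B Vge[of x] by (intro mult_left_mono) auto
        finally show ?thesis by (simp add: algebra_simps)
      qed
      hence "U z / V z \<le> (1 + real n) ^ L * B + A / 2" for z by (simp add: pos_divide_le_eq Vpos)
      \<comment> \<open>absorption; it is legitimate because \<open>A\<close> is a real number\<close>
      hence "A \<le> (1 + real n) ^ L * B + A / 2" unfolding A_def by (intro cSUP_least) auto
      hence "A \<le> C * B" by (simp add: C_def)
      hence "A * V x \<le> C * B * V x" using Vpos[of x] by (intro mult_right_mono) auto
      with UA[of x] show ?thesis by (simp add: V_def mult_ac)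
    qed
    have "((\<lambda>\<epsilon>. C * B * (1 + norm (x - x0)) ^ L * (1 + \<epsilon> * norm (x - x0)) ^ M) \<longlongrightarrow>
        C * B * (1 + norm (x - x0)) ^ L * (1 + 0 * norm (x - x0)) ^ M) (at_right 0)"
      by (intro tendsto_intros)
    moreover have "eventually (\<lambda>\<epsilon>. U x \<le> C * B * (1 + norm (x - x0)) ^ L * (1 + \<epsilon> * norm (x - x0)) ^ M) (at_right 0)"
      using e0(1) main[of _ x] unfolding eventually_at_right_field by (intro exI[of _ \<epsilon>0]) auto
    ultimately have "U x \<le> C * B * (1 + norm (x - x0)) ^ L * (1 + 0 * norm (x - x0)) ^ M"
      by (rule tendsto_lowerbound) simp
    thus ?thesis by (simp add: U_def)
  qed
  moreover have "C \<ge> 0" by (simp add: C_def)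
  ultimately show ?thesis using that by blast
qed

section \<open>Reproducing identities\<close>

text \<open>Taking complex conjugates in the defining sum exchanges the two members of an admissible pair, so
  either position of \<open>\<phi>\<close> leads to the same conclusion.\<close>

lemma admissible_dual:
  fixes \<phi> :: "real^'n \<Rightarrow> complex"
  assumes "admissible \<phi>"
  obtains \<psi> where "\<phi> \<in> schwartz" "\<psi> \<in> schwartz"
    "\<And>\<xi>. fourier \<phi> \<xi> \<noteq> 0 \<Longrightarrow> 1/2 \<le> norm \<xi> \<and> norm \<xi> \<le> 2"
    "\<And>\<xi>. \<xi> \<noteq> 0 \<Longrightarrow> ((\<lambda>j::int. cnj (fourier \<phi> ((2 powi j) *\<^sub>R \<xi>)) * fourier \<psi> ((2 powi j) *\<^sub>R \<xi>)) has_sum 1) UNIV"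
proof -
  obtain \<psi> where "admissible_pair \<phi> \<psi> \<or> admissible_pair \<psi> \<phi>" using assms unfolding admissible_def by blast
  thus ?thesis
  proof
    assume p: "admissible_pair \<phi> \<psi>"
    note d = p[unfolded admissible_pair_def]
    have sub: "{\<xi>. fourier \<phi> \<xi> \<noteq> 0} \<subseteq> {\<xi>. 1/2 \<le> norm \<xi> \<and> norm \<xi> \<le> 2}"
      by (rule order_trans[OF closure_subset]) (use d in blast)
    show ?thesis
    proof (rule that)
      show "\<phi> \<in> schwartz" "\<psi> \<in> schwartz" using d by blast+
      show "1/2 \<le> norm \<xi> \<and> norm \<xi> \<le> 2" if "fourier \<phi> \<xi> \<noteq> 0" for \<xi>
        using subsetD[OF sub, of \<xi>] that by simp
      show "((\<lambda>j::int. cnj (fourier \<phi> ((2 powi j) *\<^sub>R \<xi>)) * fourier \<psi> ((2 powi j) *\<^sub>R \<xi>)) has_sum 1) UNIV"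
        if "\<xi> \<noteq> 0" for \<xi> using d that by blast
    qed
  next
    assume p: "admissible_pair \<psi> \<phi>"
    note d = p[unfolded admissible_pair_def]
    have sub: "{\<xi>. fourier \<phi> \<xi> \<noteq> 0} \<subseteq> {\<xi>. 1/2 \<le> norm \<xi> \<and> norm \<xi> \<le> 2}"
      by (rule order_trans[OF closure_subset]) (use d in blast)
    show ?thesis
    proof (rule that)
      show "\<phi> \<in> schwartz" "\<psi> \<in> schwartz" using d by blast+
      show "1/2 \<le> norm \<xi> \<and> norm \<xi> \<le> 2" if "fourier \<phi> \<xi> \<noteq> 0" for \<xi>
        using subsetD[OF sub, of \<xi>] that by simp
      show "((\<lambda>j::int. cnj (fourier \<phi> ((2 powi j) *\<^sub>R \<xi>)) * fourier \<psi> ((2 powi j) *\<^sub>R \<xi>)) has_sum 1) UNIV"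
        if "\<xi> \<noteq> 0" for \<xi>
      proof -
        have "((\<lambda>j::int. cnj (fourier \<psi> ((2 powi j) *\<^sub>R \<xi>)) * fourier \<phi> ((2 powi j) *\<^sub>R \<xi>)) has_sum 1) UNIV"
          using d that by blast
        hence "((\<lambda>j::int. cnj (cnj (fourier \<psi> ((2 powi j) *\<^sub>R \<xi>)) * fourier \<phi> ((2 powi j) *\<^sub>R \<xi>))) has_sum cnj 1) UNIV"
          by (subst has_sum_cnj_iff)
        thus ?thesis by (simp only: complex_cnj_mult complex_cnj_cnj complex_cnj_one mult.commute)
      qed
    qed
  qed
qed

lemma cnj_away:
  fixes \<phi> :: "real^'n \<Rightarrow> complex"
  assumes "\<phi> \<in> schwartz" and "\<And>\<xi>. fourier \<phi> \<xi> \<noteq> 0 \<Longrightarrow> 1/2 \<le> norm \<xi> \<and> norm \<xi> \<le> 2"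
  shows "(\<lambda>x. cnj (\<phi> x)) \<in> away"
    and "fourier (\<lambda>x. cnj (\<phi> x)) \<xi> \<noteq> 0 \<Longrightarrow> 1/2 \<le> norm \<xi> \<and> norm \<xi> \<le> 2"
proof -
  show *: "1/2 \<le> norm \<xi> \<and> norm \<xi> \<le> 2" if "fourier (\<lambda>x. cnj (\<phi> x)) \<xi> \<noteq> 0" for \<xi>
    using assms(2)[of "- \<xi>"] that by (simp add: fourier_cnj)
  have "fourier (\<lambda>x. cnj (\<phi> x)) \<xi> = 0" if "norm \<xi> < 1/2" for \<xi>
    using *[of \<xi>] that by force
  thus "(\<lambda>x. cnj (\<phi> x)) \<in> away"
    using schwartz_cnj[OF assms(1)] by (auto simp: away_def intro!: exI[of _ "1/2"])
qed

lemma two_powi_range: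
  assumes "1/4 \<le> (2::real) powi m" "(2::real) powi m \<le> 4" shows "m \<in> {-2..2::int}"
proof -
  have "(2::real) powi (-2) \<le> 2 powi m" "(2::real) powi m \<le> 2 powi 2"
    using assms by (simp_all add: power_int_minus)
  moreover have "m < -2 \<Longrightarrow> (2::real) powi m < 2 powi (-2)" "2 < m \<Longrightarrow> (2::real) powi 2 < 2 powi m"
    by (intro power_int_strict_increasing; simp)+
  ultimately have "- 2 \<le> m" "m \<le> 2" by (meson linorder_not_less)+
  thus ?thesis by simp
qed

text \<open>On the annulus that carries the transform of \<open>\<Phi>\<close> only the indices between \<open>- 2\<close> and \<open>2\<close> contribute
  to the defining sum.  Conjugation in space reflects the transform, whence the reflected \<open>\<psi>\<close>.\<close>

lemma reproducing_kernel:
  fixes \<phi> :: "real^'n \<Rightarrow> complex"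
  assumes "admissible \<phi>"
  defines "\<Phi> \<equiv> \<lambda>x. cnj (\<phi> x)"
  obtains \<Psi> where "\<Phi> \<in> away" "\<Psi> \<in> schwartz"
    "\<And>\<xi>. fourier \<Phi> \<xi> \<noteq> 0 \<Longrightarrow> 1/2 \<le> norm \<xi> \<and> norm \<xi> \<le> 2"
    "\<And>\<xi>. 1/2 \<le> norm \<xi> \<Longrightarrow> norm \<xi> \<le> 2 \<Longrightarrow>
      (\<Sum>m\<in>{-2..2::int}. fourier (dilate m \<Psi>) \<xi> * fourier (dilate m \<Phi>) \<xi>) = 1"
proof -
  obtain \<psi> where s: "\<phi> \<in> schwartz" "\<psi> \<in> schwartz"
    and supp: "\<And>\<xi>. fourier \<phi> \<xi> \<noteq> 0 \<Longrightarrow> 1/2 \<le> norm \<xi> \<and> norm \<xi> \<le> 2"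
    and hs: "\<And>\<xi>. \<xi> \<noteq> 0 \<Longrightarrow> ((\<lambda>j::int. cnj (fourier \<phi> ((2 powi j) *\<^sub>R \<xi>)) * fourier \<psi> ((2 powi j) *\<^sub>R \<xi>)) has_sum 1) UNIV"
    proof (rule admissible_dual[OF assms(1)], goal_cases)
      case 1 show ?case by (rule 1(1)[OF 1(2-)])
    qed
  define \<Psi> where "\<Psi> = (\<lambda>x. \<psi> (- x))"
  have \<Psi>: "\<Psi> \<in> schwartz" unfolding \<Psi>_def using schwartz_affine[OF s(2), of "-1" 1 0] by simp
  have r\<psi>: "rapid \<psi>" "rapid \<Psi>" using schwartz_rapid[of _ "[]"] s \<Psi> by simp_all
  have \<Phi>: "\<Phi> \<in> away" unfolding \<Phi>_def by (rule cnj_away(1)[OF s(1) supp])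
  have "(\<Sum>m\<in>{-2..2::int}. fourier (dilate m \<Psi>) \<xi> * fourier (dilate m \<Phi>) \<xi>) = 1"
    if \<xi>: "1/2 \<le> norm \<xi>" "norm \<xi> \<le> 2" for \<xi>
  proof -
    define t where "t m = cnj (fourier \<phi> ((2 powi m) *\<^sub>R (- \<xi>))) * fourier \<psi> ((2 powi m) *\<^sub>R (- \<xi>))" for m :: int
    have t0: "t m = 0" if "m \<notin> {-2..2}" for m
    proof (rule ccontr)
      assume "t m \<noteq> 0"
      hence "1/2 \<le> norm ((2 powi m) *\<^sub>R (- \<xi>))" "norm ((2 powi m) *\<^sub>R (- \<xi>)) \<le> 2"
        using supp[of "(2 powi m) *\<^sub>R (- \<xi>)"] unfolding t_def mult_eq_0_iff complex_cnj_zero_iff de_Morgan_disj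
        by blast+
      hence a: "1/2 \<le> 2 powi m * norm \<xi>" "2 powi m * norm \<xi> \<le> 2" by simp_all
      have "2 powi m * norm \<xi> \<le> 2 powi m * 2" "2 powi m * (1/2) \<le> 2 powi m * norm \<xi>"
        using \<xi> by (intro mult_left_mono; simp)+
      hence "1/4 \<le> (2::real) powi m" "(2::real) powi m \<le> 4" using a by linarith+
      from two_powi_range[OF this] that show False by simp
    qed
    have "- \<xi> \<noteq> 0" using \<xi> by auto
    from hs[OF this] have "(t has_sum 1) UNIV" unfolding t_def .
    moreover have "(t has_sum 1) UNIV \<longleftrightarrow> (t has_sum 1) {-2..2}"
      by (rule has_sum_cong_neutral) (use t0 in auto)
    ultimately have "(t has_sum 1) {-2..2}" by simp
    from has_sum_unique[OF has_sum_finite this] have "sum t {-2..2} = 1" by simp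
    moreover have "sum t {-2..2} = (\<Sum>m\<in>{-2..2}. t (- m))"
      by (rule sum.reindex_bij_witness[of _ uminus uminus]) auto
    moreover have "t (- m) = fourier (dilate m \<Psi>) \<xi> * fourier (dilate m \<Phi>) \<xi>" for m
    proof -
      have "fourier (dilate m \<Psi>) \<xi> = fourier \<psi> ((2 powi (- m)) *\<^sub>R (- \<xi>))"
        using fourier_dilate[OF r\<psi>(2), of m \<xi>] fourier_reflect[OF r\<psi>(1), of "(2 powi (- m)) *\<^sub>R \<xi>"]
        by (simp add: \<Psi>_def)
      moreover have "fourier (dilate m \<Phi>) \<xi> = cnj (fourier \<phi> ((2 powi (- m)) *\<^sub>R (- \<xi>)))"
        using fourier_dilate[OF away_rapid[OF \<Phi>], of m \<xi>] fourier_cnj[of \<phi> "(2 powi (- m)) *\<^sub>R \<xi>"]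
        by (simp add: \<Phi>_def)
      ultimately show ?thesis by (simp add: t_def mult.commute)
    qed
    ultimately show ?thesis by simp
  qed
  moreover have "fourier \<Phi> \<xi> \<noteq> 0 \<Longrightarrow> 1/2 \<le> norm \<xi> \<and> norm \<xi> \<le> 2" for \<xi>
    unfolding \<Phi>_def by (rule cnj_away(2)[OF s(1) supp])
  ultimately show ?thesis by (intro that[OF \<Phi> \<Psi>])
qed

text \<open>Both sides have the same Fourier transform: off the annulus the transform of \<open>h\<close> vanishes, and on
  it the sum is one.  The second form stays within one scale, which is what sampling needs.\<close>

lemma reproducing_identity:
  fixes h \<Psi> \<Phi> :: "real^'n \<Rightarrow> complex"
  assumes h: "rapid h" and \<Psi>: "rapid \<Psi>" and \<Phi>: "rapid \<Phi>"
    and supp: "\<And>\<xi>. fourier h \<xi> \<noteq> 0 \<Longrightarrow> 1/2 \<le> norm \<xi> \<and> norm \<xi> \<le> 2"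
    and one: "\<And>\<xi>. 1/2 \<le> norm \<xi> \<Longrightarrow> norm \<xi> \<le> 2 \<Longrightarrow>
      (\<Sum>m\<in>F. fourier (dilate m \<Psi>) \<xi> * fourier (dilate m \<Phi>) \<xi>) = 1"
  shows "h = (\<lambda>x. \<Sum>m\<in>F. convolve (convolve h (dilate m \<Psi>)) (dilate m \<Phi>) x)"
    and "h = convolve (\<lambda>x. \<Sum>m\<in>F. convolve (dilate m \<Psi>) (dilate m \<Phi>) x) h"
proof -
  have *: "fourier h \<xi> * (\<Sum>m\<in>F. fourier (dilate m \<Psi>) \<xi> * fourier (dilate m \<Phi>) \<xi>) = fourier h \<xi>" for \<xi>
    using supp[of \<xi>] one[of \<xi>] by (cases "fourier h \<xi> = 0") auto
  show "h = (\<lambda>x. \<Sum>m\<in>F. convolve (convolve h (dilate m \<Psi>)) (dilate m \<Phi>) x)"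
  proof (rule fourier_inj)
    fix \<xi>
    have "fourier (\<lambda>x. \<Sum>m\<in>F. convolve (convolve h (dilate m \<Psi>)) (dilate m \<Phi>) x) \<xi> =
        (\<Sum>m\<in>F. fourier (convolve (convolve h (dilate m \<Psi>)) (dilate m \<Phi>)) \<xi>)"
      by (rule fourier_sum) (intro rapid_sum rapid_conv rapid_dilate h \<Psi> \<Phi>)
    also have "\<dots> = (\<Sum>m\<in>F. fourier h \<xi> * (fourier (dilate m \<Psi>) \<xi> * fourier (dilate m \<Phi>) \<xi>))"
    proof (rule sum.cong[OF refl])
      fix m
      have "fourier (convolve (convolve h (dilate m \<Psi>)) (dilate m \<Phi>)) \<xi> = fourier (convolve h (dilate m \<Psi>)) \<xi> * fourier (dilate m \<Phi>) \<xi>"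
        by (rule fourier_conv; intro rapid_sum rapid_conv rapid_dilate h \<Psi> \<Phi>)
      moreover have "fourier (convolve h (dilate m \<Psi>)) \<xi> = fourier h \<xi> * fourier (dilate m \<Psi>) \<xi>"
        by (rule fourier_conv; intro rapid_sum rapid_conv rapid_dilate h \<Psi> \<Phi>)
      ultimately show "fourier (convolve (convolve h (dilate m \<Psi>)) (dilate m \<Phi>)) \<xi> =
        fourier h \<xi> * (fourier (dilate m \<Psi>) \<xi> * fourier (dilate m \<Phi>) \<xi>)" by (simp add: mult.assoc)
    qed
    finally show "fourier h \<xi> = fourier (\<lambda>x. \<Sum>m\<in>F. convolve (convolve h (dilate m \<Psi>)) (dilate m \<Phi>) x) \<xi>"
      using *[of \<xi>] by (simp add: sum_distrib_left)
  qed (rule h, intro rapid_sum rapid_conv rapid_dilate h \<Psi> \<Phi>)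
  show "h = convolve (\<lambda>x. \<Sum>m\<in>F. convolve (dilate m \<Psi>) (dilate m \<Phi>) x) h"
  proof (rule fourier_inj)
    fix \<xi>
    have "fourier (convolve (\<lambda>x. \<Sum>m\<in>F. convolve (dilate m \<Psi>) (dilate m \<Phi>) x) h) \<xi> =
        fourier (\<lambda>x. \<Sum>m\<in>F. convolve (dilate m \<Psi>) (dilate m \<Phi>) x) \<xi> * fourier h \<xi>"
      by (rule fourier_conv; intro rapid_sum rapid_conv rapid_dilate h \<Psi> \<Phi>)
    also have "fourier (\<lambda>x. \<Sum>m\<in>F. convolve (dilate m \<Psi>) (dilate m \<Phi>) x) \<xi> =
        (\<Sum>m\<in>F. fourier (convolve (dilate m \<Psi>) (dilate m \<Phi>)) \<xi>)"
      by (rule fourier_sum) (intro rapid_sum rapid_conv rapid_dilate h \<Psi> \<Phi>)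
    also have "\<dots> = (\<Sum>m\<in>F. fourier (dilate m \<Psi>) \<xi> * fourier (dilate m \<Phi>) \<xi>)"
      by (rule sum.cong[OF refl], rule fourier_conv; intro rapid_sum rapid_conv rapid_dilate h \<Psi> \<Phi>)
    finally show "fourier h \<xi> = fourier (convolve (\<lambda>x. \<Sum>m\<in>F. convolve (dilate m \<Psi>) (dilate m \<Phi>) x) h) \<xi>"
      using *[of \<xi>] by (simp add: mult.commute)
  qed (rule h, intro rapid_sum rapid_conv rapid_dilate h \<Psi> \<Phi>)
qed

section \<open>Pointwise domination\<close>

lemma transfer_bound:
  fixes \<Phi> \<Phi>' :: "real^'n \<Rightarrow> complex" and g :: "int \<Rightarrow> real^'n \<Rightarrow> complex"
  assumes F: "finite F" and g: "\<And>m. m \<in> F \<Longrightarrow> rapid (g m)" and \<Phi>: "\<Phi> \<in> away" and \<Phi>': "\<Phi>' \<in> away"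
    and rep: "\<Phi> = (\<lambda>y. \<Sum>m\<in>F. convolve (g m) (dilate m \<Phi>') y)"
  obtains C where "C \<ge> 0" "\<And>u A x. functional u \<Longrightarrow> 0 \<le> A \<Longrightarrow>
     (\<And>m v. m \<in> F \<Longrightarrow> norm (u (\<lambda>y. dilate m \<Phi>' (y - v))) \<le> A * (1 + norm (v - x)) ^ L) \<Longrightarrow>
     norm (u (\<lambda>y. \<Phi> (y - x))) \<le> C * A"
proof -
  have "\<exists>G\<ge>1. \<forall>w. (1 + norm w) ^ L * norm (g m w) \<le> G * weight w" if "m \<in> F" for m
    using rapid_bound_weight[OF g[OF that], of L] by metis
  then obtain G where G: "\<And>m. m \<in> F \<Longrightarrow> G m \<ge> 1"
    "\<And>m w. m \<in> F \<Longrightarrow> (1 + norm w) ^ L * norm (g m w) \<le> G m * weight w" by metis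
  define H where "H = (\<Sum>m\<in>F. G m)"
  have GH: "G m \<le> H" if "m \<in> F" for m
    unfolding H_def using G(1) F that by (intro member_le_sum) (auto intro: order_trans[of 0 1])
  define C where "C = real (card F) * (2 ^ L * H) * (LINT w|lborel. weight (w::real^'n))"
  have H0: "H \<ge> 0" unfolding H_def by (intro sum_nonneg) (use G(1) in \<open>force intro: order_trans[of 0 1]\<close>)
  have "C \<ge> 0" unfolding C_def using H0 by (intro mult_nonneg_nonneg Bochner_Integration.integral_nonneg) (auto simp: weight_nonneg)
  moreover have "norm (u (\<lambda>y. \<Phi> (y - x))) \<le> C * A"
    if u: "functional u" and A: "0 \<le> A" and
      b: "\<And>m v. m \<in> F \<Longrightarrow> norm (u (\<lambda>y. dilate m \<Phi>' (y - v))) \<le> A * (1 + norm (v - x)) ^ L" for u A x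
  proof -
    have "norm (u (\<lambda>y. \<Phi> (y - x))) \<le> real (card F) * (A * (2 ^ L * H)) * (LINT w|lborel. weight (w::real^'n))"
    proof (rule functional_superposition[OF u F, where g=g and k="\<lambda>m y. dilate m \<Phi>' (y - x)"])
      show "(\<lambda>y. \<Phi> (y - x)) \<in> away" by (intro away_translate \<Phi>)
      show "(\<lambda>y. dilate m \<Phi>' (y - x)) \<in> away" for m by (intro away_translate away_dilate \<Phi>')
      show "\<Phi> (y - x) = (\<Sum>m\<in>F. convolve (g m) (\<lambda>y. dilate m \<Phi>' (y - x)) y)" for y
        using fun_cong[OF rep, of "y - x"] by (simp add: convolve_def algebra_simps)
      fix m and v w :: "real^'n" assume m: "m \<in> F" and vw: "norm v \<le> 2 * norm w"
      have "norm (u (\<lambda>y. dilate m \<Phi>' (y - v - x))) \<le> A * (1 + norm v) ^ L"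
        using b[OF m, of "v + x"] by (simp add: algebra_simps)
      also have "\<dots> \<le> A * (2 * (1 + norm w)) ^ L"
        using vw A by (intro mult_left_mono power_mono) auto
      finally have "norm (g m w) * norm (u (\<lambda>y. dilate m \<Phi>' (y - v - x))) \<le> norm (g m w) * (A * (2 * (1 + norm w)) ^ L)"
        by (rule mult_left_mono) simp
      also have "\<dots> = A * 2 ^ L * ((1 + norm w) ^ L * norm (g m w))"
        by (simp only: power_mult_distrib mult_ac)
      also have "\<dots> \<le> A * 2 ^ L * (G m * weight w)"
        using A by (intro mult_left_mono G m) auto
      also have "\<dots> \<le> A * 2 ^ L * (H * weight w)"
        using A weight_nonneg[of w] by (intro mult_left_mono mult_right_mono GH m) auto
      finally show "norm (g m w) * norm (u (\<lambda>y. dilate m \<Phi>' (y - v - x))) \<le> A * (2 ^ L * H) * weight w"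
        by (simp add: mult_ac)
    qed (use g in auto)
    also have "\<dots> = C * A" by (simp add: C_def mult_ac)
    finally show ?thesis .
  qed
  ultimately show ?thesis using that by blast
qed

lemma dilate_translate:
  "dilate j (\<lambda>y. dilate m k (y - v)) = (\<lambda>y. dilate (j + m) k (y - (2 powi (- j)) *\<^sub>R v))"
  for k :: "real^'n \<Rightarrow> complex"
proof
  fix y
  have "2 powi m *\<^sub>R (2 powi j *\<^sub>R y - v) = 2 powi (j + m) *\<^sub>R (y - (2 powi (- j)) *\<^sub>R v)"
    by (simp add: scaleR_right_diff_distrib power_int_add power_int_minus mult.commute)
  moreover have "(2::real) powi (j * int CARD('n)) * 2 powi (m * int CARD('n)) = 2 powi ((j + m) * int CARD('n))"
    by (simp add: distrib_right power_int_add)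
  hence "complex_of_real (2 powi (j * int CARD('n))) * complex_of_real (2 powi (m * int CARD('n))) =
      complex_of_real (2 powi ((j + m) * int CARD('n)))" by (simp only: of_real_mult[symmetric])
  ultimately show "dilate j (\<lambda>y. dilate m k (y - v)) y = dilate (j + m) k (y - (2 powi (- j)) *\<^sub>R v)"
    unfolding dilate_def mult.assoc[symmetric] by simp
qed

lemma dilate_zero: "dilate 0 k = k"
  by (simp add: dilate_def fun_eq_iff)

lemma dyadic_cube_scale: "dyadic_cube N j l = (\<lambda>z. (2 powi (- j)) *\<^sub>R z) ` dyadic_cube N 0 l"
proof -
  have *: "x \<in> dyadic_cube N j l \<longleftrightarrow> (2 powi j) *\<^sub>R x \<in> dyadic_cube N 0 l" for x :: "real^'a"
  proof -
    have p: "(0::real) < 2 powi j" by simp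
    have e: "(2::real) powi (- 0 - int N) = 2 powi j * 2 powi (- j - int N)"
      by (simp flip: power_int_add)
    show ?thesis unfolding dyadic_cube_def mem_Collect_eq e vector_scaleR_component mult.assoc
      by (simp add: mult_le_cancel_left_pos[OF p] mult_less_cancel_left_pos[OF p] del: mult_le_cancel_left mult_less_cancel_left)
  qed
  have inv: "(2 powi (- j)) *\<^sub>R ((2 powi j) *\<^sub>R x) = x" "(2 powi j) *\<^sub>R ((2 powi (- j)) *\<^sub>R x) = x" for x :: "real^'a"
    by (simp_all add: power_int_minus)
  show ?thesis
  proof safe
    fix x assume "x \<in> dyadic_cube N j l"
    hence "(2 powi j) *\<^sub>R x \<in> dyadic_cube N 0 l" by (simp only: *)
    thus "x \<in> (\<lambda>z. (2 powi (- j)) *\<^sub>R z) ` dyadic_cube N 0 l"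
      by (rule rev_image_eqI) (simp only: inv)
  next
    fix z :: "real^'a" assume "z \<in> dyadic_cube N 0 l"
    thus "(2 powi (- j)) *\<^sub>R z \<in> dyadic_cube N j l" unfolding * inv .
  qed
qed

lemma corner_scale: "corner N 0 l = (2 powi j) *\<^sub>R corner N j l"
proof -
  have e: "(2::real) powi (- 0 - int N) = 2 powi j * 2 powi (- j - int N)"
    by (simp flip: power_int_add)
  show ?thesis unfolding corner_def e by (simp add: vec_eq_iff)
qed

text \<open>Dilating the functional reduces each of the five scales to unit scale.  Sampling bounds the values
  for \<open>\<Phi>'\<close> at scale \<open>j + m\<close> by the infima, and the reproducing identity transfers the bounds to \<open>\<Phi>\<close>
  at scale \<open>j\<close>.\<close>

lemma pointwise_domination:
  fixes \<phi> \<phi>' :: "real^'n \<Rightarrow> complex" and L :: nat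
  assumes "admissible \<phi>" "admissible \<phi>'"
  defines "\<Phi> \<equiv> \<lambda>x. cnj (\<phi> x)" and "\<Phi>' \<equiv> \<lambda>x. cnj (\<phi>' x)"
  obtains N0 :: nat and C :: real where "C \<ge> 0"
    "\<And>N f j k z B. N \<ge> N0 \<Longrightarrow> functional f \<Longrightarrow> z \<in> dyadic_cube N j k \<Longrightarrow> 0 \<le> B \<Longrightarrow>
      (\<And>m l. m \<in> {-2..2} \<Longrightarrow>
        (INF z\<in>dyadic_cube N (j + m) l. ennreal (norm (f (\<lambda>y. dilate (j + m) \<Phi>' (y - z))))) \<le>
        ennreal (B * (1 + 2 powi j * norm (corner N (j + m) l - corner N j k)) ^ L)) \<Longrightarrow>
      norm (f (\<lambda>y. dilate j \<Phi> (y - z))) \<le> C * B"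
proof -
  obtain \<Psi> where \<Phi>': "\<Phi>' \<in> away" and \<Psi>: "\<Psi> \<in> schwartz"
    and supp': "\<And>\<xi>. fourier \<Phi>' \<xi> \<noteq> 0 \<Longrightarrow> 1/2 \<le> norm \<xi> \<and> norm \<xi> \<le> 2"
    and one: "\<And>\<xi>. 1/2 \<le> norm \<xi> \<Longrightarrow> norm \<xi> \<le> 2 \<Longrightarrow>
      (\<Sum>m\<in>{-2..2::int}. fourier (dilate m \<Psi>) \<xi> * fourier (dilate m \<Phi>') \<xi>) = 1"
    unfolding \<Phi>'_def proof (rule reproducing_kernel[OF assms(2)], goal_cases)
      case 1 show ?case by (rule 1(1)[OF 1(2-)])
    qed
  obtain \<Phi>: "\<Phi> \<in> away"
    and supp: "\<And>\<xi>. fourier \<Phi> \<xi> \<noteq> 0 \<Longrightarrow> 1/2 \<le> norm \<xi> \<and> norm \<xi> \<le> 2"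
    unfolding \<Phi>_def proof (rule reproducing_kernel[OF assms(1)], goal_cases)
      case 1 show ?case by (rule 1(1)[OF 1(2,4)])
    qed
  have r: "rapid \<Psi>" "rapid \<Phi>" "rapid \<Phi>'"
    using schwartz_rapid[OF \<Psi>, of "[]"] away_rapid \<Phi> \<Phi>' by simp_all
  define \<eta> where "\<eta> x = (\<Sum>m\<in>{-2..2::int}. convolve (dilate m \<Psi>) (dilate m \<Phi>') x)" for x
  have \<eta>rep: "\<Phi>' = convolve \<eta> \<Phi>'"
    unfolding \<eta>_def[abs_def] by (rule reproducing_identity(2)[OF r(3,1,3) supp' one])
  have \<eta>r: "rapid \<eta>" unfolding \<eta>_def[abs_def] by (intro rapid_sum rapid_conv rapid_dilate r)
  have \<eta>w: "weighted_lipschitz \<eta>" unfolding \<eta>_def[abs_def]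
    using schwartz_wlip[OF away_schwartz[OF away_dilate[OF \<Phi>']], of "[]"]
    by (intro wlip_sum wlip_conv rapid_dilate r) simp
  obtain N0 C1 where C1: "C1 \<ge> 0" and samp: "\<And>N u x0 B x. N \<ge> N0 \<Longrightarrow> functional u \<Longrightarrow> 0 \<le> B \<Longrightarrow>
      (\<And>l. (INF z\<in>dyadic_cube N 0 l. ennreal (norm (u (\<lambda>y. \<Phi>' (y - z))))) \<le>
        ennreal (B * (1 + norm (corner N 0 l - x0)) ^ L)) \<Longrightarrow>
      norm (u (\<lambda>y. \<Phi>' (y - x))) \<le> C1 * B * (1 + norm (x - x0)) ^ L"
    proof (rule sampling[OF \<eta>r \<eta>w \<Phi>' \<eta>rep, of L], goal_cases)
      case 1 show ?case by (rule 1(1)[OF 1(2)], rule 1(3); assumption)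
    qed
  define g where "g m = convolve \<Phi> (dilate m \<Psi>)" for m
  have gr: "rapid (g m)" for m unfolding g_def by (intro rapid_conv rapid_dilate r)
  have grep: "\<Phi> = (\<lambda>y. \<Sum>m\<in>{-2..2}. convolve (g m) (dilate m \<Phi>') y)"
    unfolding g_def by (rule reproducing_identity(1)[OF r(2,1,3) supp one])
  obtain C2 where C2: "C2 \<ge> 0" and trans: "\<And>u A x. functional u \<Longrightarrow> 0 \<le> A \<Longrightarrow>
     (\<And>m v. m \<in> {-2..2} \<Longrightarrow> norm (u (\<lambda>y. dilate m \<Phi>' (y - v))) \<le> A * (1 + norm (v - x)) ^ L) \<Longrightarrow>
     norm (u (\<lambda>y. \<Phi> (y - x))) \<le> C2 * A"
    proof (rule transfer_bound[OF finite_atLeastAtMost_int gr \<Phi> \<Phi>' grep, of L], goal_cases)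
      case 1 show ?case by (rule 1(1)[OF 1(2)], rule 1(3); assumption)
    qed
  define n where "n = CARD('n)"
  define C where "C = C2 * (C1 * (4 ^ L * (4 ^ L * (1 + real n) ^ L)))"
  have "norm (f (\<lambda>y. dilate j \<Phi> (y - z))) \<le> C * B"
    if N: "N \<ge> N0" and f: "functional f" and z: "z \<in> dyadic_cube N j k" and B: "0 \<le> B" and
      hyp: "\<And>m l. m \<in> {-2..2} \<Longrightarrow>
        (INF z\<in>dyadic_cube N (j + m) l. ennreal (norm (f (\<lambda>y. dilate (j + m) \<Phi>' (y - z))))) \<le>
        ennreal (B * (1 + 2 powi j * norm (corner N (j + m) l - corner N j k)) ^ L)" for N f j k z B
  proof -
    define c where "c = corner N j k"
    have four: "(2::real) powi m \<le> 4" "(2::real) powi (- m) \<le> 4" if "m \<in> {-2..2}" for m :: int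
      using power_int_increasing[of m 2 "2::real"] power_int_increasing[of "- m" 2 "2::real"] that by auto
    have scale: "1 + a * t \<le> 4 * (1 + t)" if "a \<le> 4" "0 \<le> t" for a t :: real
      using mult_right_mono[OF that] by simp
    \<comment> \<open>sampling for the functional dilated to the level \<open>j + m\<close>; the factors \<open>4 ^ L\<close> come from \<open>2 powi m \<le> 4\<close>\<close>
    have level: "norm (f (\<lambda>y. dilate (j + m) \<Phi>' (y - z'))) \<le> C1 * (4 ^ L * B) * (1 + 2 powi (j + m) * norm (z' - c)) ^ L"
      if m: "m \<in> {-2..2}" for m z'
    proof -
      define p where "p = (2::real) powi (j + m)"
      have p: "p > 0" by (simp add: p_def)
      define u where "u g = f (dilate (j + m) g)" for g
      have u: "functional u" unfolding u_def by (rule functional_dilate[OF f])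
      have ut: "u (\<lambda>y. \<Phi>' (y - x)) = f (\<lambda>y. dilate (j + m) \<Phi>' (y - (2 powi (- (j + m))) *\<^sub>R x))" for x
        unfolding u_def using dilate_translate[of "j + m" 0 \<Phi>' x] by (simp add: dilate_zero)
      have "norm (u (\<lambda>y. \<Phi>' (y - p *\<^sub>R z'))) \<le> C1 * (4 ^ L * B) * (1 + norm (p *\<^sub>R z' - p *\<^sub>R c)) ^ L"
      proof (rule samp[OF N u])
        fix l
        have "(INF z\<in>dyadic_cube N 0 l. ennreal (norm (u (\<lambda>y. \<Phi>' (y - z))))) =
            (INF z\<in>dyadic_cube N (j + m) l. ennreal (norm (f (\<lambda>y. dilate (j + m) \<Phi>' (y - z)))))"
          unfolding ut dyadic_cube_scale[of N "j + m"] image_image ..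
        also have "\<dots> \<le> ennreal (B * (1 + 2 powi j * norm (corner N (j + m) l - c)) ^ L)"
          unfolding c_def by (rule hyp[OF m])
        also have "\<dots> \<le> ennreal (4 ^ L * B * (1 + norm (corner N 0 l - p *\<^sub>R c)) ^ L)"
        proof (rule ennreal_leI)
          have "corner N 0 l - p *\<^sub>R c = p *\<^sub>R (corner N (j + m) l - c)"
            unfolding corner_scale[of N l "j + m"] p_def by (simp add: scaleR_right_diff_distrib)
          hence e: "norm (corner N 0 l - p *\<^sub>R c) = p * norm (corner N (j + m) l - c)" using p by simp
          have "(2::real) powi j = 2 powi (- m) * p"
            unfolding p_def by (simp flip: power_int_add)
          hence "1 + 2 powi j * norm (corner N (j + m) l - c) \<le> 4 * (1 + norm (corner N 0 l - p *\<^sub>R c))"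
            unfolding e using scale[OF four(2)[OF m], of "p * norm (corner N (j + m) l - c)"] p by (simp add: mult.assoc)
          hence "(1 + 2 powi j * norm (corner N (j + m) l - c)) ^ L \<le> 4 ^ L * (1 + norm (corner N 0 l - p *\<^sub>R c)) ^ L"
            unfolding power_mult_distrib[symmetric] by (intro power_mono) auto
          from mult_left_mono[OF this B]
          show "B * (1 + 2 powi j * norm (corner N (j + m) l - c)) ^ L \<le> 4 ^ L * B * (1 + norm (corner N 0 l - p *\<^sub>R c)) ^ L"
            by (simp add: mult_ac)
        qed
        finally show "(INF z\<in>dyadic_cube N 0 l. ennreal (norm (u (\<lambda>y. \<Phi>' (y - z))))) \<le>
            ennreal (4 ^ L * B * (1 + norm (corner N 0 l - p *\<^sub>R c)) ^ L)" .
      qed (use B in simp)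
      moreover have "u (\<lambda>y. \<Phi>' (y - p *\<^sub>R z')) = f (\<lambda>y. dilate (j + m) \<Phi>' (y - z'))"
        unfolding ut p_def by (simp flip: power_int_add)
      moreover have "norm (p *\<^sub>R z' - p *\<^sub>R c) = p * norm (z' - c)"
        using p by (simp flip: scaleR_right_diff_distrib)
      ultimately show ?thesis by (simp add: p_def)
    qed
    define u where "u g = f (dilate j g)" for g
    have u: "functional u" unfolding u_def by (rule functional_dilate[OF f])
    define x where "x = (2 powi j) *\<^sub>R z"
    define A where "A = C1 * (4 ^ L * B) * (4 ^ L * (1 + real n) ^ L)"
    have xc: "norm (x - (2 powi j) *\<^sub>R c) \<le> real n"
    proof -
      have "x - (2 powi j) *\<^sub>R c = (2 powi j) *\<^sub>R (z - c)" by (simp add: x_def scaleR_right_diff_distrib)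
      hence "norm (x - (2 powi j) *\<^sub>R c) = 2 powi j * norm (z - c)" by simp
      also have "\<dots> \<le> 2 powi j * (real n * 2 powi (- j - int N))"
        unfolding n_def c_def by (intro mult_left_mono dist_corner z) simp
      also have "\<dots> = real n * 2 powi (- int N)"
        by (simp add: mult.left_commute flip: power_int_add)
      also have "\<dots> \<le> real n * 1"
        by (intro mult_left_mono) (simp_all add: power_int_minus field_simps)
      finally show ?thesis by simp
    qed
    have "norm (u (\<lambda>y. \<Phi> (y - x))) \<le> C2 * A"
    proof (rule trans[OF u])
      show "0 \<le> A" unfolding A_def using C1 B by simp
      fix m v assume m: "m \<in> {-2..2::int}"
      have "norm (u (\<lambda>y. dilate m \<Phi>' (y - v))) = norm (f (\<lambda>y. dilate (j + m) \<Phi>' (y - (2 powi (- j)) *\<^sub>R v)))"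
        unfolding u_def dilate_translate ..
      also have "\<dots> \<le> C1 * (4 ^ L * B) * (1 + 2 powi (j + m) * norm ((2 powi (- j)) *\<^sub>R v - c)) ^ L"
        by (rule level[OF m])
      also have "\<dots> \<le> C1 * (4 ^ L * B) * (4 ^ L * ((1 + real n) ^ L * (1 + norm (v - x)) ^ L))"
      proof (rule mult_left_mono)
        have "(2 powi j) *\<^sub>R ((2 powi (- j)) *\<^sub>R v - c) = v - (2 powi j) *\<^sub>R c"
          by (simp add: scaleR_right_diff_distrib flip: power_int_add)
        hence "2 powi j * norm ((2 powi (- j)) *\<^sub>R v - c) = norm (v - (2 powi j) *\<^sub>R c)"
          by (metis abs_of_pos norm_scaleR zero_less_numeral zero_less_power_int)
        hence "1 + 2 powi (j + m) * norm ((2 powi (- j)) *\<^sub>R v - c) = 1 + 2 powi m * norm (v - (2 powi j) *\<^sub>R c)"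
          by (simp add: power_int_add mult_ac)
        also have "\<dots> \<le> 4 * (1 + norm (v - (2 powi j) *\<^sub>R c))" by (rule scale[OF four(1)[OF m]]) simp
        also have "\<dots> \<le> 4 * ((1 + norm (v - x)) * (1 + real n))"
        proof (rule mult_left_mono)
          have "1 + norm (v - (2 powi j) *\<^sub>R c) \<le> (1 + norm (v - x)) * (1 + norm (x - (2 powi j) *\<^sub>R c))"
            using one_plus_norm_add[of "v - x" "x - (2 powi j) *\<^sub>R c"] by simp
          also have "\<dots> \<le> (1 + norm (v - x)) * (1 + real n)" using xc by (intro mult_left_mono) auto
          finally show "1 + norm (v - (2 powi j) *\<^sub>R c) \<le> (1 + norm (v - x)) * (1 + real n)" .
        qed simp
        finally have "1 + 2 powi (j + m) * norm ((2 powi (- j)) *\<^sub>R v - c) \<le> 4 * ((1 + real n) * (1 + norm (v - x)))"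
          by (simp only: mult.commute)
        thus "(1 + 2 powi (j + m) * norm ((2 powi (- j)) *\<^sub>R v - c)) ^ L \<le> 4 ^ L * ((1 + real n) ^ L * (1 + norm (v - x)) ^ L)"
          unfolding power_mult_distrib[symmetric] by (intro power_mono) auto
      qed (use C1 B in simp)
      finally show "norm (u (\<lambda>y. dilate m \<Phi>' (y - v))) \<le> A * (1 + norm (v - x)) ^ L"
        by (simp add: A_def mult_ac)
    qed
    moreover have "u (\<lambda>y. \<Phi> (y - x)) = f (\<lambda>y. dilate j \<Phi> (y - z))"
      unfolding u_def using dilate_translate[of j 0 \<Phi> x]
      by (simp add: dilate_zero x_def flip: power_int_add)
    ultimately show ?thesis by (simp add: A_def C_def mult_ac)
  qed
  moreover have "C \<ge> 0" unfolding C_def using C1 C2 by simp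
  ultimately show ?thesis using that by blast
qed

section \<open>Norms of characteristic functions\<close>

definition modular :: "(real^'n \<Rightarrow> real) \<Rightarrow> real \<Rightarrow> (real^'n) set \<Rightarrow> ennreal" where
  "modular p t P = (\<integral>\<^sup>+ x\<in>P. ennreal (t powr - p x) \<partial>lebesgue)"

lemma Lp_norm_indicator:
  assumes p: "\<And>x. 0 < p x"
  shows "Lp_norm p (indicat_real P) = Inf {ennreal t |t. t > 0 \<and> modular p t P \<le> 1}"
proof -
  have "(\<integral>\<^sup>+ x. ennreal ((norm (indicat_real P x) / t) powr p x) \<partial>lebesgue) = modular p t P" if "t > 0" for t
    unfolding modular_def
  proof (rule nn_integral_cong)
    fix x
    show "ennreal ((norm (indicat_real P x) / t) powr p x) = ennreal (t powr - p x) * indicator P x"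
      using that by (auto simp: indicator_def powr_minus divide_inverse inverse_powr)
  qed
  thus ?thesis unfolding Lp_norm_def by (metis (no_types, lifting))
qed

lemma modular_upper:
  assumes P: "P \<in> sets lebesgue" and "\<And>x. x \<in> P \<Longrightarrow> t powr - p x \<le> B"
  shows "modular p t P \<le> ennreal B * emeasure lebesgue P"
proof -
  have "modular p t P \<le> (\<integral>\<^sup>+ x. ennreal B * indicator P x \<partial>lebesgue)"
    unfolding modular_def by (intro nn_integral_mono) (auto simp: indicator_def assms ennreal_leI)
  thus ?thesis using P by (simp add: nn_integral_cmult_indicator)
qed

lemma modular_lower:
  assumes P: "P \<in> sets lebesgue" and "\<And>x. x \<in> P \<Longrightarrow> B \<le> t powr - p x"
  shows "ennreal B * emeasure lebesgue P \<le> modular p t P"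
proof -
  have "(\<integral>\<^sup>+ x. ennreal B * indicator P x \<partial>lebesgue) \<le> modular p t P"
    unfolding modular_def by (intro nn_integral_mono) (auto simp: indicator_def assms ennreal_leI)
  thus ?thesis using P by (simp add: nn_integral_cmult_indicator)
qed

lemma modular_scale:
  assumes p: "p \<in> borel_measurable lebesgue" and P: "P \<in> sets lebesgue"
    and t: "0 < t" and K: "0 < K" and B: "\<And>x. x \<in> P \<Longrightarrow> K powr - p x \<le> B"
  shows "modular p (K * t) P \<le> ennreal B * modular p t P"
proof -
  have "modular p (K * t) P \<le> (\<integral>\<^sup>+ x. ennreal B * (ennreal (t powr - p x) * indicator P x) \<partial>lebesgue)"
    unfolding modular_def
  proof (rule nn_integral_mono)
    fix x
    have "(K * t) powr - p x = K powr - p x * t powr - p x" using t K by (simp add: powr_mult)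
    also have "x \<in> P \<Longrightarrow> \<dots> \<le> B * t powr - p x" by (intro mult_right_mono B) auto
    finally have "x \<in> P \<Longrightarrow> ennreal ((K * t) powr - p x) \<le> ennreal (B * t powr - p x)" by (rule ennreal_leI)
    moreover have "x \<in> P \<Longrightarrow> 0 \<le> B" using B[of x] powr_ge_zero order_trans by blast
    ultimately show "ennreal ((K * t) powr - p x) * indicator P x \<le> ennreal B * (ennreal (t powr - p x) * indicator P x)"
      by (auto simp: indicator_def ennreal_mult)
  qed
  also have "\<dots> = ennreal B * modular p t P"
  proof -
    have [measurable]: "p \<in> borel_measurable lebesgue" "P \<in> sets lebesgue" using p P .
    show ?thesis unfolding modular_def by (rule nn_integral_cmult) measurable
  qed
  finally show ?thesis .
qed

text \<open>Averaging the pointwise inequality over \<open>x \<in> P\<close> bounds the integrand at every \<open>y \<in> P'\<close>.\<close>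

lemma modular_compare:
  assumes p: "p \<in> borel_measurable lebesgue" and P: "P \<in> sets lebesgue" and P': "P' \<in> sets lebesgue"
    and V: "V > 0" "ennreal V \<le> emeasure lebesgue P"
    and E: "E \<ge> 0" "\<And>x y. x \<in> P \<Longrightarrow> y \<in> P' \<Longrightarrow> t powr - p y \<le> E * t powr - p x"
    and one: "modular p t P \<le> 1"
  shows "modular p t P' \<le> ennreal (E / V) * emeasure lebesgue P'"
proof (rule modular_upper[OF P'])
  fix y assume y: "y \<in> P'"
  have "ennreal (t powr - p y) * ennreal V \<le> ennreal (t powr - p y) * emeasure lebesgue P"
    by (intro mult_left_mono V) simp
  also have "\<dots> = (\<integral>\<^sup>+ x. ennreal (t powr - p y) * indicator P x \<partial>lebesgue)"
    using P by (simp add: nn_integral_cmult_indicator)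
  also have "\<dots> \<le> (\<integral>\<^sup>+ x. ennreal E * (ennreal (t powr - p x) * indicator P x) \<partial>lebesgue)"
    using E(2)[OF _ y] E(1)
    by (intro nn_integral_mono) (auto simp: indicator_def ennreal_mult[symmetric] intro!: ennreal_leI)
  also have "\<dots> = ennreal E * modular p t P"
  proof -
    have [measurable]: "p \<in> borel_measurable lebesgue" "P \<in> sets lebesgue" using p P .
    show ?thesis unfolding modular_def by (rule nn_integral_cmult) measurable
  qed
  also have "\<dots> \<le> ennreal E * 1" by (intro mult_left_mono one) simp
  finally have "ennreal (t powr - p y * V) \<le> ennreal E" using V by (simp add: ennreal_mult)
  hence "t powr - p y * V \<le> E" using E(1) by (simp add: ennreal_le_iff)
  thus "t powr - p y \<le> E / V" using V by (simp add: pos_le_divide_eq)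
qed

lemma emeasure_ball_le:
  assumes "r \<ge> 0" shows "emeasure lebesgue {x::real^'n. norm x < r} \<le> ennreal ((2 * r) ^ CARD('n))"
proof -
  let ?r = "\<chi> i. r" and ?q = "\<chi> i. - r"
  have "{x::real^'n. norm x < r} \<subseteq> cbox ?q ?r"
  proof
    fix x :: "real^'n" assume "x \<in> {x. norm x < r}"
    hence "\<bar>x $ i\<bar> \<le> r" for i using component_le_norm_cart[of x i] by simp
    thus "x \<in> cbox ?q ?r" by (simp add: mem_box_cart abs_le_iff) (smt (verit))
  qed
  hence "emeasure lebesgue {x::real^'n. norm x < r} \<le> emeasure lebesgue (cbox ?q (?r :: real^'n))"
    by (intro emeasure_mono) auto
  also have "\<dots> = ennreal ((2 * r) ^ CARD('n))"
  proof -
    have *: "?r \<bullet> b = r" "?q \<bullet> b = - r" if "b \<in> Basis" for b :: "real^'n"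
      using that by (auto simp: Basis_vec_def inner_axis)
    hence "(\<Prod>b\<in>(Basis::(real^'n) set). (?r - ?q) \<bullet> b) = (\<Prod>b\<in>(Basis::(real^'n) set). 2 * r)"
      by (intro prod.cong) (simp_all add: inner_diff_left)
    moreover have "\<forall>b\<in>(Basis::(real^'n) set). ?q \<bullet> b \<le> ?r \<bullet> b"
      using assms * by simp
    ultimately show ?thesis by (simp add: emeasure_lborel_cbox_eq)
  qed
  finally show ?thesis .
qed

text \<open>The assumptions on the exponent with finite real bounds and with the log-Hoelder constant named.\<close>

locale exponent =
  fixes p :: "real^'n \<Rightarrow> real" and a b H :: real
  assumes p[measurable]: "p \<in> borel_measurable lebesgue"
    and a: "0 < a" and ap: "\<And>x. a \<le> p x" and pb: "\<And>x. p x \<le> b" and H: "0 < H"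
    and local_lh: "\<And>x y. 0 < norm (x - y) \<Longrightarrow> norm (x - y) \<le> 1/2 \<Longrightarrow> \<bar>p x - p y\<bar> \<le> H / (- ln (norm (x - y)))"
    and decay_lh: "\<And>x y. norm x \<le> norm y \<Longrightarrow> \<bar>p x - p y\<bar> \<le> H / ln (exp 1 + norm x)"
begin

lemma ppos: "0 < p x" using a ap[of x] by simp
lemma b: "0 < b" "a \<le> b" using ap[of 0] pb[of 0] a by auto
lemma pdiff: "\<bar>p x - p y\<bar> \<le> b" using ppos[of x] ppos[of y] pb[of x] pb[of y] by auto

lemma Lp_norm_indicator_less_top:
  assumes P: "P \<in> sets lebesgue" and V: "emeasure lebesgue P = ennreal V" "V > 0"
  shows "Lp_norm p (indicat_real P) < top"
proof -
  define t where "t = max 1 (V powr (1 / a))"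
  have t: "t \<ge> 1" by (simp add: t_def)
  have "V \<le> t powr a"
  proof -
    have "V = (V powr (1 / a)) powr a" using V a by (simp add: powr_powr)
    also have "\<dots> \<le> t powr a" using a by (intro powr_mono2) (auto simp: t_def)
    finally show ?thesis .
  qed
  hence "t powr - a \<le> 1 / V" using V t by (simp add: powr_minus divide_inverse)
  moreover have "t powr - p x \<le> t powr - a" for x using t ap[of x] by (intro powr_mono) auto
  ultimately have "t powr - p x \<le> 1 / V" for x by (meson order_trans)
  from modular_upper[where p=p, OF P this] have "modular p t P \<le> 1"
    using V by (simp flip: ennreal_mult)
  hence "Lp_norm p (indicat_real P) \<le> ennreal t"
    unfolding Lp_norm_indicator[OF ppos] using t by (intro Inf_lower) auto
  thus ?thesis by (rule le_less_trans) simp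
qed

lemma Lp_norm_indicator_pos:
  assumes P: "P \<in> sets lebesgue" and V: "emeasure lebesgue P = ennreal V" "V > 0"
  shows "0 < Lp_norm p (indicat_real P)"
proof -
  have "ennreal (min 1 (V powr (1 / a))) \<le> Lp_norm p (indicat_real P)"
    unfolding Lp_norm_indicator[OF ppos]
  proof (rule Inf_greatest, clarify)
    fix t :: real assume t: "0 < t" and m: "modular p t P \<le> 1"
    show "ennreal (min 1 (V powr (1 / a))) \<le> ennreal t"
    proof (rule ennreal_leI, cases "t \<le> 1")
      case True
      have "t powr - a \<le> t powr - p x" for x using t True ap[of x] by (intro powr_mono') auto
      from modular_lower[where p=p, OF P this] m have "ennreal (t powr - a * V) \<le> 1"
        using V by (simp add: ennreal_mult order_trans)
      hence "t powr - a * V \<le> 1" by (simp add: ennreal_le_1)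
      hence "V \<le> t powr a" using t by (simp add: powr_minus field_simps)
      hence "V powr (1 / a) \<le> (t powr a) powr (1 / a)" using V a by (intro powr_mono2) auto
      also have "\<dots> = t" using t a by (simp add: powr_powr)
      finally show "min 1 (V powr (1 / a)) \<le> t" by simp
    qed simp
  qed
  moreover have "0 < ennreal (min 1 (V powr (1 / a)))" using V by simp
  ultimately show ?thesis by (rule less_le_trans[rotated])
qed

lemma powr_compare:
  assumes "0 < t" shows "t powr - p y \<le> exp (\<bar>ln t\<bar> * \<bar>p x - p y\<bar>) * t powr - p x"
proof -
  have "t powr - p y = t powr (p x - p y) * t powr - p x" by (simp flip: powr_add)
  also have "t powr (p x - p y) \<le> exp (\<bar>ln t\<bar> * \<bar>p x - p y\<bar>)"
    using assms abs_ge_self[of "(p x - p y) * ln t"] by (simp add: powr_def abs_mult mult.commute)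
  finally show ?thesis by (simp add: mult_right_mono)
qed

text \<open>The slope in the bound of \<open>\<bar>ln t\<bar>\<close> by \<open>\<bar>ln s\<bar>\<close> that holds when \<open>t\<close> is about the norm of the
  characteristic function of a set of measure \<open>s ^ CARD('n)\<close>.\<close>

definition log_slope :: real where "log_slope = max (real CARD('n) / a) (b / a * ln 2) + 1"

lemma log_slope: "0 < log_slope" "real CARD('n) / a \<le> log_slope" "b / a * ln 2 \<le> log_slope"
proof -
  have "0 < real CARD('n) / a" using a by simp
  thus "0 < log_slope" unfolding log_slope_def by linarith
  show "real CARD('n) / a \<le> log_slope" "b / a * ln 2 \<le> log_slope" unfolding log_slope_def by linarith+
qed

text \<open>Bounding the exponent by \<open>a\<close> and \<open>b\<close> in the modular traps \<open>t\<close> between powers of \<open>s\<close>.\<close>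

lemma log_size:
  assumes P: "P \<in> sets lebesgue" and s: "0 < s" and V: "emeasure lebesgue P = ennreal (s ^ CARD('n))"
    and t: "0 < t" and up: "modular p t P \<le> 1" and low: "1 \<le> ennreal (2 powr b) * modular p t P"
  shows "\<bar>ln t\<bar> \<le> log_slope * \<bar>ln s\<bar> + log_slope" and "1 \<le> s \<Longrightarrow> 1 \<le> t \<and> s ^ CARD('n) \<le> t powr b"
proof -
  have Vpos: "0 < s ^ CARD('n)" using s by simp
  have case1: "s ^ CARD('n) \<le> t powr a" if "t \<le> 1"
  proof -
    have "t powr - a \<le> t powr - p x" for x using t that ap[of x] by (intro powr_mono') auto
    from modular_lower[where p=p, OF P this] up have "ennreal (t powr - a * s ^ CARD('n)) \<le> 1"
      using V Vpos by (simp add: ennreal_mult order_trans)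
    hence "t powr - a * s ^ CARD('n) \<le> 1" by (simp add: ennreal_le_1)
    thus ?thesis using t by (simp add: powr_minus field_simps)
  qed
  have case2: "t powr a \<le> 2 powr b * s ^ CARD('n)" "s ^ CARD('n) \<le> t powr b" if "1 \<le> t"
  proof -
    have "t powr - p x \<le> t powr - a" for x using that ap[of x] by (intro powr_mono) auto
    from modular_upper[where p=p, OF P this] have "modular p t P \<le> ennreal (t powr - a * s ^ CARD('n))"
      using V Vpos by (simp add: ennreal_mult)
    hence "ennreal (2 powr b) * modular p t P \<le> ennreal (2 powr b) * ennreal (t powr - a * s ^ CARD('n))"
      by (rule mult_left_mono) simp
    with low have "1 \<le> ennreal (2 powr b) * ennreal (t powr - a * s ^ CARD('n))" by (rule order_trans)
    hence "1 \<le> ennreal (2 powr b * (t powr - a * s ^ CARD('n)))" using Vpos by (simp add: ennreal_mult)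
    hence "1 \<le> 2 powr b * (t powr - a * s ^ CARD('n))" by simp
    thus "t powr a \<le> 2 powr b * s ^ CARD('n)" using t by (simp add: powr_minus field_simps)
    have "t powr - b \<le> t powr - p x" for x using that pb[of x] by (intro powr_mono) auto
    from modular_lower[where p=p, OF P this] up have "ennreal (t powr - b * s ^ CARD('n)) \<le> 1"
      using V Vpos by (simp add: ennreal_mult order_trans)
    hence "t powr - b * s ^ CARD('n) \<le> 1" by (simp add: ennreal_le_1)
    thus "s ^ CARD('n) \<le> t powr b" using t by (simp add: powr_minus field_simps)
  qed
  show "\<bar>ln t\<bar> \<le> log_slope * \<bar>ln s\<bar> + log_slope"
  proof (cases "t \<le> 1")
    case True
    have "ln (s ^ CARD('n)) \<le> ln (t powr a)" using case1[OF True] Vpos by (subst ln_le_cancel_iff) (use t in auto)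
    hence "real CARD('n) * ln s \<le> a * ln t" using s t by (simp add: ln_realpow ln_powr)
    hence "- ln t \<le> real CARD('n) / a * (- ln s)" using a by (simp add: field_simps)
    also have "\<dots> \<le> real CARD('n) / a * \<bar>ln s\<bar>" using a by (intro mult_left_mono) auto
    also have "\<dots> \<le> log_slope * \<bar>ln s\<bar>" by (intro mult_right_mono log_slope) auto
    finally show ?thesis using True t log_slope(1) by simp
  next
    case False
    have "ln (t powr a) \<le> ln (2 powr b * s ^ CARD('n))"
      using case2(1) False Vpos t by (subst ln_le_cancel_iff) auto
    hence "a * ln t \<le> b * ln 2 + real CARD('n) * ln s"
      using s t by (simp add: ln_realpow ln_powr ln_mult)
    hence "ln t \<le> b / a * ln 2 + real CARD('n) / a * ln s" using a by (simp add: field_simps)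
    also have "\<dots> \<le> log_slope + real CARD('n) / a * \<bar>ln s\<bar>" using a by (intro add_mono log_slope mult_left_mono) auto
    also have "\<dots> \<le> log_slope + log_slope * \<bar>ln s\<bar>" by (intro add_left_mono mult_right_mono log_slope) auto
    finally show ?thesis using False by simp
  qed
  show "1 \<le> t \<and> s ^ CARD('n) \<le> t powr b" if s1: "1 \<le> s"
  proof -
    have "1 \<le> t"
    proof (rule ccontr)
      assume "\<not> 1 \<le> t"
      hence "t powr a < 1 powr a" using t a by (intro powr_less_mono2) auto
      moreover have "1 \<le> s ^ CARD('n)" using s1 by (rule one_le_power)
      ultimately show False using case1 \<open>\<not> 1 \<le> t\<close> by simp
    qed
    thus ?thesis using case2(2) by simp
  qed
qed

text \<open>If \<open>s * D \<le> sqrt s\<close>, then \<open>- ln (norm (x - y))\<close> is at least half of \<open>- ln s\<close> and the local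
  log-Hoelder condition applies.  Otherwise \<open>D\<close> exceeds the inverse square root of \<open>s\<close>, and the crude
  bound \<open>\<bar>p x - p y\<bar> \<le> b\<close> suffices.\<close>

lemma small_scale:
  assumes s: "0 < s" "s \<le> 16" and D: "1 \<le> D" and xy: "norm (x - y) \<le> s * D"
  shows "\<bar>ln s\<bar> * \<bar>p x - p y\<bar> \<le> 2 * H + b * ln 16 + 2 * b * ln D"
proof (cases "s \<ge> 1/4 \<or> x = y")
  case True
  have l16: "0 < ln (16::real)" by simp
  have lD: "0 \<le> 2 * b * ln D" using b D by simp
  from True show ?thesis
  proof
    assume s4: "s \<ge> 1/4"
    have "ln s \<le> ln 16" using s by simp
    moreover have "ln (inverse 16) \<le> ln s" using s s4 by (subst ln_le_cancel_iff) auto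
    moreover have "ln (inverse 16) = - ln (16::real)" by (rule ln_inverse)
    ultimately have "\<bar>ln s\<bar> \<le> ln 16" by linarith
    hence "\<bar>ln s\<bar> * \<bar>p x - p y\<bar> \<le> ln 16 * b" by (intro mult_mono pdiff) auto
    also have "\<dots> = b * ln 16" by simp
    finally show ?thesis using H lD by linarith
  next
    assume "x = y" thus ?thesis using H b l16 lD by simp
  qed
next
  case False
  hence s4: "s < 1/4" and ne: "0 < norm (x - y)" by auto
  have ls: "ln s < 0" using s s4 by simp
  show ?thesis
  proof (cases "s * D \<le> sqrt s")
    case True
    have sq: "sqrt s \<le> 1/2" using s4 s by (intro real_le_lsqrt) (auto simp: power2_eq_square)
    have d: "norm (x - y) \<le> sqrt s" using xy True by linarith
    have "ln (norm (x - y)) \<le> ln (sqrt s)" using d ne s by (subst ln_le_cancel_iff) auto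
    also have "ln (sqrt s) = ln s / 2" using s by (simp add: ln_sqrt)
    finally have l: "- ln s / 2 \<le> - ln (norm (x - y))" by simp
    have "\<bar>p x - p y\<bar> \<le> H / (- ln (norm (x - y)))" using local_lh[OF ne] d sq by simp
    also have "\<dots> \<le> H / (- ln s / 2)" using H l ls by (intro divide_left_mono mult_pos_pos) auto
    finally have "\<bar>ln s\<bar> * \<bar>p x - p y\<bar> \<le> \<bar>ln s\<bar> * (H / (- ln s / 2))" by (rule mult_left_mono) simp
    also have "\<dots> = 2 * H" using ls by (simp add: field_simps)
    finally show ?thesis using b D by (simp add: add_nonneg_nonneg add_increasing2)
  next
    case False
    have "sqrt s * (sqrt s * D) = s * D" using s by (simp flip: mult.assoc)
    hence "sqrt s * 1 < sqrt s * (sqrt s * D)" using False by (simp only: mult_1_right not_le)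
    hence "1 < sqrt s * D" by (rule mult_left_less_imp_less) (use s in simp)
    hence "0 < ln (sqrt s * D)" using D s by simp
    hence "- ln s \<le> 2 * ln D" using D s by (simp add: ln_mult ln_sqrt)
    hence "\<bar>ln s\<bar> * \<bar>p x - p y\<bar> \<le> (2 * ln D) * b" using ls D by (intro mult_mono pdiff) auto
    thus ?thesis using H b by (simp add: mult_ac add_increasing)
  qed
qed

text \<open>The integrands at \<open>y\<close> and \<open>x\<close> differ by the factor \<open>t powr (p x - p y)\<close>.  At small scales \<open>small_scale\<close>
  bounds it by a power of \<open>D\<close>.  At large scales \<open>t \<ge> 1\<close>, and the factor is bounded by the decay
  condition as long as \<open>x\<close> and \<open>y\<close> have norm at least \<open>s powr \<delta>\<close>.  The exceptional ball around the
  origin fills at most half of \<open>P\<close>, and for \<open>\<delta> = a / (2 * b)\<close> its measure is compensated by the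
  smallness of \<open>t powr - a\<close>.\<close>

lemma modular_transfer:
  assumes c: "c \<ge> 0"
  obtains Q where "Q \<ge> 1" "\<And>P P' s D t. P \<in> sets lebesgue \<Longrightarrow> P' \<in> sets lebesgue \<Longrightarrow> 0 < s \<Longrightarrow>
    emeasure lebesgue P = ennreal (s ^ CARD('n)) \<Longrightarrow> emeasure lebesgue P' \<le> ennreal (c * s ^ CARD('n)) \<Longrightarrow>
    1 \<le> D \<Longrightarrow> (\<And>x y. x \<in> P \<Longrightarrow> y \<in> P' \<Longrightarrow> norm (x - y) \<le> s * D) \<Longrightarrow> 0 < t \<Longrightarrow>
    modular p t P \<le> 1 \<Longrightarrow> 1 \<le> ennreal (2 powr b) * modular p t P \<Longrightarrow>
    modular p t P' \<le> ennreal (Q * D powr (2 * b * log_slope))"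
proof -
  define n where "n = CARD('n)"
  have n: "n > 0" by (simp add: n_def)
  define E0 where "E0 = exp (log_slope * (2 * H + b * ln 16) + log_slope * b)"
  define \<delta> where "\<delta> = a / (2 * b)"
  have \<delta>: "0 < \<delta>" "\<delta> \<le> 1/2" using a b by (auto simp: \<delta>_def field_simps)
  define E1 where "E1 = exp (2 * log_slope * H / \<delta>)"
  define Q where "Q = c * E0 + 2 * c * E1 + 2 ^ n + 1"
  have E0: "E0 > 0" and E1: "E1 > 0" by (simp_all add: E0_def E1_def)
  have Q: "Q \<ge> 1" "c * E0 \<le> Q" "2 * c * E1 + 2 ^ n \<le> Q"
    using c E0 E1 by (auto simp: Q_def add_nonneg_nonneg)
  have "modular p t P' \<le> ennreal (Q * D powr (2 * b * log_slope))"
    if P: "P \<in> sets lebesgue" and P': "P' \<in> sets lebesgue" and s: "0 < s"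
    and V: "emeasure lebesgue P = ennreal (s ^ CARD('n))" and V': "emeasure lebesgue P' \<le> ennreal (c * s ^ CARD('n))"
    and D: "1 \<le> D" and dist: "\<And>x y. x \<in> P \<Longrightarrow> y \<in> P' \<Longrightarrow> norm (x - y) \<le> s * D" and t: "0 < t"
    and up: "modular p t P \<le> 1" and low: "1 \<le> ennreal (2 powr b) * modular p t P" for P P' s D t
  proof -
    note V = V[folded n_def] and V' = V'[folded n_def]
    have Vpos: "0 < s ^ n" using s by simp
    have D1: "1 \<le> D powr (2 * b * log_slope)" using D b log_slope(1) by (intro ge_one_powr_ge_zero) auto
    have lt: "\<bar>ln t\<bar> \<le> log_slope * \<bar>ln s\<bar> + log_slope" by (rule log_size(1)[OF P s V[unfolded n_def] t up low])
    show ?thesis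
    proof (cases "s \<le> 16")
      case True
      have "modular p t P' \<le> ennreal ((E0 * D powr (2 * b * log_slope)) / s ^ n) * emeasure lebesgue P'"
      proof (rule modular_compare[OF p P P' Vpos _ _ _ up])
        show "ennreal (s ^ n) \<le> emeasure lebesgue P" by (simp add: V)
        show "0 \<le> E0 * D powr (2 * b * log_slope)" using E0 by simp
        fix x y assume x: "x \<in> P" and y: "y \<in> P'"
        have "\<bar>ln t\<bar> * \<bar>p x - p y\<bar> \<le> (log_slope * \<bar>ln s\<bar> + log_slope) * \<bar>p x - p y\<bar>" by (rule mult_right_mono[OF lt]) simp
        also have "\<dots> = log_slope * (\<bar>ln s\<bar> * \<bar>p x - p y\<bar>) + log_slope * \<bar>p x - p y\<bar>" by (simp add: algebra_simps)
        also have "\<dots> \<le> log_slope * (2 * H + b * ln 16 + 2 * b * ln D) + log_slope * b"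
          using log_slope(1) by (intro add_mono mult_left_mono small_scale[OF s True D dist[OF x y]] pdiff) auto
        finally have "exp (\<bar>ln t\<bar> * \<bar>p x - p y\<bar>) \<le> exp ((log_slope * (2 * H + b * ln 16) + log_slope * b) + 2 * b * log_slope * ln D)"
          by (simp add: algebra_simps)
        also have "\<dots> = E0 * D powr (2 * b * log_slope)"
          unfolding exp_add E0_def using D by (simp add: powr_def)
        finally have "exp (\<bar>ln t\<bar> * \<bar>p x - p y\<bar>) * t powr - p x \<le> (E0 * D powr (2 * b * log_slope)) * t powr - p x"
          by (rule mult_right_mono) simp
        with powr_compare[OF t, of y x] show "t powr - p y \<le> (E0 * D powr (2 * b * log_slope)) * t powr - p x"
          by (rule order_trans)
      qed
      also have "\<dots> \<le> ennreal ((E0 * D powr (2 * b * log_slope)) / s ^ n) * ennreal (c * s ^ n)"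
        by (intro mult_left_mono V') simp
      also have "\<dots> = ennreal ((c * E0) * D powr (2 * b * log_slope))"
        using E0 s c by (simp add: ennreal_mult[symmetric])
      also have "\<dots> \<le> ennreal (Q * D powr (2 * b * log_slope))" by (intro ennreal_leI mult_right_mono Q) simp
      finally show ?thesis .
    next
      case False
      have s16: "16 < s" using False by simp
      have t1: "1 \<le> t" and tb: "s ^ n \<le> t powr b" using log_size(2)[OF P s V[unfolded n_def] t up low] s16 by (auto simp: n_def)
      have ls: "1 \<le> ln s"
      proof -
        have "exp 1 \<le> (16::real)" using exp_le by simp
        hence "ln (exp 1) \<le> ln s" using s16 by (subst ln_le_cancel_iff) auto
        thus ?thesis by simp
      qed
      \<comment> \<open>near the origin the decay condition says nothing about \<open>p\<close>\<close>
      define R where "R = {x::real^'n. norm x < s powr \<delta>}"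
      have "open R" unfolding R_def by (intro open_Collect_less continuous_intros)
      hence R: "R \<in> sets lebesgue" by simp
      have Rm: "emeasure lebesgue R \<le> ennreal ((2 * s powr \<delta>) ^ n)"
        unfolding R_def n_def by (rule emeasure_ball_le) simp
      \<comment> \<open>here \<open>\<delta> \<le> 1/2\<close> and \<open>16 < s\<close> enter\<close>
      have half: "(2 * s powr \<delta>) ^ n \<le> s ^ n / 2"
      proof -
        have "s powr \<delta> \<le> s powr (1/2)" using s16 \<delta> by (intro powr_mono) auto
        also have "\<dots> = sqrt s" using s by (simp add: powr_half_sqrt)
        also have "\<dots> \<le> s / 4"
        proof (rule real_le_lsqrt)
          have "16 * s \<le> s * s" using s16 by (intro mult_right_mono) auto
          thus "s \<le> (s / 4)\<^sup>2" by (simp add: power2_eq_square)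
        qed (use s in auto)
        finally have "(2 * s powr \<delta>) ^ n \<le> (s / 2) ^ n" by (intro power_mono) auto
        also have "\<dots> = s ^ n * (1/2) ^ n" by (simp add: power_divide)
        also have "\<dots> \<le> s ^ n * (1/2) ^ 1" using n s by (intro mult_left_mono power_decreasing) auto
        finally show ?thesis by simp
      qed
      have far: "ennreal (s ^ n / 2) \<le> emeasure lebesgue (P - R)"
      proof -
        have "ennreal (s ^ n) \<le> emeasure lebesgue (P - R) + emeasure lebesgue R"
          unfolding V[symmetric] using P R
          by (intro order_trans[OF emeasure_mono emeasure_subadditive]) auto
        also have "\<dots> \<le> emeasure lebesgue (P - R) + ennreal (s ^ n / 2)"
          using order_trans[OF Rm ennreal_leI[OF half]] by (rule add_left_mono)
        finally have "ennreal (s ^ n / 2) + ennreal (s ^ n / 2) \<le> emeasure lebesgue (P - R) + ennreal (s ^ n / 2)"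
          using Vpos by (simp flip: ennreal_plus)
        thus ?thesis by (simp add: ennreal_add_left_cancel_le add.commute)
      qed
      have "modular p t (P' - R) \<le> ennreal (E1 / (s ^ n / 2)) * emeasure lebesgue (P' - R)"
      proof (rule modular_compare[OF p _ _ _ far])
        show "P - R \<in> sets lebesgue" "P' - R \<in> sets lebesgue" using P P' R by auto
        show "modular p t (P - R) \<le> 1"
        proof -
          have "modular p t (P - R) \<le> modular p t P"
            unfolding modular_def by (intro nn_integral_mono mult_left_mono) (auto simp: indicator_def)
          thus ?thesis using up by (rule order_trans)
        qed
        fix x y assume x: "x \<in> P - R" and y: "y \<in> P' - R"
        have nx: "s powr \<delta> \<le> norm x" "s powr \<delta> \<le> norm y" using x y by (auto simp: R_def)
        have ld: "0 < \<delta> * ln s" using \<delta> ls by simp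
        have dec: "\<bar>p u - p v\<bar> \<le> H / (\<delta> * ln s)" if "s powr \<delta> \<le> norm u" "norm u \<le> norm v" for u v
        proof -
          have "\<delta> * ln s = ln (s powr \<delta>)" using s by (simp add: ln_powr)
          also have "\<dots> \<le> ln (exp 1 + norm u)"
          proof (subst ln_le_cancel_iff)
            show "s powr \<delta> \<le> exp 1 + norm u" using that(1) exp_gt_zero[of "1::real"] by linarith
          qed (use s in \<open>auto simp: add_pos_nonneg\<close>)
          finally have l: "\<delta> * ln s \<le> ln (exp 1 + norm u)" .
          have "\<bar>p u - p v\<bar> \<le> H / ln (exp 1 + norm u)" by (rule decay_lh[OF that(2)])
          also have "\<dots> \<le> H / (\<delta> * ln s)" by (rule divide_left_mono[OF l less_imp_le[OF H] mult_pos_pos[OF less_le_trans[OF ld l] ld]])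
          finally show ?thesis .
        qed
        have "\<bar>p x - p y\<bar> \<le> H / (\<delta> * ln s)"
          using dec[of x y] dec[of y x] nx by (cases "norm x \<le> norm y") (auto simp: abs_minus_commute)
        moreover have "\<bar>ln t\<bar> \<le> 2 * log_slope * ln s"
        proof -
          have "log_slope * 1 \<le> log_slope * ln s" using log_slope(1) ls by (intro mult_left_mono) auto
          thus ?thesis using lt ls by simp
        qed
        ultimately have "\<bar>ln t\<bar> * \<bar>p x - p y\<bar> \<le> (2 * log_slope * ln s) * (H / (\<delta> * ln s))"
          using log_slope(1) ls by (intro mult_mono) auto
        also have "\<dots> = 2 * log_slope * H / \<delta>" using ls by simp
        finally have "exp (\<bar>ln t\<bar> * \<bar>p x - p y\<bar>) * t powr - p x \<le> E1 * t powr - p x"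
          unfolding E1_def by (intro mult_right_mono) auto
        with powr_compare[OF t, of y x] show "t powr - p y \<le> E1 * t powr - p x" by (rule order_trans)
      qed (use Vpos E1 in auto)
      also have "\<dots> \<le> ennreal (E1 / (s ^ n / 2)) * ennreal (c * s ^ n)"
        using order_trans[OF emeasure_mono V', of "P' - R"] P' by (intro mult_left_mono) auto
      also have "\<dots> = ennreal (2 * c * E1)"
        using E1 s c by (simp add: ennreal_mult[symmetric] field_simps)
      finally have m1: "modular p t (P' - R) \<le> ennreal (2 * c * E1)" .
      have tn: "t powr - a * (2 * s powr \<delta>) ^ n \<le> 2 ^ n"
      proof -
        have "s powr (real n * (a / b)) = (s ^ n) powr (a / b)" using s by (simp add: powr_powr powr_realpow[symmetric])
        also have "\<dots> \<le> (t powr b) powr (a / b)" using tb a b s by (intro powr_mono2) auto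
        also have "\<dots> = t powr a" using b by (simp add: powr_powr)
        finally have "t powr - a \<le> s powr - (real n * (a / b))"
          using s t by (simp add: powr_minus le_imp_inverse_le)
        hence "t powr - a * (2 * s powr \<delta>) ^ n \<le> s powr - (real n * (a / b)) * (2 * s powr \<delta>) ^ n"
          by (rule mult_right_mono) simp
        also have "\<dots> = 2 ^ n * (s powr - (real n * (a / b)) * s powr (real n * \<delta>))"
          using s by (simp add: power_mult_distrib powr_powr powr_realpow[symmetric] mult.commute)
        also have "\<dots> = 2 ^ n * s powr - (real n * \<delta>)"
        proof -
          have "- (real n * (a / b)) + real n * \<delta> = - (real n * \<delta>)" using b by (simp add: \<delta>_def field_simps)
          thus ?thesis by (simp only: powr_add[symmetric])
        qed
        also have "\<dots> \<le> 2 ^ n * 1"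
        proof (intro mult_left_mono)
          have "s powr - (real n * \<delta>) \<le> s powr 0" using s16 \<delta> by (intro powr_mono) auto
          thus "s powr - (real n * \<delta>) \<le> 1" using s by simp
        qed simp
        finally show ?thesis by simp
      qed
      have "modular p t (P' \<inter> R) \<le> ennreal (t powr - a) * emeasure lebesgue (P' \<inter> R)"
      proof (rule modular_upper)
        show "P' \<inter> R \<in> sets lebesgue" using P' R by auto
        show "t powr - p x \<le> t powr - a" for x using t1 ap[of x] by (intro powr_mono) auto
      qed
      also have "\<dots> \<le> ennreal (t powr - a) * ennreal ((2 * s powr \<delta>) ^ n)"
        using order_trans[OF emeasure_mono Rm, of "P' \<inter> R"] R by (intro mult_left_mono) auto
      also have "\<dots> = ennreal (t powr - a * (2 * s powr \<delta>) ^ n)" by (simp add: ennreal_mult)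
      also have "\<dots> \<le> ennreal (2 ^ n)" by (rule ennreal_leI[OF tn])
      finally have m2: "modular p t (P' \<inter> R) \<le> ennreal (2 ^ n)" .
      have "modular p t P' = (\<integral>\<^sup>+ x. ennreal (t powr - p x) * indicator (P' - R) x + ennreal (t powr - p x) * indicator (P' \<inter> R) x \<partial>lebesgue)"
        unfolding modular_def by (intro nn_integral_cong) (auto simp: indicator_def)
      also have "\<dots> = modular p t (P' - R) + modular p t (P' \<inter> R)"
      proof -
        have [measurable]: "P' \<in> sets lebesgue" "R \<in> sets lebesgue" using P' R .
        show ?thesis unfolding modular_def by (rule nn_integral_add) measurable
      qed
      also have "\<dots> \<le> ennreal (2 * c * E1) + ennreal (2 ^ n)" by (intro add_mono m1 m2)
      also have "\<dots> = ennreal (2 * c * E1 + 2 ^ n)" using c E1 by (intro ennreal_plus[symmetric]) auto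
      also have "\<dots> \<le> ennreal (Q * D powr (2 * b * log_slope))"
      proof (rule ennreal_leI)
        have "2 * c * E1 + 2 ^ n \<le> Q * 1" using Q by simp
        also have "\<dots> \<le> Q * D powr (2 * b * log_slope)" using Q D1 by (intro mult_left_mono) auto
        finally show "2 * c * E1 + 2 ^ n \<le> Q * D powr (2 * b * log_slope)" .
      qed
      finally show ?thesis .
    qed
  qed
  thus ?thesis using that Q(1) by blast
qed

definition \<kappa> :: nat where "\<kappa> = nat \<lceil>2 * b * log_slope / a\<rceil>"

text \<open>For \<open>t\<close> between the norm of the characteristic function of \<open>P\<close> and twice that norm, the modular of
  \<open>P\<close> is at most one and bounded below by \<open>2 powr - b\<close>, so \<open>modular_transfer\<close> applies; enlarging \<open>t\<close>
  by the factor \<open>K\<close> then makes the modular of \<open>P'\<close> at most one.  It matters that \<open>\<kappa>\<close> does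
  not depend on \<open>N\<close>: the order of decay, and with it the threshold for \<open>N\<close>, is chosen from it.\<close>

lemma Lp_norm_indicator_growth:
  assumes c: "c \<ge> 0"
  obtains Q where "Q \<ge> 1" "\<And>P P' s D. P \<in> sets lebesgue \<Longrightarrow> P' \<in> sets lebesgue \<Longrightarrow> 0 < s \<Longrightarrow>
    emeasure lebesgue P = ennreal (s ^ CARD('n)) \<Longrightarrow> emeasure lebesgue P' \<le> ennreal (c * s ^ CARD('n)) \<Longrightarrow>
    1 \<le> D \<Longrightarrow> (\<And>x y. x \<in> P \<Longrightarrow> y \<in> P' \<Longrightarrow> norm (x - y) \<le> s * D) \<Longrightarrow>
    Lp_norm p (indicat_real P') \<le> ennreal (Q * D ^ \<kappa>) * Lp_norm p (indicat_real P)"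
proof (rule modular_transfer[OF c], goal_cases)
  case (1 Q0)
  define Q where "Q = 2 * Q0 powr (1 / a)"
  have Q1: "Q \<ge> 1" unfolding Q_def using \<open>Q0 \<ge> 1\<close> a ge_one_powr_ge_zero[of Q0 "1 / a"] by simp
  show ?case
  proof (rule 1(1)[OF Q1])
    fix P P' :: "(real^'n) set" and s D :: real
    assume P: "P \<in> sets lebesgue" and P': "P' \<in> sets lebesgue" and s: "0 < s"
      and V: "emeasure lebesgue P = ennreal (s ^ CARD('n))" and V': "emeasure lebesgue P' \<le> ennreal (c * s ^ CARD('n))"
      and D: "1 \<le> D" and dist: "\<And>x y. x \<in> P \<Longrightarrow> y \<in> P' \<Longrightarrow> norm (x - y) \<le> s * D"
    let ?N = "Lp_norm p (indicat_real P)"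
    have fin: "?N < top" and pos: "0 < ?N"
      using Lp_norm_indicator_less_top[OF P V] Lp_norm_indicator_pos[OF P V] s by auto
    define \<nu> where "\<nu> = enn2real ?N"
    have N: "?N = ennreal \<nu>" and \<nu>: "0 < \<nu>"
      using fin pos by (auto simp: \<nu>_def enn2real_positive_iff)
    have "?N < ennreal (2 * \<nu>)" unfolding N using \<nu> by (intro ennreal_lessI) auto
    then obtain t where t: "0 < t" "modular p t P \<le> 1" "ennreal t < ennreal (2 * \<nu>)"
      unfolding Lp_norm_indicator[OF ppos] Inf_less_iff by auto
    have t2: "t < 2 * \<nu>" using t by (simp add: ennreal_less_iff)
    have low: "1 \<le> ennreal (2 powr b) * modular p t P"
    proof -
      have "\<not> modular p (1 / 2 * t) P \<le> 1"
      proof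
        assume "modular p (1 / 2 * t) P \<le> 1"
        hence "?N \<le> ennreal (1 / 2 * t)" unfolding Lp_norm_indicator[OF ppos] using t by (intro Inf_lower) auto
        thus False using t2 t \<nu> unfolding N by (simp add: ennreal_le_iff)
      qed
      hence "1 \<le> modular p (1 / 2 * t) P" by simp
      also have "\<dots> \<le> ennreal (2 powr b) * modular p t P"
      proof (rule modular_scale[OF p P])
        fix x
        have "(1 / 2) powr - p x = (2::real) powr p x" by (simp add: powr_minus powr_divide)
        also have "\<dots> \<le> 2 powr b" using pb[of x] by (intro powr_mono) auto
        finally show "(1 / 2) powr - p x \<le> 2 powr b" .
      qed (use t in auto)
      finally show ?thesis .
    qed
    define M where "M = Q0 * D powr (2 * b * log_slope)"
    have M: "1 \<le> M"
    proof -
      have "1 \<le> D powr (2 * b * log_slope)" using D b log_slope(1) by (intro ge_one_powr_ge_zero) auto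
      hence "1 * 1 \<le> M" unfolding M_def using \<open>Q0 \<ge> 1\<close> by (intro mult_mono) auto
      thus ?thesis by simp
    qed
    have mod: "modular p t P' \<le> ennreal M"
      unfolding M_def by (rule 1(3)[OF P P' s V V' D dist t(1,2) low])
    define K where "K = M powr (1 / a)"
    have K: "K \<ge> 1" unfolding K_def using M a by (intro ge_one_powr_ge_zero) auto
    have "modular p (K * t) P' \<le> ennreal (inverse M) * modular p t P'"
    proof (rule modular_scale[OF p P' t(1)])
      fix x
      have "K powr - p x \<le> K powr - a" using K ap[of x] by (intro powr_mono) auto
      also have "\<dots> = inverse M" unfolding K_def using M a by (simp add: powr_powr powr_minus)
      finally show "K powr - p x \<le> inverse M" .
    qed (use K in simp)
    also have "\<dots> \<le> ennreal (inverse M) * ennreal M" by (intro mult_left_mono mod) simp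
    also have "\<dots> = 1" using M by (simp flip: ennreal_mult)
    finally have "modular p (K * t) P' \<le> 1" .
    hence "Lp_norm p (indicat_real P') \<le> ennreal (K * t)"
      unfolding Lp_norm_indicator[OF ppos] using K t by (intro Inf_lower) auto
    also have "\<dots> \<le> ennreal (Q * D ^ \<kappa> * \<nu>)"
    proof (rule ennreal_leI)
      have "K = Q0 powr (1 / a) * D powr (2 * b * log_slope / a)"
        unfolding K_def M_def using D \<open>Q0 \<ge> 1\<close> by (simp add: powr_mult powr_powr)
      also have "\<dots> \<le> Q0 powr (1 / a) * D ^ \<kappa>"
      proof (rule mult_left_mono)
        have "2 * b * log_slope / a \<le> real \<kappa>" unfolding \<kappa>_def by linarith
        hence "D powr (2 * b * log_slope / a) \<le> D powr real \<kappa>" using D by (intro powr_mono) auto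
        thus "D powr (2 * b * log_slope / a) \<le> D ^ \<kappa>" using D by (simp add: powr_realpow)
      qed simp
      finally have "K * t \<le> (Q0 powr (1 / a) * D ^ \<kappa>) * (2 * \<nu>)"
        using t t2 D \<nu> by (intro mult_mono) auto
      thus "K * t \<le> Q * D ^ \<kappa> * \<nu>" by (simp add: Q_def mult_ac)
    qed
    also have "\<dots> = ennreal (Q * D ^ \<kappa>) * ?N"
      unfolding N using Q1 D \<nu> by (simp add: ennreal_mult)
    finally show "Lp_norm p (indicat_real P') \<le> ennreal (Q * D ^ \<kappa>) * ?N" .
  qed
qed

end

lemma exponentI:
  fixes p :: "real^'n \<Rightarrow> real"
  assumes "p \<in> borel_measurable lebesgue" "log_hoelder p" "0 < p_minus p" "p_plus p < \<infinity>"
  obtains a b H where "exponent p a b H"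
proof -
  obtain a where a: "0 < ereal a" "ereal a < p_minus p" using ereal_dense2[OF assms(3)] by auto
  have ap: "a \<le> p x" for x
  proof -
    have "ereal a \<le> ereal (p x)" using a unfolding p_minus_def by (meson INF_lower UNIV_I less_imp_le order_trans)
    thus ?thesis by simp
  qed
  obtain b where b: "p_plus p < ereal b" using ereal_dense2[OF assms(4)] by auto
  have pb: "p x \<le> b" for x
  proof -
    have "ereal (p x) \<le> ereal b" using b unfolding p_plus_def by (meson SUP_upper UNIV_I less_imp_le order_trans)
    thus ?thesis by simp
  qed
  obtain H where H: "H > 0" "\<And>x y. 0 < norm (x - y) \<and> norm (x - y) \<le> 1/2 \<Longrightarrow> \<bar>p x - p y\<bar> \<le> H / (- ln (norm (x - y)))"
    "\<And>x y. norm y \<ge> norm x \<Longrightarrow> \<bar>p x - p y\<bar> \<le> H / ln (exp 1 + norm x)"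
    using assms(2) unfolding log_hoelder_def by blast
  have "exponent p a b H"
    by unfold_locales (use assms(1) a ap pb H in auto)
  thus ?thesis by (rule that)
qed

section \<open>Sums over dyadic cubes\<close>

abbreviation nsum :: "('a \<Rightarrow> ennreal) \<Rightarrow> ennreal" where
  "nsum f \<equiv> integral\<^sup>N (count_space UNIV) f"

text \<open>Sums are handled as integrals over counting measure, for which Tonelli's theorem is available.
  Countability lets the index set be exhausted by an increasing sequence of finite sets.\<close>

lemma infsum_eq_nsum:
  fixes f :: "'a::countable \<Rightarrow> ennreal"
  shows "infsum f A = nsum (\<lambda>x. f x * indicator A x)"
proof (rule antisym)
  have S: "infsum f A = (SUP F\<in>{F. finite F \<and> F \<subseteq> A}. sum f F)"
    by (rule nonneg_infsum_complete) simp
  show "infsum f A \<le> nsum (\<lambda>x. f x * indicator A x)"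
    unfolding S
  proof (rule SUP_least, clarify)
    fix F assume F: "finite F" "F \<subseteq> A"
    have "sum f F = (\<integral>\<^sup>+x. f x \<partial>count_space F)" using F by (simp add: nn_integral_count_space_finite)
    also have "\<dots> = nsum (\<lambda>x. f x * indicator F x)" by (rule nn_integral_count_space_indicator) simp
    also have "\<dots> \<le> nsum (\<lambda>x. f x * indicator A x)"
      using F by (intro nn_integral_mono mult_left_mono) (auto simp: indicator_def)
    finally show "sum f F \<le> nsum (\<lambda>x. f x * indicator A x)" .
  qed
  define F where "F k = {x \<in> A. to_nat x < k}" for k
  have fin: "finite (F k)" for k
  proof (rule finite_imageD)
    show "finite (to_nat ` F k)" by (rule finite_subset[of _ "{..<k}"]) (auto simp: F_def)
    show "inj_on to_nat (F k)" using inj_to_nat by (rule inj_on_subset) simp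
  qed
  have "nsum (\<lambda>x. f x * indicator A x) = nsum (\<lambda>x. SUP k. f x * indicator (F k) x)"
  proof (rule nn_integral_cong)
    fix x
    show "f x * indicator A x = (SUP k. f x * indicator (F k) x)"
    proof (rule antisym)
      have "f x * indicator A x = f x * indicator (F (Suc (to_nat x))) x"
        by (auto simp: F_def indicator_def)
      also have "\<dots> \<le> (SUP k. f x * indicator (F k) x)" by (rule SUP_upper) simp
      finally show "f x * indicator A x \<le> (SUP k. f x * indicator (F k) x)" .
      show "(SUP k. f x * indicator (F k) x) \<le> f x * indicator A x"
        by (intro SUP_least mult_left_mono) (auto simp: F_def indicator_def)
    qed
  qed
  also have "\<dots> = (SUP k. nsum (\<lambda>x. f x * indicator (F k) x))"
    by (rule nn_integral_monotone_convergence_SUP)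
      (auto simp: incseq_def le_fun_def F_def indicator_def)
  also have "\<dots> \<le> infsum f A"
  proof (rule SUP_least)
    fix k
    have "nsum (\<lambda>x. f x * indicator (F k) x) = (\<integral>\<^sup>+x. f x \<partial>count_space (F k))"
      by (rule nn_integral_count_space_indicator[symmetric]) simp
    also have "\<dots> = sum f (F k)" by (rule nn_integral_count_space_finite) (rule fin)
    also have "\<dots> \<le> infsum f A"
      unfolding S using fin by (intro SUP_upper) (auto simp: F_def)
    finally show "nsum (\<lambda>x. f x * indicator (F k) x) \<le> infsum f A" .
  qed
  finally show "nsum (\<lambda>x. f x * indicator A x) \<le> infsum f A" .
qed

lemma nsum_swap: "nsum (\<lambda>x. nsum (\<lambda>y. f x y)) = nsum (\<lambda>y. nsum (\<lambda>x. f x y))"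
  using nn_integral_fst_count_space[of "\<lambda>(x, y). f x y"] nn_integral_snd_count_space[of "\<lambda>(x, y). f x y"] by simp

lemma nsum_point: "f x \<le> nsum f"
  by (rule nn_integral_ge_point) simp

lemma nsum_cmult: "nsum (\<lambda>x. c * f x) = c * nsum f"
  by (rule nn_integral_cmult) simp

lemma nsum_multc: "nsum (\<lambda>x. f x * c) = nsum f * c"
  by (rule nn_integral_multc) simp

lemma nsum_sum: "nsum (\<lambda>x. \<Sum>m\<in>F. f m x) = (\<Sum>m\<in>F. nsum (f m))"
  by (rule nn_integral_sum) simp

lemma nsum_shift: "nsum (\<lambda>j::int. f (j + m)) = nsum f"
proof -
  have "bij_betw (\<lambda>j::int. j + m) UNIV UNIV"
    by (rule bij_betw_byWitness[where f'="\<lambda>j. j - m"]) auto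
  from nn_integral_bij_count_space[OF this, of f] show ?thesis .
qed

definition vol :: "nat \<Rightarrow> int \<Rightarrow> 'n itself \<Rightarrow> real" where
  "vol N j _ = (2 powi (- j - int N)) ^ CARD('n)"

lemma vol_pos: "0 < vol N j TYPE('n::finite)"
  by (simp add: vol_def)

lemma dyadic_cube_borel[measurable]: "dyadic_cube N j (k::int^'n) \<in> sets borel"
proof -
  have "dyadic_cube N j k = (\<Inter>i\<in>UNIV. {x. 2 powi (- j - int N) * of_int (k $ i) \<le> x $ i} \<inter>
      {x. x $ i < 2 powi (- j - int N) * (of_int (k $ i) + 1)})"
    by (auto simp: dyadic_cube_def)
  also have "\<dots> \<in> sets borel"
    by (intro sets.finite_INT borel_closed borel_open sets.Int closed_Collect_le open_Collect_less continuous_intros) auto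
  finally show ?thesis .
qed

lemma emeasure_dyadic_cube:
  "emeasure lborel (dyadic_cube N j (k::int^'n)) = ennreal (vol N j TYPE('n))"
proof -
  define s :: real where "s = 2 powi (- j - int N)"
  have s: "s > 0" by (simp add: s_def)
  define l where "l = corner N j k"
  define u where "u = l + (\<chi> i. s)"
  have c: "l $ i = s * of_int (k $ i)" "u $ i = s * (of_int (k $ i) + 1)" for i
    by (simp_all add: l_def u_def corner_def s_def algebra_simps)
  have *: "(u - l) \<bullet> b = s" "l \<bullet> b \<le> u \<bullet> b" if "b \<in> Basis" for b
    using that s by (auto simp: Basis_vec_def inner_axis u_def)
  have v: "(\<Prod>b\<in>Basis. (u - l) \<bullet> b) = s ^ CARD('n)" using *(1) by simp
  have sub: "box l u \<subseteq> dyadic_cube N j k" "dyadic_cube N j k \<subseteq> cbox l u"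
    by (auto simp: dyadic_cube_def mem_box_cart c s_def[symmetric] less_imp_le)
  have "emeasure lborel (box l u) = ennreal (s ^ CARD('n))" "emeasure lborel (cbox l u) = ennreal (s ^ CARD('n))"
    using *(2) v by (simp_all add: emeasure_lborel_box_eq emeasure_lborel_cbox_eq)
  moreover have "emeasure lborel (box l u) \<le> emeasure lborel (dyadic_cube N j k)"
    "emeasure lborel (dyadic_cube N j k) \<le> emeasure lborel (cbox l u)"
    by (intro emeasure_mono sub; simp)+
  ultimately show ?thesis by (simp add: vol_def s_def[symmetric])
qed

lemma dyadic_cube_unique:
  assumes "x \<in> dyadic_cube N j k" "x \<in> dyadic_cube N j l" shows "k = l"
proof -
  define s :: real where "s = 2 powi (- j - int N)"
  have s: "s > 0" by (simp add: s_def)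
  have "k $ i = l $ i" for i
  proof -
    have "s * of_int (k $ i) \<le> x $ i" "x $ i < s * (of_int (k $ i) + 1)"
      "s * of_int (l $ i) \<le> x $ i" "x $ i < s * (of_int (l $ i) + 1)"
      using assms unfolding dyadic_cube_def s_def by blast+
    hence "s * of_int (k $ i) < s * (of_int (l $ i) + 1)" "s * of_int (l $ i) < s * (of_int (k $ i) + 1)"
      by linarith+
    hence "real_of_int (k $ i) < of_int (l $ i) + 1" "real_of_int (l $ i) < of_int (k $ i) + 1"
      using s by (auto simp: mult_less_cancel_left_pos)
    thus ?thesis by linarith
  qed
  thus ?thesis by (simp add: vec_eq_iff)
qed

lemma dyadic_cube_nested:
  assumes "i \<le> j" shows "\<exists>\<nu>. dyadic_cube N j (l::int^'n) \<subseteq> dyadic_cube N i \<nu>"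
proof -
  define s :: real where "s = 2 powi (- j - int N)"
  have s: "s > 0" by (simp add: s_def)
  define q :: int where "q = 2 ^ nat (j - i)"
  have q: "q > 0" by (simp add: q_def)
  have si: "2 powi (- i - int N) = s * of_int q"
  proof -
    have "real_of_int q = 2 powi (j - i)" using assms by (simp add: q_def power_int_def)
    moreover have "(2::real) powi (- j - int N) * 2 powi (j - i) = 2 powi (- i - int N)"
    proof -
      have "- j - int N + (j - i) = - i - int N" by linarith
      thus ?thesis using power_int_add[of "2::real" "- j - int N" "j - i"] by (simp only:) simp
    qed
    ultimately show ?thesis by (simp only: s_def)
  qed
  define \<nu> :: "int^'n" where "\<nu> = (\<chi> t. l $ t div q)"
  have "dyadic_cube N j l \<subseteq> dyadic_cube N i \<nu>"
  proof
    fix x assume x: "x \<in> dyadic_cube N j l"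
    have "s * of_int q * of_int (\<nu> $ t) \<le> x $ t \<and> x $ t < s * of_int q * (of_int (\<nu> $ t) + 1)" for t
    proof -
      have xs: "s * of_int (l $ t) \<le> x $ t" "x $ t < s * (of_int (l $ t) + 1)"
        using x unfolding dyadic_cube_def s_def by blast+
      have e: "q * (l $ t div q + 1) = q * (l $ t div q) + q" by (simp add: distrib_left)
      have "q * (l $ t div q) \<le> l $ t" "l $ t + 1 \<le> q * (l $ t div q + 1)"
        unfolding e
        using mult_div_mod_eq[of q "l $ t"] pos_mod_bound[OF q, of "l $ t"] pos_mod_sign[OF q, of "l $ t"]
        by linarith+
      hence "real_of_int (q * (l $ t div q)) \<le> of_int (l $ t)" "real_of_int (l $ t + 1) \<le> of_int (q * (l $ t div q + 1))"
        by (simp_all only: of_int_le_iff)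
      hence "s * real_of_int (q * (l $ t div q)) \<le> s * of_int (l $ t)" "s * real_of_int (l $ t + 1) \<le> s * of_int (q * (l $ t div q + 1))"
        using s by (simp_all only: mult_le_cancel_left_pos)
      with xs show ?thesis by (simp add: \<nu>_def mult.assoc)
    qed
    thus "x \<in> dyadic_cube N i \<nu>" unfolding dyadic_cube_def si by simp
  qed
  thus ?thesis by blast
qed

text \<open>On each cube the weight is comparable to its value at the corner; the cubes are disjoint, so the sum
  is dominated by the integral of the weight.\<close>

lemma weight_corner_sum:
  obtains C where "C \<ge> 0" "\<And>y::real^'n. nsum (\<lambda>k. ennreal (weight (corner N 0 k - y))) \<le> ennreal C"
proof -
  define n where "n = CARD('n)"
  define V where "V = vol N 0 TYPE('n)"
  have V: "V > 0" unfolding V_def by (rule vol_pos)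
  define W where "W = (LINT w|lborel. weight (w::real^'n))"
  have W0: "W \<ge> 0" unfolding W_def by (simp add: weight_nonneg)
  define B where "B = (1 + real n) ^ (2 * n)"
  have B: "B \<ge> 0" by (simp add: B_def)
  have "nsum (\<lambda>k. ennreal (weight (corner N 0 k - y))) \<le> ennreal (B * W / V)" for y :: "real^'n"
  proof -
    have wm[measurable]: "(\<lambda>w::real^'n. ennreal (weight (w - y))) \<in> borel_measurable borel" by measurable
    have pt: "ennreal (weight (corner N 0 k - y)) * ennreal V \<le>
        ennreal B * (\<integral>\<^sup>+w. ennreal (weight (w - y)) * indicator (dyadic_cube N 0 k) w \<partial>lborel)" for k
    proof -
      have "weight (corner N 0 k - y) \<le> B * weight (w - y)" if w: "w \<in> dyadic_cube N 0 k" for w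
      proof -
        have "2 powi (- 0 - int N) \<le> (1::real)" by (simp add: power_int_minus field_simps)
        hence "real n * 2 powi (- 0 - int N) \<le> real n * 1" by (intro mult_left_mono) auto
        hence d: "norm (w - corner N 0 k) \<le> real n"
          using dist_corner[OF w] unfolding n_def by linarith
        have "1 + norm (w - y) \<le> (1 + norm (w - corner N 0 k)) * (1 + norm (corner N 0 k - y))"
          using one_plus_norm_add[of "w - corner N 0 k" "corner N 0 k - y"] by simp
        also have "\<dots> \<le> (1 + real n) * (1 + norm (corner N 0 k - y))" using d by (intro mult_right_mono) auto
        finally have "(1 + norm (w - y)) ^ (2 * n) \<le> ((1 + real n) * (1 + norm (corner N 0 k - y))) ^ (2 * n)"
          by (intro power_mono) auto
        hence le: "(1 + norm (w - y)) ^ (2 * n) \<le> B * (1 + norm (corner N 0 k - y)) ^ (2 * n)"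
          by (simp only: power_mult_distrib B_def)
        have p1: "0 < (1 + norm (w - y)) ^ (2 * n)" "0 < (1 + norm (corner N 0 k - y)) ^ (2 * n)"
          by (intro zero_less_power add_pos_nonneg; simp)+
        have "inverse (B * (1 + norm (corner N 0 k - y)) ^ (2 * n)) \<le> inverse ((1 + norm (w - y)) ^ (2 * n))"
          by (rule le_imp_inverse_le[OF le p1(1)])
        hence "B * inverse (B * (1 + norm (corner N 0 k - y)) ^ (2 * n)) \<le> B * inverse ((1 + norm (w - y)) ^ (2 * n))"
          using B by (rule mult_left_mono)
        moreover have "B \<noteq> 0" by (simp add: B_def add_nonneg_eq_0_iff)
        hence "B * inverse (B * (1 + norm (corner N 0 k - y)) ^ (2 * n)) = inverse ((1 + norm (corner N 0 k - y)) ^ (2 * n))"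
          by (simp add: field_simps)
        ultimately show ?thesis unfolding weight_def n_def[symmetric] by (simp only:)
      qed
      hence "(\<integral>\<^sup>+w. ennreal (weight (corner N 0 k - y)) * indicator (dyadic_cube N 0 k) w \<partial>lborel) \<le>
          (\<integral>\<^sup>+w. ennreal B * (ennreal (weight (w - y)) * indicator (dyadic_cube N 0 k) w) \<partial>lborel)"
        using B by (intro nn_integral_mono) (auto simp: indicator_def ennreal_mult[symmetric] weight_nonneg intro!: ennreal_leI)
      also have "\<dots> = ennreal B * (\<integral>\<^sup>+w. ennreal (weight (w - y)) * indicator (dyadic_cube N 0 k) w \<partial>lborel)"
        by (rule nn_integral_cmult) measurable
      finally show ?thesis by (simp add: nn_integral_cmult_indicator emeasure_dyadic_cube V_def)
    qed
    have "nsum (\<lambda>k. ennreal (weight (corner N 0 k - y))) * ennreal V =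
        nsum (\<lambda>k. ennreal (weight (corner N 0 k - y)) * ennreal V)" by (rule nsum_multc[symmetric])
    also have "\<dots> \<le> nsum (\<lambda>k. ennreal B * (\<integral>\<^sup>+w. ennreal (weight (w - y)) * indicator (dyadic_cube N 0 k) w \<partial>lborel))"
      by (intro nn_integral_mono pt)
    also have "\<dots> = ennreal B * nsum (\<lambda>k. \<integral>\<^sup>+w. ennreal (weight (w - y)) * indicator (dyadic_cube N 0 k) w \<partial>lborel)"
      by (rule nsum_cmult)
    also have "nsum (\<lambda>k. \<integral>\<^sup>+w. ennreal (weight (w - y)) * indicator (dyadic_cube N 0 k) w \<partial>lborel) =
        (\<integral>\<^sup>+w. nsum (\<lambda>k. ennreal (weight (w - y)) * indicator (dyadic_cube N 0 k) w) \<partial>lborel)"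
      by (rule nn_integral_count_space_nn_integral[symmetric]) (auto, measurable)
    also have "\<dots> = (\<integral>\<^sup>+w. ennreal (weight (w - y)) \<partial>lborel)"
    proof (rule nn_integral_cong)
      fix w :: "real^'n"
      obtain k0 where k0: "w \<in> dyadic_cube N 0 k0" using dyadic_cube_cover by blast
      have "indicator (dyadic_cube N 0 k) w = (indicator {k0} k :: ennreal)" for k
      proof -
        have "w \<in> dyadic_cube N 0 k \<longleftrightarrow> k = k0" using k0 dyadic_cube_unique by metis
        thus ?thesis by (simp add: indicator_def)
      qed
      thus "nsum (\<lambda>k. ennreal (weight (w - y)) * indicator (dyadic_cube N 0 k) w) = ennreal (weight (w - y))"
        by (simp add: nn_integral_cmult_indicator)
    qed
    also have "\<dots> = ennreal (LINT w|lborel. weight (w - y))"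
      using integral_affine(1)[of 1 weight "- y"] integrable_weight[where 'n='n]
      by (intro nn_integral_eq_integral) (auto simp: weight_nonneg)
    also have "(LINT w|lborel. weight (w - y)) = W"
      using integral_affine(2)[of 1 weight "- y"] by (simp add: W_def)
    finally have "nsum (\<lambda>k. ennreal (weight (corner N 0 k - y))) * ennreal V \<le> ennreal (B * W)"
      using B W0 by (simp add: ennreal_mult)
    hence "nsum (\<lambda>k. ennreal (weight (corner N 0 k - y))) * ennreal V * ennreal (1 / V) \<le> ennreal (B * W) * ennreal (1 / V)"
      by (rule mult_right_mono) simp
    moreover have "ennreal V * ennreal (1 / V) = 1" using V by (simp flip: ennreal_mult)
    moreover have "ennreal (B * W) * ennreal (1 / V) = ennreal (B * W / V)" using B W0 V by (simp flip: ennreal_mult)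
    ultimately show ?thesis by (simp add: mult.assoc)
  qed
  moreover have "0 \<le> B * W / V" using B W0 V by simp
  ultimately show ?thesis by (rule that[rotated])
qed

lemma weight_level: "inverse ((1 + 2 powi j * norm (corner N j k - y)) ^ (2 * CARD('n))) =
    weight (corner N 0 k - (2 powi j) *\<^sub>R (y::real^'n))"
proof -
  have "corner N 0 k - (2 powi j) *\<^sub>R y = (2 powi j) *\<^sub>R (corner N j k - y)"
    unfolding corner_scale[of N k j] by (simp add: scaleR_right_diff_distrib)
  thus ?thesis by (simp add: weight_def)
qed

lemma vol_level:
  assumes "m \<in> {-2..2}" shows "vol N j TYPE('n::finite) \<le> 4 ^ CARD('n) * vol N (j + m) TYPE('n)"
proof -
  have "(2::real) powi m \<le> 2 powi 2" using assms by (intro power_int_increasing) auto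
  hence le: "2 powi m * (2::real) powi (- (j + m) - int N) \<le> 4 * 2 powi (- (j + m) - int N)"
    by (intro mult_right_mono) auto
  have eq: "2 powi m * (2::real) powi (- (j + m) - int N) = 2 powi (- j - int N)"
  proof -
    have "m + (- (j + m) - int N) = - j - int N" by linarith
    thus ?thesis using power_int_add[of "2::real" m "- (j + m) - int N"] by (simp only:) simp
  qed
  have "2 powi (- j - int N) \<le> 4 * (2::real) powi (- (j + m) - int N)" by (rule le[unfolded eq])
  from power_mono[OF this, of "CARD('n)"] show ?thesis
    unfolding vol_def power_mult_distrib by simp
qed

text \<open>Two subcubes are, relative to their own size, at least as far apart as the cubes that contain them.\<close>

lemma corner_separation:
  fixes k l \<mu> \<nu> :: "int^'n"
  assumes m: "m \<in> {-2..2}" and ij: "i \<le> j"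
    and k: "dyadic_cube N j k \<subseteq> dyadic_cube N i \<mu>" and l: "dyadic_cube N (j + m) l \<subseteq> dyadic_cube N (i + m) \<nu>"
  shows "1 + 2 powi i * norm (corner N (i + m) \<nu> - corner N i \<mu>) \<le>
    (1 + 5 * real CARD('n)) * (1 + 2 powi j * norm (corner N (j + m) l - corner N j k))"
proof -
  define n where "n = CARD('n)"
  have near: "2 powi i * norm (x - corner N (i + r) \<theta>) \<le> 4 * real n"
    if x: "x \<in> dyadic_cube N (i + r) \<theta>" and r: "r \<in> {-2..2}" for x r and \<theta> :: "int^'n"
  proof -
    have "2 powi i * norm (x - corner N (i + r) \<theta>) \<le> 2 powi i * (real n * 2 powi (- (i + r) - int N))"
      unfolding n_def by (intro mult_left_mono dist_corner x) simp
    also have "\<dots> = real n * (2 powi i * 2 powi (- (i + r) - int N))" by simp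
    also have "2 powi i * (2::real) powi (- (i + r) - int N) = 2 powi (- r - int N)"
    proof -
      have "i + (- (i + r) - int N) = - r - int N" by linarith
      thus ?thesis using power_int_add[of "2::real" i "- (i + r) - int N"] by (simp only:) simp
    qed
    also have "real n * 2 powi (- r - int N) \<le> real n * 2 powi 2"
      using r by (intro mult_left_mono power_int_increasing) auto
    finally show ?thesis by simp
  qed
  have near0: "2 powi i * norm (x - corner N i \<mu>) \<le> real n" if x: "x \<in> dyadic_cube N i \<mu>" for x
  proof -
    have "2 powi i * norm (x - corner N i \<mu>) \<le> 2 powi i * (real n * 2 powi (- i - int N))"
      unfolding n_def by (intro mult_left_mono dist_corner x) simp
    also have "\<dots> = real n * (2 powi i * 2 powi (- i - int N))" by simp
    also have "2 powi i * (2::real) powi (- i - int N) = 2 powi (- int N)"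
    proof -
      have "i + (- i - int N) = - int N" by linarith
      thus ?thesis using power_int_add[of "2::real" i "- i - int N"] by (simp only:) simp
    qed
    also have "real n * 2 powi (- int N) \<le> real n * 2 powi 0"
      by (intro mult_left_mono power_int_increasing) auto
    finally show ?thesis by simp
  qed
  have t: "norm (corner N (i + m) \<nu> - corner N i \<mu>) \<le> norm (corner N (j + m) l - corner N (i + m) \<nu>) +
      (norm (corner N (j + m) l - corner N j k) + norm (corner N j k - corner N i \<mu>))"
  proof -
    have "corner N (i + m) \<nu> - corner N i \<mu> = - (corner N (j + m) l - corner N (i + m) \<nu>) +
        ((corner N (j + m) l - corner N j k) + (corner N j k - corner N i \<mu>))" by simp
    also have "norm \<dots> \<le> norm (- (corner N (j + m) l - corner N (i + m) \<nu>)) +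
        norm ((corner N (j + m) l - corner N j k) + (corner N j k - corner N i \<mu>))" by (rule norm_triangle_ineq)
    also have "\<dots> \<le> norm (corner N (j + m) l - corner N (i + m) \<nu>) +
        (norm (corner N (j + m) l - corner N j k) + norm (corner N j k - corner N i \<mu>))"
      unfolding norm_minus_cancel by (intro add_left_mono norm_triangle_ineq)
    finally show ?thesis .
  qed
  have "2 powi i * norm (corner N (i + m) \<nu> - corner N i \<mu>) \<le> 2 powi i * (norm (corner N (j + m) l - corner N (i + m) \<nu>) +
      (norm (corner N (j + m) l - corner N j k) + norm (corner N j k - corner N i \<mu>)))"
    by (rule mult_left_mono[OF t]) simp
  also have "\<dots> = 2 powi i * norm (corner N (j + m) l - corner N (i + m) \<nu>) +
      (2 powi i * norm (corner N (j + m) l - corner N j k) + 2 powi i * norm (corner N j k - corner N i \<mu>))"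
    by (simp add: distrib_left)
  also have "\<dots> \<le> 4 * real n + (2 powi j * norm (corner N (j + m) l - corner N j k) + real n)"
  proof (intro add_mono)
    show "2 powi i * norm (corner N (j + m) l - corner N (i + m) \<nu>) \<le> 4 * real n"
      by (rule near[OF subsetD[OF l corner_in_cube] m])
    show "2 powi i * norm (corner N j k - corner N i \<mu>) \<le> real n"
      by (rule near0[OF subsetD[OF k corner_in_cube]])
    show "2 powi i * norm (corner N (j + m) l - corner N j k) \<le> 2 powi j * norm (corner N (j + m) l - corner N j k)"
      using ij by (intro mult_right_mono power_int_increasing) auto
  qed
  finally have "1 + 2 powi i * norm (corner N (i + m) \<nu> - corner N i \<mu>) \<le>
      1 + 5 * real n + 2 powi j * norm (corner N (j + m) l - corner N j k)" by simp
  also have "\<dots> \<le> (1 + 5 * real n) * (1 + 2 powi j * norm (corner N (j + m) l - corner N j k))"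
    by (simp add: algebra_simps)
  finally show ?thesis by (simp add: n_def)
qed

text \<open>The double sum in the Carleson expression of the cube with indices \<open>i\<close>, \<open>\<mu>\<close>.\<close>

definition subtotal :: "nat \<Rightarrow> (int \<Rightarrow> int^'n \<Rightarrow> ennreal) \<Rightarrow> int \<Rightarrow> int^'n \<Rightarrow> ennreal" where
  "subtotal N a i \<mu> = nsum (\<lambda>j. nsum (\<lambda>k. (a j k)\<^sup>2 * ennreal (vol N j TYPE('n)) *
     indicator {k. dyadic_cube N j k \<subseteq> dyadic_cube N i \<mu>} k) * indicator {i..} j)"

text \<open>Negative powers of this quantity measure the decay between two cubes; the unit of length is that of
  the first one.\<close>

definition decay :: "nat \<Rightarrow> int \<Rightarrow> int^'n \<Rightarrow> int \<Rightarrow> int^'n \<Rightarrow> real" where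
  "decay N j k j' l = 1 + 2 powi j * norm (corner N j' l - corner N j k)"

lemma decay_ge1: "1 \<le> decay N j k j' l"
  by (simp add: decay_def)

lemma inverse_power_split:
  assumes "(1::real) \<le> u" shows "inverse (u ^ (p + q)) = inverse (u ^ p) * inverse (u ^ q)"
  by (simp add: power_add)

text \<open>The decay is split in two.  One part, of order \<open>2 * CARD('n)\<close>, makes the sum over the cubes \<open>k\<close>
  finite for each fixed \<open>l\<close>.  By \<open>corner_separation\<close> the remaining part is at most a multiple of the
  decay between the containing cubes \<open>\<mu>\<close> and \<open>\<nu>\<close>, and the sum over \<open>l\<close> is regrouped by \<open>\<nu>\<close>.\<close>

lemma subtotal_bound:
  fixes M :: "int set" and N \<kappa> :: nat
  assumes M: "M \<subseteq> {-2..2}"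
  obtains C1 where "C1 \<ge> 0" "\<And>a b i \<mu>. (\<And>j k. (a j k)\<^sup>2 \<le> ennreal C0 * (\<Sum>m\<in>M. nsum (\<lambda>l. (b (j + m) l)\<^sup>2 *
      ennreal (inverse (decay N j k (j + m) l ^ (2 * CARD('n) + (2 * CARD('n) + \<kappa>))))))) \<Longrightarrow>
    subtotal N a i (\<mu>::int^'n) \<le> ennreal C1 * (\<Sum>m\<in>M. nsum (\<lambda>\<nu>.
      ennreal (inverse (decay N i \<mu> (i + m) \<nu> ^ (2 * CARD('n) + \<kappa>))) * subtotal N b (i + m) \<nu>))"
proof -
  define n where "n = CARD('n)"
  let ?v = "\<lambda>j. ennreal (vol N j TYPE('n))"
  obtain Cw where Cw: "Cw \<ge> 0" "\<And>y::real^'n. nsum (\<lambda>k. ennreal (weight (corner N 0 k - y))) \<le> ennreal Cw"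
    using weight_corner_sum[of N, where 'n='n] by blast
  define q where "q = 2 * n + \<kappa>"
  define S where "S = (1 + 5 * real n) ^ q"
  have S: "S \<ge> 0" by (simp add: S_def)
  define C1 where "C1 = max C0 0 * (S * Cw * 4 ^ n)"
  have C1: "C1 \<ge> 0" unfolding C1_def using S Cw by simp
  have "subtotal N a i \<mu> \<le> ennreal C1 * (\<Sum>m\<in>M. nsum (\<lambda>\<nu>.
      ennreal (inverse (decay N i \<mu> (i + m) \<nu> ^ q)) * subtotal N b (i + m) \<nu>))"
    if hyp: "\<And>j k. (a j k)\<^sup>2 \<le> ennreal C0 * (\<Sum>m\<in>M. nsum (\<lambda>l. (b (j + m) l)\<^sup>2 *
      ennreal (inverse (decay N j k (j + m) l ^ (2 * n + q)))))" for a b i and \<mu> :: "int^'n"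
  proof -
    let ?J = "\<lambda>j i \<mu> k. indicator {k. dyadic_cube N j k \<subseteq> dyadic_cube N i \<mu>} (k::int^'n) :: ennreal"
    let ?w = "\<lambda>j k m l. ennreal (inverse (decay N j k (j + m) l ^ (2 * n + q)))"
    let ?om = "\<lambda>m \<nu>. ennreal (inverse (decay N i \<mu> (i + m) \<nu> ^ q))"
    have kernel: "nsum (\<lambda>k. ?w j k m l * ?J j i \<mu> k) \<le> ennreal (S * Cw) * ?om m \<nu>"
      if ij: "i \<le> j" and m: "m \<in> M" and l: "dyadic_cube N (j + m) l \<subseteq> dyadic_cube N (i + m) \<nu>" for j m l \<nu>
    proof -
      let ?y = "(2 powi j) *\<^sub>R corner N (j + m) l"
      have pt: "?w j k m l * ?J j i \<mu> k \<le> (ennreal S * ?om m \<nu>) * ennreal (weight (corner N 0 k - ?y))" for k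
      proof (cases "dyadic_cube N j k \<subseteq> dyadic_cube N i \<mu>")
        case True
        define u where "u = decay N j k (j + m) l"
        define o' where "o' = decay N i \<mu> (i + m) \<nu>"
        have u: "1 \<le> u" and o': "1 \<le> o'" by (simp_all add: u_def o'_def decay_ge1)
        have "o' \<le> (1 + 5 * real n) * u"
          unfolding u_def o'_def decay_def n_def by (rule corner_separation[OF subsetD[OF M m] ij True l])
        hence "o' ^ q \<le> S * u ^ q"
          unfolding S_def power_mult_distrib[symmetric] using o' by (intro power_mono) auto
        hence "inverse (u ^ q) \<le> S * inverse (o' ^ q)" using u o' by (simp add: field_simps)
        moreover have "inverse (u ^ (2 * n)) = weight (corner N 0 k - ?y)"
          unfolding u_def decay_def n_def using weight_level[of j N k "corner N (j + m) l"]
          by (simp add: norm_minus_commute)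
        ultimately have "inverse (u ^ (2 * n + q)) \<le> weight (corner N 0 k - ?y) * (S * inverse (o' ^ q))"
          unfolding inverse_power_split[OF u] by (simp only:) (intro mult_left_mono, auto simp: weight_nonneg)
        hence "ennreal (inverse (u ^ (2 * n + q))) \<le> ennreal (S * inverse (o' ^ q) * weight (corner N 0 k - ?y))"
          by (intro ennreal_leI) (simp add: mult_ac)
        also have "\<dots> = (ennreal S * ennreal (inverse (o' ^ q))) * ennreal (weight (corner N 0 k - ?y))"
          using S o' by (simp add: ennreal_mult weight_nonneg)
        finally show ?thesis using True by (simp add: u_def o'_def)
      qed simp
      have "nsum (\<lambda>k. ?w j k m l * ?J j i \<mu> k) \<le> nsum (\<lambda>k. (ennreal S * ?om m \<nu>) * ennreal (weight (corner N 0 k - ?y)))"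
        by (intro nn_integral_mono pt)
      also have "\<dots> = (ennreal S * ?om m \<nu>) * nsum (\<lambda>k. ennreal (weight (corner N 0 k - ?y)))" by (rule nsum_cmult)
      also have "\<dots> \<le> (ennreal S * ?om m \<nu>) * ennreal Cw" by (intro mult_left_mono Cw) simp
      also have "\<dots> = ennreal (S * Cw) * ?om m \<nu>" using S Cw by (simp add: ennreal_mult mult_ac)
      finally show ?thesis .
    qed
    have level: "nsum (\<lambda>k. (a j k)\<^sup>2 * ?v j * ?J j i \<mu> k) \<le>
        ennreal C1 * (\<Sum>m\<in>M. nsum (\<lambda>\<nu>. ?om m \<nu> * nsum (\<lambda>l. (b (j + m) l)\<^sup>2 * ?v (j + m) * ?J (j + m) (i + m) \<nu> l)))"
      if ij: "i \<le> j" for j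
    proof -
      have "nsum (\<lambda>k. (a j k)\<^sup>2 * ?v j * ?J j i \<mu> k) \<le>
          nsum (\<lambda>k. (ennreal C0 * (\<Sum>m\<in>M. nsum (\<lambda>l. (b (j + m) l)\<^sup>2 * ?w j k m l))) * ?v j * ?J j i \<mu> k)"
        by (intro nn_integral_mono mult_right_mono hyp) auto
      also have "\<dots> = nsum (\<lambda>k. ennreal C0 * (\<Sum>m\<in>M. nsum (\<lambda>l. (b (j + m) l)\<^sup>2 * ?v j * (?w j k m l * ?J j i \<mu> k))))"
      proof (rule nn_integral_cong)
        fix k
        have "(\<Sum>m\<in>M. nsum (\<lambda>l. (b (j + m) l)\<^sup>2 * ?w j k m l)) * (?v j * ?J j i \<mu> k) =
            (\<Sum>m\<in>M. nsum (\<lambda>l. (b (j + m) l)\<^sup>2 * ?w j k m l * (?v j * ?J j i \<mu> k)))"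
          unfolding nsum_multc by (rule sum_distrib_right)
        also have "\<dots> = (\<Sum>m\<in>M. nsum (\<lambda>l. (b (j + m) l)\<^sup>2 * ?v j * (?w j k m l * ?J j i \<mu> k)))"
          by (simp only: mult_ac)
        finally show "(ennreal C0 * (\<Sum>m\<in>M. nsum (\<lambda>l. (b (j + m) l)\<^sup>2 * ?w j k m l))) * ?v j * ?J j i \<mu> k =
            ennreal C0 * (\<Sum>m\<in>M. nsum (\<lambda>l. (b (j + m) l)\<^sup>2 * ?v j * (?w j k m l * ?J j i \<mu> k)))"
          by (simp only: mult.assoc)
      qed
      also have "\<dots> = ennreal C0 * (\<Sum>m\<in>M. nsum (\<lambda>k. nsum (\<lambda>l. (b (j + m) l)\<^sup>2 * ?v j * (?w j k m l * ?J j i \<mu> k))))"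
        unfolding nsum_cmult nsum_sum ..
      also have "\<dots> = ennreal C0 * (\<Sum>m\<in>M. nsum (\<lambda>l. (b (j + m) l)\<^sup>2 * ?v j * nsum (\<lambda>k. ?w j k m l * ?J j i \<mu> k)))"
        by (subst nsum_swap) (simp only: nsum_cmult)
      also have "\<dots> \<le> ennreal C0 * (\<Sum>m\<in>M. ennreal (S * Cw * 4 ^ n) *
          nsum (\<lambda>\<nu>. ?om m \<nu> * nsum (\<lambda>l. (b (j + m) l)\<^sup>2 * ?v (j + m) * ?J (j + m) (i + m) \<nu> l)))"
      proof (intro mult_left_mono sum_mono)
        fix m assume m: "m \<in> M"
        have "nsum (\<lambda>l. (b (j + m) l)\<^sup>2 * ?v j * nsum (\<lambda>k. ?w j k m l * ?J j i \<mu> k)) \<le>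
          nsum (\<lambda>l. nsum (\<lambda>\<nu>. ennreal (S * Cw * 4 ^ n) * (?om m \<nu> * ((b (j + m) l)\<^sup>2 * ?v (j + m) * ?J (j + m) (i + m) \<nu> l))))"
        proof (rule nn_integral_mono)
          fix l :: "int^'n"
          obtain \<nu> where \<nu>: "dyadic_cube N (j + m) l \<subseteq> dyadic_cube N (i + m) \<nu>"
            using dyadic_cube_nested[of "i + m" "j + m" N l] ij by auto
          have "?v j \<le> ennreal (4 ^ n * vol N (j + m) TYPE('n))"
            unfolding n_def using m M by (intro ennreal_leI vol_level) auto
          also have "\<dots> = ennreal (4 ^ n) * ?v (j + m)"
            using vol_pos[of N "j + m", where 'n='n] by (intro ennreal_mult) auto
          finally have vv: "?v j \<le> ennreal (4 ^ n) * ?v (j + m)" .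
          have "(b (j + m) l)\<^sup>2 * ?v j * nsum (\<lambda>k. ?w j k m l * ?J j i \<mu> k) \<le>
              (b (j + m) l)\<^sup>2 * (ennreal (4 ^ n) * ?v (j + m)) * (ennreal (S * Cw) * ?om m \<nu>)"
            by (intro mult_mono vv kernel[OF ij m \<nu>]) auto
          also have "\<dots> = ennreal (S * Cw * 4 ^ n) * (?om m \<nu> * ((b (j + m) l)\<^sup>2 * ?v (j + m) * ?J (j + m) (i + m) \<nu> l))"
          proof -
            have "ennreal (S * Cw * 4 ^ n) = ennreal (S * Cw) * ennreal (4 ^ n)" using S Cw by (intro ennreal_mult) auto
            moreover have "?J (j + m) (i + m) \<nu> l = 1" using \<nu> by simp
            ultimately show ?thesis by (simp only: mult_ac mult_1_left mult_1_right)
          qed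
          also have "\<dots> \<le> nsum (\<lambda>\<nu>. ennreal (S * Cw * 4 ^ n) * (?om m \<nu> * ((b (j + m) l)\<^sup>2 * ?v (j + m) * ?J (j + m) (i + m) \<nu> l)))"
            by (rule nsum_point)
          finally show "(b (j + m) l)\<^sup>2 * ?v j * nsum (\<lambda>k. ?w j k m l * ?J j i \<mu> k) \<le>
              nsum (\<lambda>\<nu>. ennreal (S * Cw * 4 ^ n) * (?om m \<nu> * ((b (j + m) l)\<^sup>2 * ?v (j + m) * ?J (j + m) (i + m) \<nu> l)))" .
        qed
        also have "\<dots> = ennreal (S * Cw * 4 ^ n) *
            nsum (\<lambda>\<nu>. ?om m \<nu> * nsum (\<lambda>l. (b (j + m) l)\<^sup>2 * ?v (j + m) * ?J (j + m) (i + m) \<nu> l))"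
          by (subst nsum_swap) (simp only: nsum_cmult)
        finally show "nsum (\<lambda>l. (b (j + m) l)\<^sup>2 * ?v j * nsum (\<lambda>k. ?w j k m l * ?J j i \<mu> k)) \<le>
            ennreal (S * Cw * 4 ^ n) *
            nsum (\<lambda>\<nu>. ?om m \<nu> * nsum (\<lambda>l. (b (j + m) l)\<^sup>2 * ?v (j + m) * ?J (j + m) (i + m) \<nu> l))" .
      qed simp
      also have "\<dots> = ennreal C1 * (\<Sum>m\<in>M. nsum (\<lambda>\<nu>. ?om m \<nu> * nsum (\<lambda>l. (b (j + m) l)\<^sup>2 * ?v (j + m) * ?J (j + m) (i + m) \<nu> l)))"
      proof -
        have "ennreal C1 = ennreal (max C0 0) * ennreal (S * Cw * 4 ^ n)"
          unfolding C1_def using S Cw by (intro ennreal_mult) auto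
        moreover have "ennreal (max C0 0) = ennreal C0" by (auto simp: max_def ennreal_neg)
        ultimately show ?thesis unfolding sum_distrib_left[symmetric] by (simp only: mult.assoc)
      qed
      finally show ?thesis .
    qed
    have "subtotal N a i \<mu> \<le> nsum (\<lambda>j. ennreal C1 * (\<Sum>m\<in>M. nsum (\<lambda>\<nu>. ?om m \<nu> *
        (nsum (\<lambda>l. (b (j + m) l)\<^sup>2 * ?v (j + m) * ?J (j + m) (i + m) \<nu> l) * indicator {i + m..} (j + m)))))"
      unfolding subtotal_def
    proof (rule nn_integral_mono)
      fix j
      show "nsum (\<lambda>k. (a j k)\<^sup>2 * ?v j * ?J j i \<mu> k) * indicator {i..} j \<le>
        ennreal C1 * (\<Sum>m\<in>M. nsum (\<lambda>\<nu>. ?om m \<nu> *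
        (nsum (\<lambda>l. (b (j + m) l)\<^sup>2 * ?v (j + m) * ?J (j + m) (i + m) \<nu> l) * indicator {i + m..} (j + m))))"
        using level[of j] by (cases "i \<le> j") auto
    qed
    also have "\<dots> = ennreal C1 * (\<Sum>m\<in>M. nsum (\<lambda>\<nu>. ?om m \<nu> * subtotal N b (i + m) \<nu>))"
    proof -
      have "nsum (\<lambda>j. nsum (\<lambda>\<nu>. ?om m \<nu> * (nsum (\<lambda>l. (b (j + m) l)\<^sup>2 * ?v (j + m) * ?J (j + m) (i + m) \<nu> l) * indicator {i + m..} (j + m)))) =
          nsum (\<lambda>\<nu>. ?om m \<nu> * subtotal N b (i + m) \<nu>)" for m
        unfolding subtotal_def
        by (subst nsum_swap)
          (simp only: nsum_cmult nsum_shift[where f="\<lambda>j. nsum (\<lambda>l. (b j l)\<^sup>2 * ?v j * ?J j (i + m) _ l) * indicator {i + m..} j"])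
      thus ?thesis unfolding nsum_cmult nsum_sum by (simp only:)
    qed
    finally show ?thesis .
  qed
  thus ?thesis using that[OF C1] unfolding q_def n_def by blast
qed

section \<open>Comparison of Carleson quantities\<close>

lemma ennsqrt_mono: "x \<le> y \<Longrightarrow> ennsqrt x \<le> ennsqrt y"
  by (auto simp: ennsqrt_def top_unique less_top intro!: ennreal_leI enn2real_mono)

lemma ennsqrt_le_iff: assumes "0 \<le> r" shows "ennsqrt x \<le> ennreal r \<longleftrightarrow> x \<le> ennreal (r\<^sup>2)"
proof (cases x)
  case (real t)
  thus ?thesis using assms by (simp add: ennsqrt_def ennreal_le_iff real_sqrt_le_iff' sqrt_le_D real_le_lsqrt)
qed (simp add: ennsqrt_def top_unique)

definition carleson_term :: "nat \<Rightarrow> (real^'n \<Rightarrow> real) \<Rightarrow> (int \<Rightarrow> (real^'n) set \<Rightarrow> ennreal) \<Rightarrow> int \<Rightarrow> int^'n \<Rightarrow> ennreal" where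
  "carleson_term N p a i \<mu> = emeasure lborel (dyadic_cube N i \<mu>) / (Lp_norm p (indicat_real (dyadic_cube N i \<mu>)))\<^sup>2 *
     subtotal N (\<lambda>j k. a j (dyadic_cube N j k)) i \<mu>"

lemma carleson_eq: "carleson N p a = (SUP (i, \<mu>). ennsqrt (carleson_term N p a i \<mu>))"
  unfolding carleson_def carleson_term_def subtotal_def Let_def infsum_eq_nsum emeasure_dyadic_cube ..

lemma carleson_mono:
  assumes "\<And>j k. a j (dyadic_cube N j k) \<le> b j (dyadic_cube N j k)"
  shows "carleson N p a \<le> carleson N p b"
  unfolding carleson_eq
proof (rule SUP_mono, clarify)
  fix i \<mu>
  have "subtotal N (\<lambda>j k. a j (dyadic_cube N j k)) i \<mu> \<le> subtotal N (\<lambda>j k. b j (dyadic_cube N j k)) i \<mu>"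
    unfolding subtotal_def by (intro nn_integral_mono mult_right_mono power_mono assms) auto
  hence "ennsqrt (carleson_term N p a i \<mu>) \<le> ennsqrt (carleson_term N p b i \<mu>)"
    unfolding carleson_term_def by (intro ennsqrt_mono mult_left_mono) auto
  thus "\<exists>q\<in>UNIV. ennsqrt (carleson_term N p a i \<mu>) \<le> (case q of (i, \<mu>) \<Rightarrow> ennsqrt (carleson_term N p b i \<mu>))"
    by (intro bexI[of _ "(i, \<mu>)"]) auto
qed

lemma cube_distance:
  fixes \<mu> \<nu> :: "int^'n"
  assumes m: "m \<in> {-2..2}" and x: "x \<in> dyadic_cube N i \<mu>" and y: "y \<in> dyadic_cube N (i + m) \<nu>"
  shows "norm (x - y) \<le> 2 powi (- i - int N) * (2 ^ N * (1 + 5 * real CARD('n)) * decay N i \<mu> (i + m) \<nu>)"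
proof -
  define n where "n = CARD('n)"
  define s :: real where "s = 2 powi (- i - int N)"
  define h :: real where "h = 2 powi (- i)"
  have h: "h > 0" by (simp add: h_def)
  define d where "d = norm (corner N (i + m) \<nu> - corner N i \<mu>)"
  have d0: "d \<ge> 0" by (simp add: d_def)
  have sh: "s * 2 ^ N = h" 
  proof -
    have "- i - int N + int N = - i" by linarith
    thus ?thesis using power_int_add[of "2::real" "- i - int N" "int N"] unfolding s_def h_def by (simp only:) simp
  qed
  have s0: "s > 0" by (simp add: s_def)
  have "1 \<le> (2::real) ^ N" by simp
  hence "s * 1 \<le> s * 2 ^ N" using s0 by (intro mult_left_mono) auto
  hence sle: "s \<le> h" by (simp add: sh)
  have 1: "norm (x - corner N i \<mu>) \<le> real n * s" unfolding n_def s_def by (rule dist_corner[OF x])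
  have "norm (y - corner N (i + m) \<nu>) \<le> real n * 2 powi (- (i + m) - int N)"
    unfolding n_def by (rule dist_corner[OF y])
  also have "2 powi (- (i + m) - int N) = 2 powi (- m) * s"
  proof -
    have "- m + (- i - int N) = - (i + m) - int N" by linarith
    thus ?thesis using power_int_add[of "2::real" "- m" "- i - int N"] unfolding s_def by (simp only:) simp
  qed
  also have "real n * (2 powi (- m) * s) \<le> real n * (2 powi 2 * s)"
    using m s0 by (intro mult_left_mono mult_right_mono power_int_increasing) auto
  finally have 2: "norm (y - corner N (i + m) \<nu>) \<le> 4 * real n * s" by simp
  have "x - y = (x - corner N i \<mu>) + (- (corner N (i + m) \<nu> - corner N i \<mu>) + - (y - corner N (i + m) \<nu>))" by simp
  hence "norm (x - y) \<le> norm (x - corner N i \<mu>) + norm (- (corner N (i + m) \<nu> - corner N i \<mu>) + - (y - corner N (i + m) \<nu>))"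
    by (metis norm_triangle_ineq)
  also have "\<dots> \<le> norm (x - corner N i \<mu>) + (norm (- (corner N (i + m) \<nu> - corner N i \<mu>)) + norm (- (y - corner N (i + m) \<nu>)))"
    by (intro add_left_mono norm_triangle_ineq)
  also have "\<dots> \<le> real n * s + (d + 4 * real n * s)"
    unfolding norm_minus_cancel d_def by (intro add_mono 1 2 order_refl)
  also have "\<dots> = 5 * real n * s + d" by simp
  also have "\<dots> \<le> 5 * real n * h + d" using sle by (intro add_right_mono mult_left_mono) auto
  also have "\<dots> \<le> (1 + 5 * real n) * (h + d)" using h d0 by (simp add: algebra_simps)
  also have "h + d = h * decay N i \<mu> (i + m) \<nu>"
  proof -
    have "h * 2 powi i = 1" unfolding h_def by (simp add: power_int_minus)
    thus ?thesis by (simp add: decay_def d_def distrib_left flip: mult.assoc)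
  qed
  finally show ?thesis unfolding sh[symmetric] s_def n_def by (simp add: mult_ac)
qed

lemma decay_sum:
  assumes Cw: "Cw \<ge> 0" "\<And>y::real^'n. nsum (\<lambda>k. ennreal (weight (corner N 0 k - y))) \<le> ennreal Cw" and m: "m \<in> {-2..2}"
  shows "nsum (\<lambda>\<nu>. ennreal (inverse (decay N i (\<mu>::int^'n) (i + m) \<nu> ^ (2 * CARD('n))))) \<le> ennreal (4 ^ (2 * CARD('n)) * Cw)"
proof -
  define n where "n = CARD('n)"
  let ?y = "(2 powi (i + m)) *\<^sub>R corner N i \<mu>"
  have "inverse (decay N i \<mu> (i + m) \<nu> ^ (2 * n)) \<le> 4 ^ (2 * n) * weight (corner N 0 \<nu> - ?y)" for \<nu>
  proof -
    define d where "d = norm (corner N (i + m) \<nu> - corner N i \<mu>)"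
    have d0: "d \<ge> 0" by (simp add: d_def)
    define u where "u = 1 + 2 powi (i + m) * d"
    have u1: "1 \<le> u" using d0 by (simp add: u_def)
    have "2 powi (i + m) * d = 2 powi m * (2 powi i * d)" by (simp add: power_int_add)
    also have "\<dots> \<le> 2 powi 2 * (2 powi i * d)"
      using m d0 by (intro mult_right_mono power_int_increasing) auto
    finally have "u \<le> 4 * decay N i \<mu> (i + m) \<nu>" by (simp add: u_def decay_def d_def)
    hence "u ^ (2 * n) \<le> 4 ^ (2 * n) * decay N i \<mu> (i + m) \<nu> ^ (2 * n)"
      unfolding power_mult_distrib[symmetric] using u1 by (intro power_mono) auto
    hence "inverse (decay N i \<mu> (i + m) \<nu> ^ (2 * n)) \<le> 4 ^ (2 * n) * inverse (u ^ (2 * n))"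
    proof -
      assume le: "u ^ (2 * n) \<le> 4 ^ (2 * n) * decay N i \<mu> (i + m) \<nu> ^ (2 * n)"
      have "0 < u ^ (2 * n)" using u1 by (intro zero_less_power) simp
      moreover have "0 < decay N i \<mu> (i + m) \<nu> ^ (2 * n)"
        by (intro zero_less_power less_le_trans[OF zero_less_one decay_ge1])
      ultimately show ?thesis using le by (simp add: field_simps)
    qed
    also have "inverse (u ^ (2 * n)) = weight (corner N 0 \<nu> - ?y)"
      unfolding u_def d_def n_def by (rule weight_level)
    finally show ?thesis .
  qed
  hence "nsum (\<lambda>\<nu>. ennreal (inverse (decay N i \<mu> (i + m) \<nu> ^ (2 * n)))) \<le>
      nsum (\<lambda>\<nu>. ennreal (4 ^ (2 * n)) * ennreal (weight (corner N 0 \<nu> - ?y)))"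
    by (intro nn_integral_mono) (simp add: ennreal_mult[symmetric] weight_nonneg ennreal_leI)
  also have "\<dots> = ennreal (4 ^ (2 * n)) * nsum (\<lambda>\<nu>. ennreal (weight (corner N 0 \<nu> - ?y)))" by (rule nsum_cmult)
  also have "\<dots> \<le> ennreal (4 ^ (2 * n)) * ennreal Cw" by (intro mult_left_mono Cw) simp
  also have "\<dots> = ennreal (4 ^ (2 * n) * Cw)" using Cw by (simp add: ennreal_mult)
  finally show ?thesis by (simp add: n_def)
qed

context exponent
begin

text \<open>Each subtotal of \<open>b\<close> is bounded through the Carleson quantity of \<open>b\<close> by the squared norm of its own
  cube; \<open>Lp_norm_indicator_growth\<close> replaces this norm by that of the cube under consideration at the
  cost of \<open>2 * \<kappa>\<close> orders of decay, and the last \<open>2 * CARD('n)\<close> orders make the sum over the cubes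
  converge.\<close>

lemma carleson_compare:
  obtains K where "K \<ge> 1" "\<And>a b :: int \<Rightarrow> (real^'n) set \<Rightarrow> ennreal. (\<And>j k. (a j (dyadic_cube N j k))\<^sup>2 \<le>
      ennreal C0 * (\<Sum>m\<in>{-2..2}. nsum (\<lambda>l. (b (j + m) (dyadic_cube N (j + m) l))\<^sup>2 *
        ennreal (inverse (decay N j k (j + m) l ^ (2 * CARD('n) + (2 * CARD('n) + 2 * \<kappa>))))))) \<Longrightarrow>
    carleson N p a \<le> ennreal K * carleson N p b"
proof -
  define n where "n = CARD('n)"
  have c4: "(0::real) \<le> 4 ^ n" by simp
  obtain Q where Q: "Q \<ge> 1" and growth: "\<And>P P' s D. P \<in> sets lebesgue \<Longrightarrow> P' \<in> sets lebesgue \<Longrightarrow> 0 < s \<Longrightarrow>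
    emeasure lebesgue P = ennreal (s ^ CARD('n)) \<Longrightarrow> emeasure lebesgue P' \<le> ennreal (4 ^ n * s ^ CARD('n)) \<Longrightarrow>
    1 \<le> D \<Longrightarrow> (\<And>x y. x \<in> P \<Longrightarrow> y \<in> P' \<Longrightarrow> norm (x - y) \<le> s * D) \<Longrightarrow>
    Lp_norm p (indicat_real P') \<le> ennreal (Q * D ^ \<kappa>) * Lp_norm p (indicat_real P)"
  proof (rule Lp_norm_indicator_growth[OF c4], goal_cases)
    case (1 Q) show ?case by (rule 1(1)[OF 1(2)], rule 1(3); assumption)
  qed
  obtain Cw where Cw: "Cw \<ge> 0" "\<And>y::real^'n. nsum (\<lambda>k. ennreal (weight (corner N 0 k - y))) \<le> ennreal Cw"
    using weight_corner_sum[of N, where 'n='n] by blast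
  obtain C1 where C1: "C1 \<ge> 0" and sub: "\<And>a b i \<mu>. (\<And>j k. (a j k)\<^sup>2 \<le> ennreal C0 * (\<Sum>m\<in>{-2..2}. nsum (\<lambda>l. (b (j + m) l)\<^sup>2 *
      ennreal (inverse (decay N j k (j + m) l ^ (2 * CARD('n) + (2 * CARD('n) + 2 * \<kappa>))))))) \<Longrightarrow>
    subtotal N a i (\<mu>::int^'n) \<le> ennreal C1 * (\<Sum>m\<in>{-2..2}. nsum (\<lambda>\<nu>.
      ennreal (inverse (decay N i \<mu> (i + m) \<nu> ^ (2 * CARD('n) + 2 * \<kappa>))) * subtotal N b (i + m) \<nu>))"
  proof (rule subtotal_bound[OF order_refl, where 'n='n and ?C0.0=C0 and N=N and \<kappa>="2 * \<kappa>"], goal_cases)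
    case (1 C1) show ?case by (rule 1(1)[OF 1(2)], rule 1(3); assumption)
  qed
  define G where "G = 4 ^ n * Q\<^sup>2 * (2 ^ N * (1 + 5 * real n)) ^ (2 * \<kappa>)"
  have G: "G \<ge> 0" by (simp add: G_def)
  define Z where "Z = C1 * (5 * (G * (4 ^ (2 * n) * Cw)))"
  have Z: "Z \<ge> 0" unfolding Z_def using C1 G Cw by simp
  \<comment> \<open>one is added to have \<open>Z \<le> K\<^sup>2\<close>\<close>
  define K where "K = 1 + Z"
  have K: "K \<ge> 1" using Z by (simp add: K_def)
  let ?P = "dyadic_cube N :: int \<Rightarrow> int^'n \<Rightarrow> (real^'n) set"
  let ?v = "\<lambda>i. vol N i TYPE('n)"
  define r where "r i \<mu> = enn2real (Lp_norm p (indicat_real (?P i \<mu>)))" for i \<mu>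
  have leb: "?P i \<mu> \<in> sets lebesgue" "emeasure lebesgue (?P i \<mu>) = ennreal (?v i)" for i \<mu>
    by (simp_all add: emeasure_dyadic_cube)
  have r: "Lp_norm p (indicat_real (?P i \<mu>)) = ennreal (r i \<mu>)" "r i \<mu> > 0" for i \<mu>
    using Lp_norm_indicator_less_top[OF leb vol_pos, of i \<mu>] Lp_norm_indicator_pos[OF leb vol_pos, of i \<mu>]
    by (auto simp: r_def enn2real_positive_iff)
  have term_eq: "carleson_term N p a i \<mu> = ennreal (?v i / (r i \<mu>)\<^sup>2) * subtotal N (\<lambda>j k. a j (?P j k)) i \<mu>" for a i \<mu>
    unfolding carleson_term_def r(1) emeasure_dyadic_cube
    using r(2)[of i \<mu>] vol_pos[of N i, where 'n='n] by (simp add: ennreal_power divide_ennreal less_imp_le)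
  have growth': "r (i + m) \<nu> \<le> Q * (2 ^ N * (1 + 5 * real n) * decay N i \<mu> (i + m) \<nu>) ^ \<kappa> * r i \<mu>"
    if m: "m \<in> {-2..2}" for i m \<mu> \<nu>
  proof -
    define D where "D = 2 ^ N * (1 + 5 * real n) * decay N i \<mu> (i + m) \<nu>"
    have D: "1 \<le> D"
    proof -
      have "1 * 1 * 1 \<le> D" unfolding D_def by (intro mult_mono decay_ge1) auto
      thus ?thesis by simp
    qed
    have "Lp_norm p (indicat_real (?P (i + m) \<nu>)) \<le> ennreal (Q * D ^ \<kappa>) * Lp_norm p (indicat_real (?P i \<mu>))"
    proof (rule growth[OF leb(1) leb(1)])
      show "0 < (2::real) powi (- i - int N)" by simp
      show "emeasure lebesgue (?P i \<mu>) = ennreal ((2 powi (- i - int N)) ^ CARD('n))"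
        unfolding leb(2) vol_def ..
      have "?v (i + m) \<le> 4 ^ n * ?v i"
        using vol_level[of "- m" N "i + m", where 'n='n] m by (simp add: n_def)
      thus "emeasure lebesgue (?P (i + m) \<nu>) \<le> ennreal (4 ^ n * (2 powi (- i - int N)) ^ CARD('n))"
        unfolding leb(2) vol_def[of N i] by (rule ennreal_leI)
      show "1 \<le> D" by (rule D)
      fix x y assume "x \<in> ?P i \<mu>" "y \<in> ?P (i + m) \<nu>"
      from cube_distance[OF m this] show "norm (x - y) \<le> 2 powi (- i - int N) * D"
        unfolding D_def n_def .
    qed
    hence "ennreal (r (i + m) \<nu>) \<le> ennreal (Q * D ^ \<kappa> * r i \<mu>)"
      unfolding r(1) using Q D r(2)[of i \<mu>] by (simp add: ennreal_mult)
    moreover have "0 \<le> Q * D ^ \<kappa> * r i \<mu>" using Q D r(2)[of i \<mu>] by simp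
    ultimately show ?thesis unfolding D_def[symmetric] by (simp add: ennreal_le_iff)
  qed
  have "carleson N p a \<le> ennreal K * carleson N p b"
    if hyp: "\<And>j k. (a j (?P j k))\<^sup>2 \<le>
      ennreal C0 * (\<Sum>m\<in>{-2..2}. nsum (\<lambda>l. (b (j + m) (?P (j + m) l))\<^sup>2 *
        ennreal (inverse (decay N j k (j + m) l ^ (2 * CARD('n) + (2 * CARD('n) + 2 * \<kappa>))))))" for a b
  proof (cases "carleson N p b")
    case (real I)
    have tb: "carleson_term N p b i \<mu> \<le> ennreal (I\<^sup>2)" for i \<mu>
    proof -
      have "ennsqrt (carleson_term N p b i \<mu>) \<le> carleson N p b"
        unfolding carleson_eq by (rule SUP_upper2[of "(i, \<mu>)"]) auto
      thus ?thesis using real ennsqrt_le_iff by simp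
    qed
    have sb: "subtotal N (\<lambda>j k. b j (?P j k)) i \<mu> \<le> ennreal (I\<^sup>2 * (r i \<mu>)\<^sup>2 / ?v i)" for i \<mu>
    proof -
      have v: "?v i > 0" by (rule vol_pos)
      have "ennreal ((r i \<mu>)\<^sup>2 / ?v i) * (ennreal (?v i / (r i \<mu>)\<^sup>2) * subtotal N (\<lambda>j k. b j (?P j k)) i \<mu>)
          \<le> ennreal ((r i \<mu>)\<^sup>2 / ?v i) * ennreal (I\<^sup>2)"
        using tb[of i \<mu>] unfolding term_eq by (rule mult_left_mono) simp
      moreover have "ennreal ((r i \<mu>)\<^sup>2 / ?v i) * ennreal (?v i / (r i \<mu>)\<^sup>2) = 1"
        using v r(2)[of i \<mu>] by (simp flip: ennreal_mult)
      moreover have "ennreal ((r i \<mu>)\<^sup>2 / ?v i) * ennreal (I\<^sup>2) = ennreal (I\<^sup>2 * (r i \<mu>)\<^sup>2 / ?v i)"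
        using v by (simp add: mult.commute flip: ennreal_mult)
      ultimately show ?thesis by (simp only: mult.assoc[symmetric] mult_1_left)
    qed
    have ta: "carleson_term N p a i \<mu> \<le> ennreal (I\<^sup>2 * Z)" for i \<mu>
    proof -
      have v: "?v i > 0" for i by (rule vol_pos)
      define w where "w = ?v i / (r i \<mu>)\<^sup>2"
      have w: "w \<ge> 0" unfolding w_def using v[of i] by simp
      have pt: "ennreal w * (ennreal (inverse (decay N i \<mu> (i + m) \<nu> ^ (2 * CARD('n) + 2 * \<kappa>))) * subtotal N (\<lambda>j k. b j (?P j k)) (i + m) \<nu>)
          \<le> ennreal (I\<^sup>2 * G) * ennreal (inverse (decay N i \<mu> (i + m) \<nu> ^ (2 * CARD('n))))"
        if m: "m \<in> {-2..2}" for m \<nu>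
      proof -
        define u where "u = decay N i \<mu> (i + m) \<nu>"
        have u: "1 \<le> u" unfolding u_def by (rule decay_ge1)
        define q where "q = 2 ^ N * (1 + 5 * real n)"
        have q: "q \<ge> 0" by (simp add: q_def)
        have "(r (i + m) \<nu>)\<^sup>2 \<le> (Q * (q * u) ^ \<kappa> * r i \<mu>)\<^sup>2"
          using growth'[OF m, of i \<nu> \<mu>] r(2)[of "i + m" \<nu>] unfolding q_def u_def by (intro power_mono) auto
        also have "\<dots> = Q\<^sup>2 * q ^ (2 * \<kappa>) * u ^ (2 * \<kappa>) * (r i \<mu>)\<^sup>2"
          by (simp add: power_mult_distrib power_even_eq mult.commute[of 2] power_mult)
        finally have r2: "(r (i + m) \<nu>)\<^sup>2 \<le> Q\<^sup>2 * q ^ (2 * \<kappa>) * u ^ (2 * \<kappa>) * (r i \<mu>)\<^sup>2" .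
        have "w * (inverse (u ^ (2 * n + 2 * \<kappa>)) * (I\<^sup>2 * (r (i + m) \<nu>)\<^sup>2 / ?v (i + m))) \<le>
            w * (inverse (u ^ (2 * n + 2 * \<kappa>)) * (I\<^sup>2 * (Q\<^sup>2 * q ^ (2 * \<kappa>) * u ^ (2 * \<kappa>) * (r i \<mu>)\<^sup>2) / ?v (i + m)))"
          using w u v[of "i + m"] r2 by (intro mult_left_mono divide_right_mono) auto
        also have "\<dots> = (?v i / ?v (i + m)) * (I\<^sup>2 * (Q\<^sup>2 * q ^ (2 * \<kappa>)) * inverse (u ^ (2 * n)))"
          unfolding w_def power_add using u r(2)[of i \<mu>] by (simp add: field_simps)
        also have "\<dots> \<le> 4 ^ n * (I\<^sup>2 * (Q\<^sup>2 * q ^ (2 * \<kappa>)) * inverse (u ^ (2 * n)))"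
          using vol_level[OF m, of N i, where 'n='n] v[of "i + m"] q u
          by (intro mult_right_mono) (auto simp: n_def pos_divide_le_eq)
        also have "\<dots> = I\<^sup>2 * G * inverse (u ^ (2 * n))" by (simp add: G_def q_def mult_ac)
        finally have le: "w * (inverse (u ^ (2 * n + 2 * \<kappa>)) * (I\<^sup>2 * (r (i + m) \<nu>)\<^sup>2 / ?v (i + m))) \<le> I\<^sup>2 * G * inverse (u ^ (2 * n))" .
        have "ennreal w * (ennreal (inverse (u ^ (2 * n + 2 * \<kappa>))) * subtotal N (\<lambda>j k. b j (?P j k)) (i + m) \<nu>) \<le>
            ennreal w * (ennreal (inverse (u ^ (2 * n + 2 * \<kappa>))) * ennreal (I\<^sup>2 * (r (i + m) \<nu>)\<^sup>2 / ?v (i + m)))"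
          by (intro mult_left_mono sb) auto
        also have "\<dots> = ennreal (w * (inverse (u ^ (2 * n + 2 * \<kappa>)) * (I\<^sup>2 * (r (i + m) \<nu>)\<^sup>2 / ?v (i + m))))"
        proof -
          have triple: "ennreal x * (ennreal y * ennreal z) = ennreal (x * (y * z))"
            if "0 \<le> x" "0 \<le> y" "0 \<le> z" for x y z
            using that by (simp add: ennreal_mult)
          show ?thesis by (rule triple) (use w u v[of "i + m"] in auto)
        qed
        also have "\<dots> \<le> ennreal (I\<^sup>2 * G * inverse (u ^ (2 * n)))" by (rule ennreal_leI[OF le])
        also have "\<dots> = ennreal (I\<^sup>2 * G) * ennreal (inverse (u ^ (2 * n)))"
          using G u by (intro ennreal_mult) auto
        finally show ?thesis by (simp only: u_def n_def)
      qed
      have "carleson_term N p a i \<mu> \<le> ennreal w * (ennreal C1 * (\<Sum>m\<in>{-2..2}. nsum (\<lambda>\<nu>.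
          ennreal (inverse (decay N i \<mu> (i + m) \<nu> ^ (2 * CARD('n) + 2 * \<kappa>))) * subtotal N (\<lambda>j k. b j (?P j k)) (i + m) \<nu>)))"
        unfolding term_eq w_def[symmetric] by (intro mult_left_mono sub hyp) simp
      also have "\<dots> = ennreal C1 * (\<Sum>m\<in>{-2..2}. nsum (\<lambda>\<nu>. ennreal w *
          (ennreal (inverse (decay N i \<mu> (i + m) \<nu> ^ (2 * CARD('n) + 2 * \<kappa>))) * subtotal N (\<lambda>j k. b j (?P j k)) (i + m) \<nu>)))"
        unfolding nsum_cmult sum_distrib_left[symmetric] by (rule mult.left_commute)
      also have "\<dots> \<le> ennreal C1 * (\<Sum>m\<in>{-2..2::int}. ennreal (I\<^sup>2 * G) * ennreal (4 ^ (2 * n) * Cw))"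
      proof (intro mult_left_mono sum_mono)
        fix m :: int assume m: "m \<in> {-2..2}"
        have "nsum (\<lambda>\<nu>. ennreal w *
          (ennreal (inverse (decay N i \<mu> (i + m) \<nu> ^ (2 * CARD('n) + 2 * \<kappa>))) * subtotal N (\<lambda>j k. b j (?P j k)) (i + m) \<nu>)) \<le>
          nsum (\<lambda>\<nu>. ennreal (I\<^sup>2 * G) * ennreal (inverse (decay N i \<mu> (i + m) \<nu> ^ (2 * CARD('n)))))"
          by (intro nn_integral_mono pt[OF m])
        also have "\<dots> = ennreal (I\<^sup>2 * G) * nsum (\<lambda>\<nu>. ennreal (inverse (decay N i \<mu> (i + m) \<nu> ^ (2 * CARD('n)))))"
          by (rule nsum_cmult)
        also have "\<dots> \<le> ennreal (I\<^sup>2 * G) * ennreal (4 ^ (2 * n) * Cw)"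
          unfolding n_def by (intro mult_left_mono decay_sum Cw m) simp
        finally show "nsum (\<lambda>\<nu>. ennreal w *
          (ennreal (inverse (decay N i \<mu> (i + m) \<nu> ^ (2 * CARD('n) + 2 * \<kappa>))) * subtotal N (\<lambda>j k. b j (?P j k)) (i + m) \<nu>)) \<le>
          ennreal (I\<^sup>2 * G) * ennreal (4 ^ (2 * n) * Cw)" .
      qed simp
      also have "\<dots> = ennreal (I\<^sup>2 * Z)"
      proof -
        have "(\<Sum>m\<in>{-2..2::int}. ennreal (I\<^sup>2 * G) * ennreal (4 ^ (2 * n) * Cw)) =
            (\<Sum>m\<in>{-2..2::int}. ennreal (I\<^sup>2 * G * (4 ^ (2 * n) * Cw)))"
          using G Cw by (intro sum.cong refl ennreal_mult[symmetric]) auto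
        also have "\<dots> = ennreal (\<Sum>m\<in>{-2..2::int}. I\<^sup>2 * G * (4 ^ (2 * n) * Cw))"
          using G Cw by (intro sum_ennreal) auto
        also have "\<dots> = ennreal (5 * (I\<^sup>2 * G * (4 ^ (2 * n) * Cw)))" by simp
        finally have "ennreal C1 * (\<Sum>m\<in>{-2..2::int}. ennreal (I\<^sup>2 * G) * ennreal (4 ^ (2 * n) * Cw)) =
            ennreal (C1 * (5 * (I\<^sup>2 * G * (4 ^ (2 * n) * Cw))))"
          using C1 G Cw by (simp only:) (intro ennreal_mult[symmetric], auto)
        moreover have "C1 * (5 * (I\<^sup>2 * G * (4 ^ (2 * n) * Cw))) = I\<^sup>2 * Z" by (simp add: Z_def mult_ac)
        ultimately show ?thesis by (simp only:)
      qed
      finally show ?thesis .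
    qed
    have "ennsqrt (carleson_term N p a i \<mu>) \<le> ennreal (K * I)" for i \<mu>
    proof -
      have "Z \<le> K\<^sup>2" using Z by (simp add: K_def power2_eq_square algebra_simps)
      hence "I\<^sup>2 * Z \<le> I\<^sup>2 * K\<^sup>2" by (rule mult_left_mono) simp
      hence "I\<^sup>2 * Z \<le> (K * I)\<^sup>2" by (simp add: power_mult_distrib mult.commute)
      hence "ennreal (I\<^sup>2 * Z) \<le> ennreal ((K * I)\<^sup>2)" by (rule ennreal_leI)
      with ta[of i \<mu>] have "carleson_term N p a i \<mu> \<le> ennreal ((K * I)\<^sup>2)" by (rule order_trans)
      thus ?thesis using ennsqrt_le_iff[of "K * I"] K real by simp
    qed
    hence "carleson N p a \<le> ennreal (K * I)" unfolding carleson_eq by (intro SUP_least) auto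
    thus ?thesis using K real by (simp add: ennreal_mult)
  next
    case top
    have "ennreal K * top = top" using K by (simp add: ennreal_mult_top)
    thus ?thesis using top by simp
  qed
  thus ?thesis using that[OF K] by blast
qed

end

section \<open>The comparison of suprema with infima\<close>

lemma conv_dist_tilde: "conv_dist (dilate j (tilde \<phi>)) f z = f (\<lambda>y. dilate j (\<lambda>x. cnj (\<phi> x)) (y - z))"
  by (simp add: conv_dist_def dilate_def tilde_def flip: scaleR_minus_right)

lemma I_le_U: "I_quantity N p \<phi> f \<le> U_quantity N p \<phi> f"
  unfolding I_quantity_def U_quantity_def
  by (rule carleson_mono) (rule INF_le_SUP, use corner_in_cube in blast)

text \<open>Take \<open>B\<close> to be the square root of the decaying sum of squared infima.  Each single infimum satisfies
  the hypothesis of \<open>pointwise_domination\<close> with this \<open>B\<close>, and \<open>L = 2 * CARD('n) + \<kappa>\<close> is half of the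
  order of decay required by \<open>carleson_compare\<close>.\<close>

lemma U_le_I:
  fixes p :: "real^'n \<Rightarrow> real" and \<phi> \<phi>' :: "real^'n \<Rightarrow> complex"
  assumes "exponent p a b H" and adm: "admissible \<phi>" "admissible \<phi>'"
  shows "\<exists>N0. \<forall>N\<ge>N0. \<exists>K\<ge>1. \<forall>f\<in>schwartz_inf_dual. U_quantity N p \<phi> f \<le> ennreal K * I_quantity N p \<phi>' f"
proof -
  interpret exponent p a b H by (rule assms(1))
  define n where "n = CARD('n)"
  define L where "L = 2 * n + \<kappa>"
  define \<Phi> where "\<Phi> = (\<lambda>x. cnj (\<phi> x))"
  define \<Phi>' where "\<Phi>' = (\<lambda>x. cnj (\<phi>' x))"
  obtain N0 :: nat and C :: real where C: "C \<ge> 0" and dom: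
    "\<And>N f j k z B. N \<ge> N0 \<Longrightarrow> functional f \<Longrightarrow> z \<in> dyadic_cube N j k \<Longrightarrow> 0 \<le> B \<Longrightarrow>
      (\<And>m l. m \<in> {-2..2} \<Longrightarrow>
        (INF z\<in>dyadic_cube N (j + m) l. ennreal (norm (f (\<lambda>y. dilate (j + m) \<Phi>' (y - z))))) \<le>
        ennreal (B * (1 + 2 powi j * norm (corner N (j + m) l - corner N j k)) ^ L)) \<Longrightarrow>
      norm (f (\<lambda>y. dilate j \<Phi> (y - z))) \<le> C * B"
    unfolding \<Phi>_def \<Phi>'_def
  proof (rule pointwise_domination[OF adm, of L], goal_cases)
    case (1 N0 C) show ?case by (rule 1(1)[OF 1(2)], rule 1(3); assumption)
  qed
  have "\<exists>K\<ge>1. \<forall>f\<in>schwartz_inf_dual. U_quantity N p \<phi> f \<le> ennreal K * I_quantity N p \<phi>' f" if N: "N \<ge> N0" for N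
  proof -
    obtain K where K: "K \<ge> 1" and comp: "\<And>a b :: int \<Rightarrow> (real^'n) set \<Rightarrow> ennreal. (\<And>j k. (a j (dyadic_cube N j k))\<^sup>2 \<le>
      ennreal (C\<^sup>2 + 1) * (\<Sum>m\<in>{-2..2}. nsum (\<lambda>l. (b (j + m) (dyadic_cube N (j + m) l))\<^sup>2 *
        ennreal (inverse (decay N j k (j + m) l ^ (2 * CARD('n) + (2 * CARD('n) + 2 * \<kappa>))))))) \<Longrightarrow>
      carleson N p a \<le> ennreal K * carleson N p b"
    proof (rule carleson_compare[where N=N and ?C0.0="C\<^sup>2 + 1"], goal_cases)
      case (1 K) show ?case by (rule 1(1)[OF 1(2)], rule 1(3); assumption)
    qed
    have "U_quantity N p \<phi> f \<le> ennreal K * I_quantity N p \<phi>' f" if f: "f \<in> schwartz_inf_dual" for f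
      unfolding U_quantity_def I_quantity_def
    proof (rule comp)
      fix j and k :: "int^'n"
      let ?b = "\<lambda>m l. INF z\<in>dyadic_cube N (j + m) l. ennreal (norm (conv_dist (dilate (j + m) (tilde \<phi>')) f z))"
      let ?T = "\<Sum>m\<in>{-2..2}. nsum (\<lambda>l. (?b m l)\<^sup>2 *
        ennreal (inverse (decay N j k (j + m) l ^ (2 * CARD('n) + (2 * CARD('n) + 2 * \<kappa>)))))"
      show "(SUP z\<in>dyadic_cube N j k. ennreal (norm (conv_dist (dilate j (tilde \<phi>)) f z)))\<^sup>2 \<le> ennreal (C\<^sup>2 + 1) * ?T"
      proof (cases ?T)
        case (real \<tau>)
        define B where "B = sqrt \<tau>"
        have B: "B \<ge> 0" "B\<^sup>2 = \<tau>" using real by (simp_all add: B_def)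
        have "norm (conv_dist (dilate j (tilde \<phi>)) f z) \<le> C * B" if z: "z \<in> dyadic_cube N j k" for z
          unfolding conv_dist_tilde \<Phi>_def[symmetric]
        proof (rule dom[OF N schwartz_inf_dual_functional[OF f] z B(1)])
          fix m :: int and l :: "int^'n" assume m: "m \<in> {-2..2}"
          define u where "u = decay N j k (j + m) l"
          have u: "1 \<le> u" unfolding u_def by (rule decay_ge1)
          have "?b m l \<le> ennreal (norm (conv_dist (dilate (j + m) (tilde \<phi>')) f (corner N (j + m) l)))"
            by (rule INF_lower) (rule corner_in_cube)
          hence "?b m l < top" by (rule le_less_trans) simp
          then obtain \<xi> where \<xi>: "?b m l = ennreal \<xi>" "\<xi> \<ge> 0" by (cases "?b m l") auto
          have "(?b m l)\<^sup>2 * ennreal (inverse (u ^ (2 * CARD('n) + (2 * CARD('n) + 2 * \<kappa>)))) \<le>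
              nsum (\<lambda>l. (?b m l)\<^sup>2 * ennreal (inverse (decay N j k (j + m) l ^ (2 * CARD('n) + (2 * CARD('n) + 2 * \<kappa>)))))"
            unfolding u_def by (rule nsum_point)
          also have "\<dots> \<le> ?T" using m by (intro member_le_sum) auto
          finally have "ennreal (\<xi>\<^sup>2 * inverse (u ^ (2 * L))) \<le> ennreal (B\<^sup>2)"
          proof -
            assume "(?b m l)\<^sup>2 * ennreal (inverse (u ^ (2 * CARD('n) + (2 * CARD('n) + 2 * \<kappa>)))) \<le> ?T"
            moreover have "2 * CARD('n) + (2 * CARD('n) + 2 * \<kappa>) = 2 * L" by (simp add: L_def n_def)
            ultimately show ?thesis
              unfolding \<xi>(1) real B(2) using \<xi>(2) u by (simp add: ennreal_mult ennreal_power)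
          qed
          hence "\<xi>\<^sup>2 * inverse (u ^ (2 * L)) \<le> B\<^sup>2" by (simp add: ennreal_le_iff)
          moreover have "0 < u ^ (2 * L)" using u by (intro zero_less_power) simp
          ultimately have "\<xi>\<^sup>2 \<le> B\<^sup>2 * u ^ (2 * L)"
            by (simp only: divide_inverse[symmetric] pos_divide_le_eq)
          also have "\<dots> = (B * u ^ L)\<^sup>2" by (simp only: power_mult_distrib power_even_eq)
          finally have "\<xi> \<le> B * u ^ L" by (rule power2_le_imp_le) (use B(1) u in simp)
          hence "?b m l \<le> ennreal (B * u ^ L)" unfolding \<xi>(1) by (rule ennreal_leI)
          thus "(INF z\<in>dyadic_cube N (j + m) l. ennreal (norm (f (\<lambda>y. dilate (j + m) \<Phi>' (y - z))))) \<le>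
              ennreal (B * (1 + 2 powi j * norm (corner N (j + m) l - corner N j k)) ^ L)"
            unfolding conv_dist_tilde \<Phi>'_def[symmetric] u_def decay_def .
        qed
        hence "(SUP z\<in>dyadic_cube N j k. ennreal (norm (conv_dist (dilate j (tilde \<phi>)) f z))) \<le> ennreal (C * B)"
          by (intro SUP_least ennreal_leI)
        hence "(SUP z\<in>dyadic_cube N j k. ennreal (norm (conv_dist (dilate j (tilde \<phi>)) f z)))\<^sup>2 \<le> (ennreal (C * B))\<^sup>2"
          by (rule power_mono) simp
        also have "\<dots> = ennreal (C\<^sup>2 * \<tau>)" using C B by (simp add: ennreal_power power_mult_distrib)
        also have "\<dots> \<le> ennreal ((C\<^sup>2 + 1) * \<tau>)" using real by (intro ennreal_leI mult_right_mono) auto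
        also have "\<dots> = ennreal (C\<^sup>2 + 1) * ?T" unfolding real using real by (intro ennreal_mult) auto
        finally show ?thesis .
      next
        case top
        \<comment> \<open>the summand one keeps the constant positive even for \<open>C = 0\<close>\<close>
        have "ennreal (C\<^sup>2 + 1) \<noteq> 0" by (simp add: add_nonneg_pos less_le_not_le)
        hence "ennreal (C\<^sup>2 + 1) * ?T = top" unfolding top by (simp add: ennreal_mult_top)
        thus ?thesis by (simp only: top_greatest)
      qed
    qed
    thus ?thesis using K by blast
  qed
  thus ?thesis by blast
qed

theorem theorem2p7:
  fixes p :: "real^'n \<Rightarrow> real" and \<phi> \<phi>' :: "real^'n \<Rightarrow> complex"
  assumes "p \<in> borel_measurable lebesgue" and "\<And>x. 0 < p x"
    and "log_hoelder p"
    and "0 < p_minus p" and "p_minus p \<le> p_plus p" and "p_plus p < \<infinity>"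
    and "\<phi> \<in> schwartz" and "\<phi>' \<in> schwartz"
    and "admissible \<phi>" and "admissible \<phi>'"
  shows "\<exists>N\<^sub>0>0. \<forall>N\<ge>N\<^sub>0. \<exists>C::real. C \<ge> 1 \<and>
    (\<forall>f\<in>schwartz_inf_dual.
       ennreal (inverse C) * I_quantity N p \<phi>' f \<le> U_quantity N p \<phi> f \<and>
       U_quantity N p \<phi> f \<le> ennreal C * I_quantity N p \<phi>' f)"
proof -
  obtain a b H where ex: "exponent p a b H"
    by (rule exponentI[OF assms(1,3,4,6)])
  obtain N1 where N1: "\<And>N. N \<ge> N1 \<Longrightarrow> \<exists>K\<ge>1. \<forall>f\<in>schwartz_inf_dual. U_quantity N p \<phi> f \<le> ennreal K * I_quantity N p \<phi>' f"
    using U_le_I[OF ex assms(9,10)] by blast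
  obtain N2 where N2: "\<And>N. N \<ge> N2 \<Longrightarrow> \<exists>K\<ge>1. \<forall>f\<in>schwartz_inf_dual. U_quantity N p \<phi>' f \<le> ennreal K * I_quantity N p \<phi> f"
    using U_le_I[OF ex assms(10,9)] by blast
  have "\<exists>C::real. C \<ge> 1 \<and> (\<forall>f\<in>schwartz_inf_dual.
       ennreal (inverse C) * I_quantity N p \<phi>' f \<le> U_quantity N p \<phi> f \<and>
       U_quantity N p \<phi> f \<le> ennreal C * I_quantity N p \<phi>' f)" if N: "N \<ge> max 1 (max N1 N2)" for N
  proof -
    obtain K1 where K1: "K1 \<ge> 1" "\<And>f. f \<in> schwartz_inf_dual \<Longrightarrow> U_quantity N p \<phi> f \<le> ennreal K1 * I_quantity N p \<phi>' f"
      using N1[of N] N by auto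
    obtain K2 where K2: "K2 \<ge> 1" "\<And>f. f \<in> schwartz_inf_dual \<Longrightarrow> U_quantity N p \<phi>' f \<le> ennreal K2 * I_quantity N p \<phi> f"
      using N2[of N] N by auto
    define C where "C = max K1 K2"
    have C: "C \<ge> 1" "K1 \<le> C" "K2 \<le> C" using K1(1) by (auto simp: C_def)
    have "ennreal (inverse C) * I_quantity N p \<phi>' f \<le> U_quantity N p \<phi> f" if f: "f \<in> schwartz_inf_dual" for f
    proof -
      have "I_quantity N p \<phi>' f \<le> ennreal K2 * U_quantity N p \<phi> f"
        by (rule order_trans[OF I_le_U order_trans[OF K2(2)[OF f] mult_left_mono[OF I_le_U]]]) simp
      also have "\<dots> \<le> ennreal C * U_quantity N p \<phi> f" by (intro mult_right_mono ennreal_leI C) simp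
      finally have "ennreal (inverse C) * I_quantity N p \<phi>' f \<le> ennreal (inverse C) * (ennreal C * U_quantity N p \<phi> f)"
        by (rule mult_left_mono) simp
      also have "\<dots> = U_quantity N p \<phi> f"
      proof -
        have "ennreal (inverse C) * ennreal C = 1" using C(1) by (simp flip: ennreal_mult)
        thus ?thesis by (simp flip: mult.assoc)
      qed
      finally show ?thesis .
    qed
    moreover have "U_quantity N p \<phi> f \<le> ennreal C * I_quantity N p \<phi>' f" if f: "f \<in> schwartz_inf_dual" for f
      by (rule order_trans[OF K1(2)[OF f]]) (intro mult_right_mono ennreal_leI C, simp)
    ultimately show ?thesis using C(1) by blast
  qed
  thus ?thesis by (intro exI[of _ "max 1 (max N1 N2)"]) auto
qed

end
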